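(* As $d\to\infty$, the spectral parameter of the $\mathbb{Z}^d$ lattice with periodic boundary condition is \[ \gamma_{\mathbb{Z}^d}=\frac{\pi^2}{d^2}\left(1+\frac{1}{2d}+O(d^{-2})\right), \] and, for each fixed $j\ge 0$, the parameters with open boundary condition are \[ \gamma_{\mathbb{Z}^d,j}=\frac{\pi^2}{2d^2}\left(1+\frac{3}{2d}+O_j(d^{-2})\right), \] and, uniformly in $j$ (that is, for all sufficiently large $d$ and all $0\le j<d$), \[ \gamma_{\mathbb{Z}^d,j}\ge\frac{\pi^2}{2d^2+d}. \] For each fixed $j$, as $d\to\infty$, \[ \Gamma_j=\frac{2d^3-(2j+3)d^2+O_j(d)}{\pi^2}. \] In particular, for all $d$ sufficiently large, the total variation mixing time of sandpile dynamics on $\mathbb{Z}^d$ is dominated by the bulk behavior, i.e. $\Gamma=\Gamma_0$, and $\Gamma=\frac{2d^3}{\pi^2}\left(1-\frac{3}{2d}+O(d^{-2})\right)$.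
   Context: $\mathscr{T}=\mathbb{Z}^d$ is the nearest neighbor lattice graph ($2d$-regular), with graph Laplacian $\Delta f(v)=2d\,f(v)-\sum_{w\sim v}f(w)$. $C^1(\mathscr{T})$ is the set of integer-valued finitely supported functions on $\mathbb{Z}^d$ with sum $0$. A real-valued $\xi\in\ell^2(\mathscr{T})$ is harmonic modulo 1 if $\Delta\xi$ is integer valued. $\xi\equiv0\bmod 1$ means $\xi$ is integer valued. The periodic boundary spectral parameter is \[\gamma_{\mathbb{Z}^d}=\inf\Big\{\sum_{x\in\mathbb{Z}^d}\big(1-\cos(2\pi\xi_x)\big):\xi\in\ell^2(\mathbb{Z}^d),\ \Delta\xi\in C^1(\mathscr{T}),\ \xi\not\equiv0\bmod1\Big\}.\] For $S\subset\{1,\dots,d\}$ let $\mathfrak{S}_S$ be the group generated by the reflections in the coordinate hyperplanes $\{x_i=0\}$, $i\in S$, and let $\mathscr{H}_S^2$ be the set of $\xi\in\ell^2(\mathbb{Z}^d)$ that are harmonic modulo 1 and anti-symmetric under reflection in each of these hyperplanes. The open boundary spectral parameters are, for $0\le j<d$, \[\gamma_{\mathbb{Z}^d,j}=\inf_{S\subset\{1,\dots,d\},\,|S|=j}\ \ \inf_{\xi\in\mathscr{H}^2_S,\ \xi\not\equiv0\bmod1}\ \ \sum_{x\in\mathbb{Z}^d/\mathfrak{S}_S}\big(1-\cos(2\pi\xi_x)\big),\] the sum being over $\mathfrak{S}_S$-orbits (the summand is constant on orbits). The spectral factors are $\Gamma_j=\frac{d-j}{\gamma_{\mathbb{Z}^d,j}}$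 for $0\le j<d$, and $\Gamma=\max_j\Gamma_j$; $\Gamma$ governs the asymptotic total variation mixing time with open boundary, and one says the bulk behavior controls (dominates) the total variation mixing time if $\Gamma=\Gamma_0$. $O_j$ denotes an implied constant that may depend on $j$. *)

theory Defs
  imports "HOL-Analysis.Analysis" "HOL-Algebra.Group_Action" "HOL-Algebra.Generated_Groups"
    "HOL-Library.Landau_Symbols"
begin

text \<open>
  The dimension \<open>d\<close> is a parameter that tends to infinity, so a point of \<open>\<int>\<^sup>d\<close> is an extensional
  function on \<open>{1..d}\<close>. Real functions on the lattice are total functions of which only the
  values on \<open>grid d\<close> matter.
\<close>

definition grid :: "nat \<Rightarrow> (nat \<Rightarrow> int) set" where
  "grid d = {1..d} \<rightarrow>\<^sub>E UNIV"

definition adjacent :: "nat \<Rightarrow> (nat \<Rightarrow> int) \<Rightarrow> (nat \<Rightarrow> int) \<Rightarrow> bool" where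
  "adjacent d v w \<longleftrightarrow> v \<in> grid d \<and> w \<in> grid d \<and> (\<Sum>i\<in>{1..d}. \<bar>v i - w i\<bar>) = 1"

definition laplacian :: "nat \<Rightarrow> ((nat \<Rightarrow> int) \<Rightarrow> real) \<Rightarrow> (nat \<Rightarrow> int) \<Rightarrow> real" where
  "laplacian d f v = 2 * real d * f v - (\<Sum>w | adjacent d v w. f w)"

definition zero_mod_1 :: "nat \<Rightarrow> ((nat \<Rightarrow> int) \<Rightarrow> real) \<Rightarrow> bool" where
  "zero_mod_1 d \<xi> \<longleftrightarrow> (\<forall>x\<in>grid d. \<xi> x \<in> \<int>)"

definition harmonic_mod_1 :: "nat \<Rightarrow> ((nat \<Rightarrow> int) \<Rightarrow> real) \<Rightarrow> bool" where
  "harmonic_mod_1 d \<xi> \<longleftrightarrow> (\<forall>x\<in>grid d. laplacian d \<xi> x \<in> \<int>)"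

definition ell2 :: "nat \<Rightarrow> ((nat \<Rightarrow> int) \<Rightarrow> real) set" where
  "ell2 d = {\<xi>. (\<lambda>x. (\<xi> x)\<^sup>2) summable_on grid d}"

definition C1 :: "nat \<Rightarrow> ((nat \<Rightarrow> int) \<Rightarrow> real) set" where
  "C1 d = {f. (\<forall>x\<in>grid d. f x \<in> \<int>) \<and> finite {x \<in> grid d. f x \<noteq> 0} \<and>
              (\<Sum>x | x \<in> grid d \<and> f x \<noteq> 0. f x) = 0}"

text \<open>
  The sets over which the infima below are taken are nonempty for all large \<open>d\<close>, which is all that
  asymptotic statements see. They can be empty in very low dimension (e.g. \<open>d = 1\<close>); there the
  real-valued infimum is an unspecified junk value.
\<close>

definition gamma_periodic :: "nat \<Rightarrow> real" where
  "gamma_periodic d =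
     (INF \<xi>\<in>{\<xi> \<in> ell2 d. laplacian d \<xi> \<in> C1 d \<and> \<not> zero_mod_1 d \<xi>}.
        \<Sum>\<^sub>\<infinity>x\<in>grid d. 1 - cos (2 * pi * \<xi> x))"

definition reflection :: "nat \<Rightarrow> nat \<Rightarrow> (nat \<Rightarrow> int) \<Rightarrow> (nat \<Rightarrow> int)" where
  "reflection d i = (\<lambda>x\<in>grid d. x(i := - x i))"

definition reflection_group :: "nat \<Rightarrow> nat set \<Rightarrow> ((nat \<Rightarrow> int) \<Rightarrow> (nat \<Rightarrow> int)) monoid" where
  "reflection_group d S =
     BijGroup (grid d) \<lparr>carrier := generate (BijGroup (grid d)) (reflection d ` S)\<rparr>"

definition grid_quotient :: "nat \<Rightarrow> nat set \<Rightarrow> (nat \<Rightarrow> int) set set" where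
  "grid_quotient d S = orbits (reflection_group d S) (grid d) (\<lambda>g. g)"

definition H2 :: "nat \<Rightarrow> nat set \<Rightarrow> ((nat \<Rightarrow> int) \<Rightarrow> real) set" where
  "H2 d S = {\<xi> \<in> ell2 d. harmonic_mod_1 d \<xi> \<and>
                          (\<forall>i\<in>S. \<forall>x\<in>grid d. \<xi> (reflection d i x) = - \<xi> x)}"

text \<open>
  For \<open>\<xi> \<in> H2 d S\<close> the summand is constant on each orbit (cosine is even), so the representative
  picked by \<open>SOME\<close> is irrelevant.
\<close>

definition orbit_sum :: "nat \<Rightarrow> nat set \<Rightarrow> ((nat \<Rightarrow> int) \<Rightarrow> real) \<Rightarrow> real" where
  "orbit_sum d S \<xi> = (\<Sum>\<^sub>\<infinity>X\<in>grid_quotient d S. 1 - cos (2 * pi * \<xi> (SOME x. x \<in> X)))"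

definition gamma_open :: "nat \<Rightarrow> nat \<Rightarrow> real" where
  "gamma_open d j =
     (INF S\<in>{S. S \<subseteq> {1..d} \<and> card S = j}.
        INF \<xi>\<in>{\<xi> \<in> H2 d S. \<not> zero_mod_1 d \<xi>}. orbit_sum d S \<xi>)"

definition spectral_factor :: "nat \<Rightarrow> nat \<Rightarrow> real" where
  "spectral_factor d j = (real d - real j) / gamma_open d j"

definition max_spectral_factor :: "nat \<Rightarrow> real" where
  "max_spectral_factor d = Max (spectral_factor d ` {..<d})"

definition bulk_controls_mixing :: "nat \<Rightarrow> bool" where
  "bulk_controls_mixing d \<longleftrightarrow> max_spectral_factor d = spectral_factor d 0"

end

theory Submission
  imports Defs "HOL-Probability.Probability" "HOL-Real_Asymp.Real_Asymp"
begin

text \<open>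
  Upper bounds: the antisymmetrised Green's function with pole in the open orthant is a competitor for
  \<open>gamma_open\<close>, and the difference of two Green's functions with neighbouring poles is one for
  \<open>gamma_periodic\<close>. Their square sums reduce to
  \<open>\<Sum>\<^sub>n (n + 1) p\<^sub>n\<close>, where \<open>p\<^sub>n\<close> is an \<open>n\<close>-step transition probability of the simple random walk.
  The exponential generating function of the walk counts is a product of modified Bessel functions
  \<open>I\<^sub>k\<close>, one for each coordinate, so this sum is the integral of \<open>t exp (- t) I\<^sub>0(t/d)\<^sup>d\<close>; the bounds
  \<open>I\<^sub>0(s) \<le> exp (s\<^sup>2 / 4)\<close> and \<open>I\<^sub>0(s) \<le> exp s / sqrt s\<close> evaluate it up to \<open>O(d\<^sup>-\<^sup>2)\<close>.

  Lower bounds: after reducing \<open>\<xi>\<close> to values in \<open>[-1/2, 1/2]\<close>, either its Laplacian has so many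
  support points that Cauchy-Schwarz around these points gives a square sum that is larger by a
  constant factor, or \<open>\<xi>\<close> is, by the maximum principle, an integer multiple of one of the competitors above.
\<close>

subsection \<open>The lattice Laplacian\<close>

text \<open>Both sides must agree to relative order 1/d, the size at which the periodic and the open
  parameter differ. From below the term 3/(2d) comes from walks of at most two steps: the return in
  two steps raises the Green's function at its pole by the relative amount 1/(2d), which counts
  twice in the square, and the 2d neighbours, each of relative height 1/(2d), add another 1/(2d).
  From above it is the integral of t^3 exp(-t) / (4d). In the periodic case the two poles double the
  main term, and their interaction as neighbours lowers 3/(2d) to 1/(2d). In the open case the
  reflected walk counts lie, on the orthant, between 0 and the free ones, so a single upper bound
  serves all \<open>S\<close>. Each antisymmetric coordinate costs the lower bound at most the
  relative amount 3/(4 d^2): this is invisible for fixed \<open>j\<close>, and for all j < d a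
  positive multiple of 1/d remains.\<close>

lemma has_sum_finite_sum:
  fixes f :: "'i \<Rightarrow> 'a \<Rightarrow> real"
  assumes "finite I" "\<And>i. i \<in> I \<Longrightarrow> (f i has_sum s i) A"
  shows "((\<lambda>x. \<Sum>i\<in>I. f i x) has_sum (\<Sum>i\<in>I. s i)) A"
  using assms by (induction I) (auto intro!: has_sum_add)

lemma has_sum_minus:
  fixes f g :: "'a \<Rightarrow> real"
  assumes "(f has_sum a) A" "(g has_sum b) A"
  shows "((\<lambda>x. f x - g x) has_sum (a - b)) A"
  using has_sum_add[OF assms(1) has_sum_uminusI[OF assms(2)]] by simp

definition nbsum :: "nat \<Rightarrow> ((nat \<Rightarrow> int) \<Rightarrow> 'a::comm_monoid_add) \<Rightarrow> (nat \<Rightarrow> int) \<Rightarrow> 'a" where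
  "nbsum d f v = (\<Sum>i\<in>{1..d}. f (v(i := v i + 1)) + f (v(i := v i - 1)))"

lemma grid_upd [simp]: "v \<in> grid d \<Longrightarrow> i \<in> {1..d} \<Longrightarrow> v(i := c) \<in> grid d"
  by (auto simp: grid_def PiE_def extensional_def)

lemma adjacent_iff:
  assumes v: "v \<in> grid d"
  shows "adjacent d v w \<longleftrightarrow> (\<exists>i\<in>{1..d}. w = v(i := v i + 1) \<or> w = v(i := v i - 1))"
proof
  assume a: "adjacent d v w"
  hence w: "w \<in> grid d" and s: "(\<Sum>i\<in>{1..d}. \<bar>v i - w i\<bar>) = 1"
    by (auto simp: adjacent_def)
  have "\<exists>i\<in>{1..d}. v i \<noteq> w i"
  proof (rule ccontr)
    assume "\<not> ?thesis"
    hence "(\<Sum>i\<in>{1..d}. \<bar>v i - w i\<bar>) = 0" by (intro sum.neutral) auto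
    with s show False by simp
  qed
  then obtain i where i: "i \<in> {1..d}" "v i \<noteq> w i" by blast
  have s': "\<bar>v i - w i\<bar> + (\<Sum>j\<in>{1..d}-{i}. \<bar>v j - w j\<bar>) = 1"
    using s i sum.remove[of "{1..d}" i "\<lambda>j. \<bar>v j - w j\<bar>"] by simp
  have "(\<Sum>j\<in>{1..d}-{i}. \<bar>v j - w j\<bar>) \<ge> 0" by (intro sum_nonneg) auto
  with s' i have d1: "\<bar>v i - w i\<bar> = 1" and z: "(\<Sum>j\<in>{1..d}-{i}. \<bar>v j - w j\<bar>) = 0" by linarith+
  from z have "\<forall>j\<in>{1..d}-{i}. \<bar>v j - w j\<bar> = 0"
    by (subst (asm) sum_nonneg_eq_0_iff) auto
  hence e: "w j = v j" if "j \<noteq> i" for j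
    using that v w by (cases "j \<in> {1..d}") (auto simp: grid_def PiE_def extensional_def)
  have "w i = v i + 1 \<or> w i = v i - 1" using d1 by linarith
  with e have "w = v(i := v i + 1) \<or> w = v(i := v i - 1)" by (auto simp: fun_eq_iff)
  with i show "\<exists>i\<in>{1..d}. w = v(i := v i + 1) \<or> w = v(i := v i - 1)" by blast
next
  assume "\<exists>i\<in>{1..d}. w = v(i := v i + 1) \<or> w = v(i := v i - 1)"
  then obtain i where i: "i \<in> {1..d}" and w: "w = v(i := v i + 1) \<or> w = v(i := v i - 1)" by blast
  have "(\<Sum>j\<in>{1..d}. \<bar>v j - w j\<bar>) = (\<Sum>j\<in>{1..d}. if j = i then 1 else 0)"
    using w by (intro sum.cong) auto
  also have "\<dots> = 1" using i by simp
  finally show "adjacent d v w" using v w i by (auto simp: adjacent_def)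
qed

lemma sum_adjacent:
  assumes v: "v \<in> grid d"
  shows "(\<Sum>w | adjacent d v w. f w) = nbsum d f v"
proof -
  let ?A = "(\<lambda>i. v(i := v i + 1)) ` {1..d}" and ?B = "(\<lambda>i. v(i := v i - 1)) ` {1..d}"
  have e: "{w. adjacent d v w} = ?A \<union> ?B" using adjacent_iff[OF v] by auto
  have ne: "v(i := v i + 1) \<noteq> v(j := v j - 1)" for i j
  proof
    assume "v(i := v i + 1) = v(j := v j - 1)"
    from fun_cong[OF this, of i] show False by (auto split: if_splits)
  qed
  have ia: "inj_on (\<lambda>i. v(i := v i + 1)) {1..d}"
  proof (rule inj_onI)
    fix i j assume "v(i := v i + 1) = v(j := v j + 1)"
    from fun_cong[OF this, of i] show "i = j" by (auto split: if_splits)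
  qed
  have ib: "inj_on (\<lambda>i. v(i := v i - 1)) {1..d}"
  proof (rule inj_onI)
    fix i j assume "v(i := v i - 1) = v(j := v j - 1)"
    from fun_cong[OF this, of i] show "i = j" by (auto split: if_splits)
  qed
  have "sum f (?A \<union> ?B) = sum f ?A + sum f ?B"
    using ne by (intro sum.union_disjoint) auto
  also have "sum f ?A = (\<Sum>i\<in>{1..d}. f (v(i := v i + 1)))"
    using sum.reindex[OF ia] by simp
  also have "sum f ?B = (\<Sum>i\<in>{1..d}. f (v(i := v i - 1)))"
    using sum.reindex[OF ib] by simp
  finally show ?thesis unfolding e nbsum_def sum.distrib .
qed

lemma laplacian_nbsum: "v \<in> grid d \<Longrightarrow> laplacian d f v = 2 * real d * f v - nbsum d f v"
  by (simp add: laplacian_def sum_adjacent)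

lemma nbsum_cong:
  assumes "v \<in> grid d" "\<And>w. w \<in> grid d \<Longrightarrow> f w = g w"
  shows "nbsum d f v = nbsum d g v"
  using assms unfolding nbsum_def by (intro sum.cong) auto

lemma nbsum_diff:
  fixes f :: "_ \<Rightarrow> real"
  shows "nbsum d (\<lambda>x. f x - g x) v = nbsum d f v - nbsum d g v"
  by (simp add: nbsum_def sum.distrib sum_subtractf algebra_simps)

lemma nbsum_mult:
  fixes c :: real shows "nbsum d (\<lambda>x. c * f x) v = c * nbsum d f v"
  by (simp add: nbsum_def sum_distrib_left algebra_simps)

lemma laplacian_diff:
  "v \<in> grid d \<Longrightarrow> laplacian d (\<lambda>x. f x - g x) v = laplacian d f v - laplacian d g v"
  by (simp add: laplacian_nbsum nbsum_diff algebra_simps)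

lemma laplacian_mult:
  "v \<in> grid d \<Longrightarrow> laplacian d (\<lambda>x. c * f x) v = c * laplacian d f v"
  by (simp add: laplacian_nbsum nbsum_mult algebra_simps)

lemma nbsum_Ints: "v \<in> grid d \<Longrightarrow> (\<And>x. x \<in> grid d \<Longrightarrow> f x \<in> \<int>) \<Longrightarrow> nbsum d f v \<in> \<int>"
  for f :: "_ \<Rightarrow> real"
  unfolding nbsum_def by (intro Ints_sum Ints_add) auto

lemma laplacian_Ints: "v \<in> grid d \<Longrightarrow> (\<And>x. x \<in> grid d \<Longrightarrow> f x \<in> \<int>) \<Longrightarrow> laplacian d f v \<in> \<int>"
  by (simp add: laplacian_nbsum nbsum_Ints)

lemma bij_betw_shift:
  assumes "i \<in> {1..d}"
  shows "bij_betw (\<lambda>v. v(i := v i + c)) (grid d) (grid d)"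
  by (rule bij_betw_byWitness[where f' = "\<lambda>v. v(i := v i - c)"]) (use assms in auto)

lemma has_sum_shift:
  assumes "i \<in> {1..d}"
  shows "((\<lambda>v. f (v(i := v i + c))) has_sum s) (grid d) \<longleftrightarrow> (f has_sum s) (grid d)"
  by (rule has_sum_reindex_bij_betw[OF bij_betw_shift[OF assms], of f])

text \<open>Summation by parts: each coordinate shift is a bijection of the grid and can be moved
  from one factor to the other. Finite support of \<open>f\<close> gives summability against an
  arbitrary \<open>g\<close>.\<close>

lemma nbsum_symmetric:
  fixes f g :: "(nat \<Rightarrow> int) \<Rightarrow> real"
  assumes fin: "finite {x \<in> grid d. f x \<noteq> 0}"
  shows "(\<lambda>u. f u * nbsum d g u) summable_on grid d"
    and "((\<lambda>u. nbsum d f u * g u) has_sum (\<Sum>\<^sub>\<infinity>u\<in>grid d. f u * nbsum d g u)) (grid d)"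
proof -
  have fs: "(\<lambda>u. f u * h u) summable_on grid d" for h
  proof -
    have "(\<lambda>u. f u * h u) summable_on {x \<in> grid d. f x \<noteq> 0}"
      using fin by (rule summable_on_finite)
    thus ?thesis by (rule summable_on_cong_neutral[THEN iffD1, rotated -1]) auto
  qed
  show "(\<lambda>u. f u * nbsum d g u) summable_on grid d" by (rule fs)
  have hs: "((\<lambda>u. f u * h u) has_sum (\<Sum>\<^sub>\<infinity>u\<in>grid d. f u * h u)) (grid d)" for h
    using fs by (rule has_sum_infsum)
  let ?s = "\<lambda>i c. (\<Sum>\<^sub>\<infinity>u\<in>grid d. f u * g (u(i := u i + c)))"
  have sh: "((\<lambda>u. f (u(i := u i - c)) * g u) has_sum ?s i c) (grid d)" if i: "i \<in> {1..d}" for i c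
  proof -
    have "((\<lambda>u. f ((u(i := u i + c))(i := (u(i := u i + c)) i - c)) * g (u(i := u i + c)))
      has_sum ?s i c) (grid d)"
      using hs[of "\<lambda>u. g (u(i := u i + c))"] by simp
    thus ?thesis by (subst (asm) has_sum_shift[OF i])
  qed
  have A: "((\<lambda>u. \<Sum>i\<in>{1..d}. f u * g (u(i := u i + 1)) + f u * g (u(i := u i + (-1))))
     has_sum (\<Sum>i\<in>{1..d}. ?s i 1 + ?s i (-1))) (grid d)"
    by (intro has_sum_finite_sum has_sum_add) (use hs in auto)
  have B: "((\<lambda>u. \<Sum>i\<in>{1..d}. f (u(i := u i - 1)) * g u + f (u(i := u i - (-1))) * g u)
     has_sum (\<Sum>i\<in>{1..d}. ?s i 1 + ?s i (-1))) (grid d)"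
    by (intro has_sum_finite_sum has_sum_add sh) auto
  have "(\<Sum>\<^sub>\<infinity>u\<in>grid d. f u * nbsum d g u) = (\<Sum>i\<in>{1..d}. ?s i 1 + ?s i (-1))"
    using infsumI[OF A] by (simp add: nbsum_def sum_distrib_left algebra_simps)
  moreover have "(\<lambda>u. \<Sum>i\<in>{1..d}. f (u(i := u i - 1)) * g u + f (u(i := u i - (-1))) * g u)
      = (\<lambda>u. nbsum d f u * g u)"
    unfolding nbsum_def sum_distrib_right by (simp add: algebra_simps)
  ultimately show "((\<lambda>u. nbsum d f u * g u) has_sum (\<Sum>\<^sub>\<infinity>u\<in>grid d. f u * nbsum d g u)) (grid d)"
    using B by simp
qed

text \<open>Self-adjointness tested against the constant 1, which the Laplacian kills. Hence
  subtracting a finitely supported function does not change the total of a Laplacian.\<close>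

lemma has_sum_laplacian_zero:
  assumes fin: "finite {x \<in> grid d. f x \<noteq> 0}"
  shows "(laplacian d f has_sum 0) (grid d)"
proof -
  have n1: "nbsum d (\<lambda>_. 1::real) u = 2 * real d" for u by (simp add: nbsum_def)
  have "((\<lambda>u. nbsum d f u * 1) has_sum (\<Sum>\<^sub>\<infinity>u\<in>grid d. f u * nbsum d (\<lambda>_. 1) u)) (grid d)"
    by (rule nbsum_symmetric(2)[OF fin])
  moreover have "((\<lambda>u. f u * nbsum d (\<lambda>_. 1) u) has_sum (\<Sum>\<^sub>\<infinity>u\<in>grid d. f u * nbsum d (\<lambda>_. 1) u)) (grid d)"
    by (rule has_sum_infsum[OF nbsum_symmetric(1)[OF fin]])
  ultimately have "((\<lambda>u. f u * nbsum d (\<lambda>_. 1) u - nbsum d f u * 1) has_sum 0) (grid d)"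
    using has_sum_minus by fastforce
  thus ?thesis
    by (rule has_sum_cong[THEN iffD1, rotated]) (simp add: n1 laplacian_nbsum)
qed

subsection \<open>Uniqueness of square summable solutions\<close>

lemma ell2_finite_ge:
  assumes "\<eta> \<in> ell2 d" "e > 0"
  shows "finite {x \<in> grid d. \<bar>\<eta> x\<bar> \<ge> e}"
proof -
  have "(\<lambda>x. (\<eta> x)\<^sup>2) summable_on grid d" using assms by (simp add: ell2_def)
  then obtain s where "((\<lambda>x. (\<eta> x)\<^sup>2) has_sum s) (grid d)" by (auto simp: summable_on_def)
  hence b: "(\<Sum>x\<in>F. (\<eta> x)\<^sup>2) \<le> s" if "finite F" "F \<subseteq> grid d" for F
    using that by (intro has_sum_mono_neutral[OF has_sum_finite]) auto
  show ?thesis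
  proof (rule ccontr)
    assume inf: "infinite {x \<in> grid d. \<bar>\<eta> x\<bar> \<ge> e}"
    obtain n :: nat where n: "real n * e\<^sup>2 > s"
      using reals_Archimedean3[of "e\<^sup>2"] assms(2) by auto
    obtain F where F: "F \<subseteq> {x \<in> grid d. \<bar>\<eta> x\<bar> \<ge> e}" "finite F" "card F = n"
      using infinite_arbitrarily_large[OF inf] by blast
    have "real n * e\<^sup>2 = (\<Sum>x\<in>F. e\<^sup>2)" using F by simp
    also have "\<dots> \<le> (\<Sum>x\<in>F. (\<eta> x)\<^sup>2)"
      using F assms(2) by (intro sum_mono) (auto simp: abs_le_square_iff[symmetric])
    also have "\<dots> \<le> s" using F by (intro b) auto
    finally show False using n by simp
  qed
qed

text \<open>Maximum principle. Square summability makes the maximum of the absolute value attained,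
  and at finitely many points only; one of these with largest first coordinate has a neighbour in
  direction 1 with a strictly smaller value, which contradicts the mean value property.\<close>

lemma ell2_harmonic_zero:
  assumes l2: "\<eta> \<in> ell2 d" and h: "\<And>x. x \<in> grid d \<Longrightarrow> laplacian d \<eta> x = 0" and d: "d \<ge> 1"
    and x: "x \<in> grid d"
  shows "\<eta> x = 0"
proof (rule ccontr)
  assume nz: "\<eta> x \<noteq> 0"
  let ?A = "{z \<in> grid d. \<bar>\<eta> z\<bar> \<ge> \<bar>\<eta> x\<bar>}"
  have fA: "finite ?A" using ell2_finite_ge[OF l2] nz by simp
  have xA: "x \<in> ?A" using x by simp
  define m where "m = Max ((\<lambda>z. \<bar>\<eta> z\<bar>) ` ?A)"
  have le: "\<bar>\<eta> z\<bar> \<le> m" if "z \<in> grid d" for z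
  proof (cases "z \<in> ?A")
    case True thus ?thesis unfolding m_def using fA by (intro Max_ge) auto
  next
    case False
    have "\<bar>\<eta> x\<bar> \<le> m" unfolding m_def using fA xA by (intro Max_ge) auto
    with False that show ?thesis by simp
  qed
  have "m \<in> (\<lambda>z. \<bar>\<eta> z\<bar>) ` ?A" unfolding m_def
    by (rule Max_in) (use fA xA in blast)+
  then obtain z0 where z0: "z0 \<in> grid d" "\<bar>\<eta> z0\<bar> = m" by auto
  let ?M = "{z \<in> grid d. \<bar>\<eta> z\<bar> = m}"
  have "\<bar>\<eta> x\<bar> \<le> m" using le x by simp
  hence fM: "finite ?M" by (intro finite_subset[OF _ fA]) auto
  define k where "k = Max ((\<lambda>z. z 1) ` ?M)"
  have "k \<in> (\<lambda>z. z 1) ` ?M" unfolding k_def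
    by (rule Max_in) (use fM z0 in blast)+
  then obtain y where y: "y \<in> grid d" "\<bar>\<eta> y\<bar> = m" "y 1 = k" by auto
  have 1: "(1::nat) \<in> {1..d}" using d by simp
  let ?y = "y(1 := y 1 + 1)"
  have yg: "?y \<in> grid d" using y 1 by simp
  have "\<bar>\<eta> ?y\<bar> \<noteq> m"
  proof
    assume "\<bar>\<eta> ?y\<bar> = m"
    hence "?y 1 \<in> (\<lambda>z. z 1) ` ?M" using yg by blast
    hence "?y 1 \<le> k" unfolding k_def using fM by (intro Max_ge) auto
    thus False using y by simp
  qed
  hence lt: "\<bar>\<eta> ?y\<bar> < m" using le[OF yg] by simp
  have "2 * real d * m = \<bar>nbsum d \<eta> y\<bar>"
  proof -
    have "2 * real d * \<eta> y = nbsum d \<eta> y" using h[OF y(1)] y by (simp add: laplacian_nbsum)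
    hence "\<bar>2 * real d * \<eta> y\<bar> = \<bar>nbsum d \<eta> y\<bar>" by simp
    thus ?thesis by (simp add: abs_mult y(2))
  qed
  also have "\<dots> \<le> (\<Sum>i\<in>{1..d}. \<bar>\<eta> (y(i := y i + 1))\<bar> + \<bar>\<eta> (y(i := y i - 1))\<bar>)"
    unfolding nbsum_def by (rule order_trans[OF sum_abs]) (intro sum_mono abs_triangle_ineq)
  also have "\<dots> < (\<Sum>i\<in>{1..d}. 2 * m)"
  proof (rule sum_strict_mono_ex1)
    show "\<forall>i\<in>{1..d}. \<bar>\<eta> (y(i := y i + 1))\<bar> + \<bar>\<eta> (y(i := y i - 1))\<bar> \<le> 2 * m"
    proof
      fix i assume i: "i \<in> {1..d}"
      have "\<bar>\<eta> (y(i := y i + 1))\<bar> \<le> m" "\<bar>\<eta> (y(i := y i - 1))\<bar> \<le> m" using y i le by auto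
      thus "\<bar>\<eta> (y(i := y i + 1))\<bar> + \<bar>\<eta> (y(i := y i - 1))\<bar> \<le> 2 * m" by simp
    qed
    have "\<bar>\<eta> (y(1 := y 1 - 1))\<bar> \<le> m" using y 1 le by auto
    thus "\<exists>i\<in>{1..d}. \<bar>\<eta> (y(i := y i + 1))\<bar> + \<bar>\<eta> (y(i := y i - 1))\<bar> < 2 * m"
      using lt 1 by (intro bexI[of _ 1]) linarith+
  qed simp
  finally show False by simp
qed

subsection \<open>Reflections and their orbits\<close>

definition orthant :: "nat \<Rightarrow> nat set \<Rightarrow> (nat \<Rightarrow> int) set" where
  "orthant d S = {x \<in> grid d. \<forall>i\<in>S. 0 \<le> x i}"

definition fold_abs :: "nat set \<Rightarrow> (nat \<Rightarrow> int) \<Rightarrow> (nat \<Rightarrow> int)" where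
  "fold_abs S x = (\<lambda>i. if i \<in> S then \<bar>x i\<bar> else x i)"

lemma fold_abs_grid: "S \<subseteq> {1..d} \<Longrightarrow> x \<in> grid d \<Longrightarrow> fold_abs S x \<in> grid d"
  by (auto simp: grid_def PiE_def extensional_def fold_abs_def)

lemma fold_abs_orthant: "S \<subseteq> {1..d} \<Longrightarrow> x \<in> grid d \<Longrightarrow> fold_abs S x \<in> orthant d S"
  using fold_abs_grid[of S d x] by (auto simp: orthant_def fold_abs_def)

lemma reflection_eq: "x \<in> grid d \<Longrightarrow> reflection d i x = x(i := - x i)"
  by (simp add: reflection_def)

text \<open>Flips the negative coordinates in \<open>S\<close> one at a time, so that a property
  stable under single reflections reaches the representative in the orthant.\<close>

lemma fold_abs_induct:
  assumes S: "S \<subseteq> {1..d}" and x: "x \<in> grid d" and P: "P x"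
    and step: "\<And>i z. i \<in> S \<Longrightarrow> z \<in> grid d \<Longrightarrow> P z \<Longrightarrow> P (z(i := - z i))"
  shows "P (fold_abs S x)"
proof -
  have "finite S" using S finite_subset by blast
  have "T \<subseteq> S \<Longrightarrow> P (fold_abs T x)" if "finite T" for T
    using that
  proof (induction T)
    case empty
    have "fold_abs {} x = x" by (auto simp: fold_abs_def)
    thus ?case using P by simp
  next
    case (insert i T)
    let ?z = "fold_abs T x"
    have z: "?z \<in> grid d" "P ?z" "i \<in> S" using insert fold_abs_grid S x by auto
    have e: "fold_abs (insert i T) x = (if x i \<ge> 0 then ?z else ?z(i := - ?z i))"
      using insert.hyps by (auto simp: fold_abs_def fun_eq_iff)
    show ?case unfolding e using z step[of i ?z] by simp
  qed
  thus ?thesis using \<open>finite S\<close> by blast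
qed

lemma reflection_invariant_fold_abs:
  assumes S: "S \<subseteq> {1..d}" and x: "x \<in> grid d"
    and inv: "\<And>i z. i \<in> S \<Longrightarrow> z \<in> grid d \<Longrightarrow> c (reflection d i z) = c z"
  shows "c (fold_abs S x) = c x"
  by (rule fold_abs_induct[OF S x, of "\<lambda>z. c z = c x"])
     (use inv in \<open>auto simp: reflection_eq\<close>)

lemma reflection_Bij: "i \<in> {1..d} \<Longrightarrow> reflection d i \<in> carrier (BijGroup (grid d))"
  unfolding BijGroup_def Bij_def
  by (auto simp: reflection_def intro!: bij_betw_byWitness[where f' = "\<lambda>v. v(i := - v i)"])

lemma BijGroup_mult:
  "g \<in> carrier (BijGroup E) \<Longrightarrow> h \<in> carrier (BijGroup E) \<Longrightarrow> x \<in> E \<Longrightarrow> (g \<otimes>\<^bsub>BijGroup E\<^esub> h) x = g (h x)"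
  by (simp add: BijGroup_def compose_def)

lemma BijGroup_one: "x \<in> E \<Longrightarrow> \<one>\<^bsub>BijGroup E\<^esub> x = x"
  by (simp add: BijGroup_def)

lemma inv_reflection:
  assumes "i \<in> {1..d}"
  shows "inv\<^bsub>BijGroup (grid d)\<^esub> reflection d i = reflection d i"
proof -
  interpret group "BijGroup (grid d)" by (rule group_BijGroup)
  have m: "reflection d i \<in> carrier (BijGroup (grid d))" using assms by (rule reflection_Bij)
  have "reflection d i \<otimes>\<^bsub>BijGroup (grid d)\<^esub> reflection d i = \<one>\<^bsub>BijGroup (grid d)\<^esub>"
    using m assms by (auto simp: BijGroup_def compose_def reflection_def restrict_def fun_eq_iff)
  thus ?thesis using m inv_equality by blast
qed

text \<open>Generators and their inverses preserve \<open>fold_abs\<close>. Conversely, two points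
  with the same fold are each carried to it by a group element, and composing one with the inverse
  of the other joins them.\<close>

lemma orbit_eq:
  assumes S: "S \<subseteq> {1..d}" and x: "x \<in> grid d"
  shows "orbit (reflection_group d S) (\<lambda>g. g) x = {y \<in> grid d. fold_abs S y = fold_abs S x}"
proof -
  let ?G = "BijGroup (grid d)"
  interpret group ?G by (rule group_BijGroup)
  have sub: "reflection d ` S \<subseteq> carrier ?G" using S reflection_Bij by blast
  have gc: "generate ?G (reflection d ` S) \<subseteq> carrier ?G" using generate_incl[OF sub] .
  have refl_inv: "reflection d i z \<in> grid d \<and> fold_abs S (reflection d i z) = fold_abs S z"
    if "i \<in> S" "z \<in> grid d" for i z
    using that S by (auto simp: reflection_eq fold_abs_def fun_eq_iff subset_iff)
  have A: "\<forall>z\<in>grid d. g z \<in> grid d \<and> fold_abs S (g z) = fold_abs S z"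
    if "g \<in> generate ?G (reflection d ` S)" for g
    using that
  proof (induction g rule: generate.induct)
    case one thus ?case by (simp add: BijGroup_one)
  next
    case (incl h) thus ?case using refl_inv by auto
  next
    case (inv h)
    then obtain i where "i \<in> S" "h = reflection d i" by auto
    thus ?case using refl_inv inv_reflection[of i d] S by auto
  next
    case (eng h1 h2)
    thus ?case using BijGroup_mult[of h1 "grid d" h2] gc by (auto simp: subset_iff)
  qed
  let ?O = "(\<lambda>g. g x) ` generate ?G (reflection d ` S)"
  have orb: "orbit (reflection_group d S) (\<lambda>g. g) x = ?O"
    by (auto simp: orbit_def reflection_group_def)
  have step: "z(i := - z i) \<in> (\<lambda>g. g w) ` generate ?G (reflection d ` S)"
    if "i \<in> S" "z \<in> (\<lambda>g. g w) ` generate ?G (reflection d ` S)" "w \<in> grid d" for i z w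
  proof -
    from that obtain g where g: "g \<in> generate ?G (reflection d ` S)" "z = g w" by auto
    have r: "reflection d i \<in> generate ?G (reflection d ` S)" using that by (intro generate.incl) auto
    have "reflection d i \<otimes>\<^bsub>?G\<^esub> g \<in> generate ?G (reflection d ` S)"
      using r g by (intro generate.eng)
    moreover have "(reflection d i \<otimes>\<^bsub>?G\<^esub> g) w = z(i := - z i)"
      using BijGroup_mult[of "reflection d i" "grid d" g w] r g gc that A by (auto simp: reflection_eq)
    ultimately show ?thesis by (metis imageI)
  qed
  have fo: "fold_abs S w \<in> (\<lambda>g. g w) ` generate ?G (reflection d ` S)" if w: "w \<in> grid d" for w
  proof (rule fold_abs_induct[OF S w])
    show "w \<in> (\<lambda>g. g w) ` generate ?G (reflection d ` S)"
      using generate.one[of ?G "reflection d ` S"] BijGroup_one[OF w] by (metis imageI)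
  qed (use step w in blast)
  have "?O = {y \<in> grid d. fold_abs S y = fold_abs S x}"
  proof (intro equalityI subsetI)
    fix y assume "y \<in> ?O" thus "y \<in> {y \<in> grid d. fold_abs S y = fold_abs S x}" using A x by auto
  next
    fix y assume "y \<in> {y \<in> grid d. fold_abs S y = fold_abs S x}"
    hence y: "y \<in> grid d" and e: "fold_abs S y = fold_abs S x" by auto
    from fo[OF y] obtain g where g: "g \<in> generate ?G (reflection d ` S)" "fold_abs S y = g y"
      by (elim imageE)
    from fo[OF x] obtain h where h: "h \<in> generate ?G (reflection d ` S)" "fold_abs S x = h x"
      by (elim imageE)
    have ig: "inv\<^bsub>?G\<^esub> g \<in> generate ?G (reflection d ` S)"
      using generate_m_inv_closed[OF sub g(1)] .
    have "inv\<^bsub>?G\<^esub> g \<otimes>\<^bsub>?G\<^esub> h \<in> generate ?G (reflection d ` S)"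
      using ig h by (intro generate.eng)
    moreover have "(inv\<^bsub>?G\<^esub> g \<otimes>\<^bsub>?G\<^esub> h) x = y"
    proof -
      have "(inv\<^bsub>?G\<^esub> g \<otimes>\<^bsub>?G\<^esub> h) x = (inv\<^bsub>?G\<^esub> g) (h x)"
        using BijGroup_mult[of "inv\<^bsub>?G\<^esub> g" "grid d" h x] ig h gc x by auto
      also have "h x = g y" using e g h by simp
      also have "(inv\<^bsub>?G\<^esub> g) (g y) = (inv\<^bsub>?G\<^esub> g \<otimes>\<^bsub>?G\<^esub> g) y"
        using BijGroup_mult[of "inv\<^bsub>?G\<^esub> g" "grid d" g y] ig g gc y by auto
      also have "\<dots> = y" using g gc y by (subst l_inv) (auto simp: BijGroup_one)
      finally show ?thesis .
    qed
    ultimately show "y \<in> ?O" by (metis imageI)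
  qed
  with orb show ?thesis by simp
qed

text \<open>The closed orthant, walls included, meets every orbit exactly once. From here on the
  quotient sum is an ordinary sum over a subset of the grid.\<close>

lemma orbit_sum_orthant:
  assumes S: "S \<subseteq> {1..d}" and \<xi>: "\<xi> \<in> H2 d S"
  shows "orbit_sum d S \<xi> = (\<Sum>\<^sub>\<infinity>x\<in>orthant d S. 1 - cos (2 * pi * \<xi> x))"
proof -
  let ?c = "\<lambda>x. 1 - cos (2 * pi * \<xi> x)"
  let ?o = "\<lambda>x. {y \<in> grid d. fold_abs S y = fold_abs S x}"
  have fo: "fold_abs S x = x" if "x \<in> orthant d S" for x
    using that by (auto simp: orthant_def fold_abs_def)
  have gq: "grid_quotient d S = ?o ` orthant d S"
  proof -
    have "grid_quotient d S = ?o ` grid d"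
    proof -
      have "grid_quotient d S = (\<lambda>x. orbit (reflection_group d S) (\<lambda>g. g) x) ` grid d"
        by (auto simp: grid_quotient_def orbits_def)
      also have "\<dots> = ?o ` grid d" by (rule image_cong[OF refl]) (rule orbit_eq[OF S])
      finally show ?thesis .
    qed
    also have "\<dots> = ?o ` orthant d S"
    proof (intro equalityI subsetI)
      fix X assume "X \<in> ?o ` grid d"
      then obtain x where x: "x \<in> grid d" "X = ?o x" by auto
      have "fold_abs S (fold_abs S x) = fold_abs S x" by (auto simp: fold_abs_def)
      hence "?o x = ?o (fold_abs S x)" by simp
      thus "X \<in> ?o ` orthant d S" using x fold_abs_orthant[OF S x(1)] by blast
    qed (auto simp: orthant_def)
    finally show ?thesis .
  qed
  have inj: "inj_on ?o (orthant d S)"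
  proof (rule inj_onI)
    fix x y assume x: "x \<in> orthant d S" and y: "y \<in> orthant d S" and e: "?o x = ?o y"
    have "x \<in> ?o x" using x by (auto simp: orthant_def)
    hence "fold_abs S x = fold_abs S y" using e by auto
    thus "x = y" using fo x y by simp
  qed
  have c: "?c (fold_abs S x) = ?c x" if "x \<in> grid d" for x
    using S that
  proof (rule reflection_invariant_fold_abs)
    fix i z assume "i \<in> S" "z \<in> grid d"
    hence "\<xi> (reflection d i z) = - \<xi> z" using \<xi> by (auto simp: H2_def)
    thus "?c (reflection d i z) = ?c z" by simp
  qed
  have some: "?c (SOME y. y \<in> ?o x) = ?c x" if x: "x \<in> orthant d S" for x
  proof -
    have "x \<in> ?o x" using x by (auto simp: orthant_def)
    hence "(SOME y. y \<in> ?o x) \<in> ?o x" by (rule someI[where P = "\<lambda>y. y \<in> ?o x"])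
    hence "(SOME y. y \<in> ?o x) \<in> grid d" "fold_abs S (SOME y. y \<in> ?o x) = fold_abs S x" by auto
    thus ?thesis using c[of "SOME y. y \<in> ?o x"] fo[OF x] by metis
  qed
  have "orbit_sum d S \<xi> = (\<Sum>\<^sub>\<infinity>x\<in>orthant d S. ?c (SOME y. y \<in> ?o x))"
    unfolding orbit_sum_def gq by (subst infsum_reindex[OF inj]) (simp add: o_def)
  also have "\<dots> = (\<Sum>\<^sub>\<infinity>x\<in>orthant d S. ?c x)"
    by (rule infsum_cong) (rule some)
  finally show ?thesis .
qed

lemma nbsum_reflect:
  assumes "v \<in> grid d" "i \<in> {1..d}" 
  shows "nbsum d f (v(i := - v i)) = nbsum d (\<lambda>x. f (x(i := - x i))) v"
  unfolding nbsum_def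
proof (rule sum.cong[OF refl])
  fix k assume "k \<in> {1..d}"
  show "f ((v(i := - v i))(k := (v(i := - v i)) k + 1)) + f ((v(i := - v i))(k := (v(i := - v i)) k - 1))
    = f ((v(k := v k + 1))(i := - (v(k := v k + 1)) i)) + f ((v(k := v k - 1))(i := - (v(k := v k - 1)) i))"
  proof (cases "k = i")
    case True
    have e: "- v i - 1 = - (v i + 1)" "- v i + 1 = - (v i - 1)" by simp_all
    from True show ?thesis by (simp only: fun_upd_same fun_upd_upd e add.commute[of "f (v(i := - (v i + 1)))"])
  next
    case False thus ?thesis by (simp add: fun_upd_twist)
  qed
qed

definition antisymmetric :: "nat \<Rightarrow> nat set \<Rightarrow> ((nat \<Rightarrow> int) \<Rightarrow> real) \<Rightarrow> bool" where
  "antisymmetric d S f \<longleftrightarrow> (\<forall>i\<in>S. \<forall>x\<in>grid d. f (x(i := - x i)) = - f x)"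

lemma H2_iff: "\<xi> \<in> H2 d S \<longleftrightarrow> \<xi> \<in> ell2 d \<and> harmonic_mod_1 d \<xi> \<and> antisymmetric d S \<xi>"
  by (auto simp: H2_def antisymmetric_def reflection_eq)

lemma antisymmetric_laplacian:
  assumes S: "S \<subseteq> {1..d}" and a: "antisymmetric d S f"
  shows "antisymmetric d S (laplacian d f)"
  unfolding antisymmetric_def
proof (intro ballI)
  fix i x assume i: "i \<in> S" and x: "x \<in> grid d"
  hence i': "i \<in> {1..d}" using S by auto
  have "nbsum d f (x(i := - x i)) = nbsum d (\<lambda>z. - 1 * f z) x"
    unfolding nbsum_reflect[OF x i'] using a i x
    by (intro nbsum_cong) (auto simp: antisymmetric_def)
  also have "\<dots> = - nbsum d f x" by (subst nbsum_mult) simp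
  finally show "laplacian d f (x(i := - x i)) = - laplacian d f x"
    using x i' i a by (simp add: laplacian_nbsum antisymmetric_def)
qed

lemma antisymmetric_zero_on_wall:
  assumes "antisymmetric d S f" "i \<in> S" "x \<in> grid d" "x i = 0"
  shows "f x = 0"
proof -
  have "x(i := - x i) = x" using assms by (auto simp: fun_eq_iff)
  moreover have "f (x(i := - x i)) = - f x" using assms unfolding antisymmetric_def by blast
  ultimately show ?thesis by simp
qed

lemma antisymmetric_zeroI:
  assumes S: "S \<subseteq> {1..d}" and a: "antisymmetric d S f"
    and z: "\<And>x. x \<in> orthant d S \<Longrightarrow> f x = 0" and x: "x \<in> grid d"
  shows "f x = 0"
proof -
  have "\<bar>f (fold_abs S x)\<bar> = \<bar>f x\<bar>"
    by (rule reflection_invariant_fold_abs[OF S x])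
       (use a in \<open>simp add: reflection_eq antisymmetric_def del: fun_upd_apply\<close>)
  thus ?thesis using z fold_abs_orthant[OF S x] by auto
qed

text \<open>The sign constraints are removed one by one: \<open>orthant d T\<close> is the union of
  \<open>orthant d (insert i T)\<close> and its mirror image. The two overlap in the wall, which is
  harmless because only summability is claimed.\<close>

lemma summable_on_grid_from_orthant:
  fixes f :: "(nat \<Rightarrow> int) \<Rightarrow> real"
  assumes S: "S \<subseteq> {1..d}" and f: "f summable_on orthant d S"
    and inv: "\<And>i z. i \<in> S \<Longrightarrow> z \<in> grid d \<Longrightarrow> f (z(i := - z i)) = f z"
  shows "f summable_on grid d"
proof -
  have fin: "finite S" using S finite_subset by blast
  have "f summable_on orthant d T" if "finite U" "U \<union> T = S" "U \<inter> T = {}" for T U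
    using that
  proof (induction U arbitrary: T)
    case empty thus ?case using f by simp
  next
    case (insert i U)
    have ih: "f summable_on orthant d (insert i T)" using insert.prems insert.hyps by (intro insert.IH) blast+
    let ?N = "{x \<in> orthant d T. x i \<le> 0}"
    have i: "i \<in> S" "i \<in> {1..d}" using insert.prems S by blast+
    have inj: "inj_on (\<lambda>x. x(i := - x i)) (orthant d (insert i T))"
      by (rule inj_on_inverseI[where g = "\<lambda>x. x(i := - x i)"]) simp
    have im: "(\<lambda>x. x(i := - x i)) ` orthant d (insert i T) = ?N"
    proof (intro equalityI subsetI)
      fix y assume "y \<in> ?N"
      hence "y(i := - y i) \<in> orthant d (insert i T)" using i by (auto simp: orthant_def)
      moreover have "y = (y(i := - y i))(i := - (y(i := - y i)) i)" by simp
      ultimately show "y \<in> (\<lambda>x. x(i := - x i)) ` orthant d (insert i T)" by blast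
    qed (use i insert.prems in \<open>auto simp: orthant_def\<close>)
    have "(f \<circ> (\<lambda>x. x(i := - x i))) summable_on orthant d (insert i T)"
      by (rule summable_on_cong[THEN iffD1, OF _ ih]) (use inv i in \<open>auto simp: orthant_def\<close>)
    hence "f summable_on ?N"
      using summable_on_reindex[OF inj, of f] im by simp
    hence "f summable_on (orthant d (insert i T) \<union> ?N)"
      using ih by (intro summable_on_union)
    moreover have "orthant d (insert i T) \<union> ?N = orthant d T" by (auto simp: orthant_def)
    ultimately show ?case by simp
  qed
  from this[of S "{}"] fin have "f summable_on orthant d {}" by simp
  thus ?thesis by (simp add: orthant_def)
qed

subsection \<open>Modified Bessel functions\<close>

text \<open>The power series of \<open>I\<^sub>k(2t)\<close>; the recursion says that its derivative is \<open>I\<^sub>k\<^sub>-\<^sub>1(2t) + I\<^sub>k\<^sub>+\<^sub>1(2t)\<close>.\<close>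

primrec bcoef :: "nat \<Rightarrow> int \<Rightarrow> real" where
  "bcoef 0 k = (if k = 0 then 1 else 0)"
| "bcoef (Suc n) k = (bcoef n (k - 1) + bcoef n (k + 1)) / real (Suc n)"

lemma bcoef_nonneg: "0 \<le> bcoef n k"
  by (induction n arbitrary: k) simp_all

lemma bcoef_minus: "bcoef n (- k) = bcoef n k"
proof (induction n arbitrary: k)
  case (Suc n)
  have "- k - 1 = - (k + 1)" "- k + 1 = - (k - 1)" by simp_all
  thus ?case by (simp only: bcoef.simps Suc.IH add.commute)
qed simp

lemma bcoef_abs: "bcoef n \<bar>k\<bar> = bcoef n k"
  by (cases "k \<ge> 0") (simp_all add: bcoef_minus)

lemma bcoef_le: "bcoef n k \<le> 2 ^ n / fact n"
proof (induction n arbitrary: k)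
  case (Suc n)
  have "bcoef (Suc n) k \<le> (2 ^ n / fact n + 2 ^ n / fact n) / real (Suc n)"
    unfolding bcoef.simps by (intro divide_right_mono add_mono Suc.IH) simp
  also have "\<dots> = 2 ^ Suc n / fact (Suc n)" by (simp add: field_simps)
  finally show ?case .
qed simp

lemma bcoef_zero: "int n < \<bar>k\<bar> \<or> odd (int n + k) \<Longrightarrow> bcoef n k = 0"
proof (induction n arbitrary: k)
  case (Suc n)
  have "bcoef n (k - 1) = 0" "bcoef n (k + 1) = 0" using Suc.prems by (intro Suc.IH; auto)+
  thus ?case by simp
qed auto

text \<open>These are the coefficients of the classical Bessel series. For k = 0 the recursion
  reaches the index -1, which symmetry turns into 1; for m = 0 the term with index k + 1 lies
  outside the support.\<close>

lemma bcoef_closed: "2 * m + k = n \<Longrightarrow> bcoef n (int k) = 1 / (fact m * fact (m + k))"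
proof (induction n arbitrary: m k)
  case (Suc n)
  have e1: "x \<noteq> 0 \<Longrightarrow> (1 / (fact m' * (x * f)) + 1 / (fact m' * (x * f))) / (2 * x) = 1 / ((x * fact m') * (x * f))"
    for x f :: real and m' by (simp add: field_simps)
  show ?case
  proof (cases k)
    case 0
    then obtain m' where m: "m = Suc m'" using Suc.prems by (cases m) auto
    have "bcoef n (int 1) = 1 / (fact m' * fact (m' + 1))" using Suc.prems 0 m by (intro Suc.IH) auto
    hence A: "bcoef n 1 = 1 / (fact m' * (real (Suc m') * fact m'))" by simp
    have B: "bcoef n (- 1) = bcoef n 1" by (rule bcoef_minus)
    have C: "real (Suc n) = 2 * real (Suc m')" using Suc.prems 0 m by simp
    have "bcoef (Suc n) 0 = (1 / (fact m' * (real (Suc m') * fact m')) + 1 / (fact m' * (real (Suc m') * fact m'))) / (2 * real (Suc m'))"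
      using A B C by simp
    also have "\<dots> = 1 / ((real (Suc m') * fact m') * (real (Suc m') * fact m'))" by (rule e1) simp
    finally show ?thesis using 0 m by simp
  next
    case (Suc k')
    have A: "bcoef n (int k') = 1 / (fact m * fact (m + k'))" using Suc.prems Suc by (intro Suc.IH) auto
    show ?thesis
    proof (cases m)
      case 0
      have "bcoef n (int k' + 2) = 0" using Suc.prems Suc 0 by (intro bcoef_zero) auto
      hence "bcoef n (2 + int k') = 0" by (simp only: add.commute)
      moreover have "real (Suc n) = real (Suc k')" using Suc.prems Suc 0 by simp
      ultimately show ?thesis using A Suc 0 by simp
    next
      case (Suc m')
      have "bcoef n (int (k' + 2)) = 1 / (fact m' * fact (m' + (k' + 2)))"
        using Suc.prems \<open>k = Suc k'\<close> Suc by (intro Suc.IH) auto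
      hence B: "bcoef n (int k' + 2) = 1 / (fact m' * (real (m' + k' + 2) * fact (m' + k' + 1)))"
        by (simp add: algebra_simps)
      have A': "bcoef n (int k') = 1 / ((real (m' + 1) * fact m') * fact (m' + k' + 1))"
      proof -
        have "fact m = real (m' + 1) * (fact m' :: real)" using Suc by simp
        moreover have "m + k' = m' + k' + 1" using Suc by simp
        ultimately show ?thesis using A by (simp only:)
      qed
      have N: "real (Suc n) = real (m' + 1) + real (m' + k' + 2)" using Suc.prems \<open>k = Suc k'\<close> Suc by simp
      have alg: "(1 / ((a * f) * g) + 1 / (f * (b * g))) / (a + b) = 1 / ((a * f) * (b * g))"
        if "a > 0" "b > 0" "f > 0" "g > 0" for a b f g :: real
        using that by (simp add: divide_simps)
      have ik: "int k - 1 = int k'" "int k + 1 = int k' + 2" using \<open>k = Suc k'\<close> by simp_all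
      have "bcoef (Suc n) (int k) = (bcoef n (int k') + bcoef n (int k' + 2)) / real (Suc n)"
        by (simp only: bcoef.simps ik)
      also have "\<dots> = 1 / ((real (m' + 1) * fact m') * (real (m' + k' + 2) * fact (m' + k' + 1)))"
        unfolding A' B N by (rule alg) auto
      also have "\<dots> = 1 / (fact m * fact (m + k))" using \<open>k = Suc k'\<close> Suc by simp
      finally show ?thesis .
    qed
  qed
qed simp

text \<open>Coefficients of the wrong parity vanish, so a coefficientwise comparison is possible
  only between indices of equal parity.\<close>

lemma bcoef_antimono_even:
  assumes "\<bar>k\<bar> \<le> \<bar>l\<bar>" "even (k + l)"
  shows "bcoef n l \<le> bcoef n k"
proof -
  \<comment> \<open>Starting at -1 rather than 0 closes the induction, since the recursion lowers
    the index by one; at -1 both sides agree by symmetry.\<close>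
  have step: "k \<ge> -1 \<Longrightarrow> bcoef n (k + 2) \<le> bcoef n k" for n k
  proof (induction n arbitrary: k)
    case (Suc n)
    show ?case
    proof (cases "k = -1")
      case True
      have "bcoef (Suc n) (- 1) = bcoef (Suc n) 1" by (rule bcoef_minus)
      with True show ?thesis by (simp only: True) simp
    next
      case False
      hence "bcoef n (k - 1 + 2) \<le> bcoef n (k - 1)" "bcoef n (k + 1 + 2) \<le> bcoef n (k + 1)"
        using Suc.prems by (intro Suc.IH; simp)+
      thus ?thesis by (simp del: bcoef.simps(1) add: divide_right_mono algebra_simps)
    qed
  qed auto
  have iter: "bcoef n (int a + 2 * int m) \<le> bcoef n (int a)" for a m
  proof (induction m)
    case (Suc m)
    have "bcoef n (int a + 2 * int m + 2) \<le> bcoef n (int a + 2 * int m)" by (rule step) simp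
    with Suc show ?case by (simp add: algebra_simps)
  qed simp
  have "even (\<bar>l\<bar> - \<bar>k\<bar>)" using assms(2) by simp
  then obtain m where "\<bar>l\<bar> - \<bar>k\<bar> = 2 * m" by (rule evenE)
  hence l: "\<bar>l\<bar> = \<bar>k\<bar> + 2 * m" and "m \<ge> 0" using assms(1) by simp_all
  with iter[of "nat \<bar>k\<bar>" "nat m"] have "bcoef n \<bar>l\<bar> \<le> bcoef n \<bar>k\<bar>"
    by (simp only: l) simp
  thus ?thesis by (simp add: bcoef_abs)
qed

text \<open>Coefficientwise positivity of a pole minus its mirror image. The two indices differ by 2
  l, so the parity condition holds automatically.\<close>

lemma bcoef_reflect_le:
  assumes "k \<ge> 0" "l \<ge> 0"
  shows "bcoef n (k + l) \<le> bcoef n (k - l)"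
  using assms by (intro bcoef_antimono_even) auto

definition bfps :: "int \<Rightarrow> real fps" where
  "bfps k = Abs_fps (\<lambda>n. bcoef n k)"

lemma bfps_nth [simp]: "fps_nth (bfps k) n = bcoef n k"
  by (simp add: bfps_def)

lemma bfps_minus: "bfps (- k) = bfps k" by (simp add: bfps_def bcoef_minus)

lemma fps_deriv_bfps: "fps_deriv (bfps k) = bfps (k - 1) + bfps (k + 1)"
  by (rule fps_ext) (simp add: field_simps del: of_nat_Suc)

lemma summable_bcoef: "summable (\<lambda>n. bcoef n k * t ^ n)"
proof (rule summable_comparison_test)
  show "\<exists>N. \<forall>n\<ge>N. norm (bcoef n k * t ^ n) \<le> (2 * \<bar>t\<bar>) ^ n / fact n"
  proof (intro exI allI impI)
    fix n
    have "norm (bcoef n k * t ^ n) \<le> (2 ^ n / fact n) * \<bar>t\<bar> ^ n"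
      using bcoef_le[of n k] bcoef_nonneg[of n k]
      by (simp add: abs_mult power_abs mult_right_mono del: times_divide_eq_left)
    thus "norm (bcoef n k * t ^ n) \<le> (2 * \<bar>t\<bar>) ^ n / fact n" by (simp add: power_mult_distrib)
  qed
  show "summable (\<lambda>n. (2 * \<bar>t\<bar>) ^ n / fact n)"
    using summable_exp[of "2 * \<bar>t\<bar>"] by (simp add: field_simps)
qed

lemma fps_conv_radius_bfps: "fps_conv_radius (bfps k) = \<infinity>"
  unfolding fps_conv_radius_def by (rule conv_radius_inftyI'') (simp add: summable_bcoef)

definition bes :: "int \<Rightarrow> real \<Rightarrow> real" where
  "bes k t = eval_fps (bfps k) t"

lemma bes_sums: "(\<lambda>n. bcoef n k * t ^ n) sums bes k t"
  unfolding bes_def eval_fps_def by (simp add: summable_bcoef summable_sums)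

lemma bes_nonneg: "0 \<le> t \<Longrightarrow> 0 \<le> bes k t"
  using bes_sums[of k t] by (rule sums_le[OF _ sums_zero, rotated]) (simp add: bcoef_nonneg)

lemma bes_sums_closed:
  "(\<lambda>m. t ^ (2 * m + k) / (fact m * fact (m + k))) sums bes (int k) t"
proof -
  have sm: "strict_mono (\<lambda>m. 2 * m + k)" by (simp add: strict_mono_def)
  have "(\<lambda>m. bcoef (2 * m + k) (int k) * t ^ (2 * m + k)) sums bes (int k) t"
  proof (subst sums_mono_reindex[OF sm, of "\<lambda>n. bcoef n (int k) * t ^ n"])
    fix n assume n: "n \<notin> range (\<lambda>m. 2 * m + k)"
    have "int n < \<bar>int k\<bar> \<or> odd (int n + int k)"
    proof (rule ccontr)
      assume "\<not> ?thesis"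
      hence "k \<le> n" "even (n - k)" by auto
      from this(2) obtain m where "n - k = 2 * m" by (rule evenE)
      hence "n = 2 * m + k" using \<open>k \<le> n\<close> by simp
      with n show False by blast
    qed
    thus "bcoef n (int k) * t ^ n = 0" using bcoef_zero by simp
  qed (rule bes_sums)
  thus ?thesis by (simp add: bcoef_closed)
qed

text \<open>Termwise the inequality is AM-GM applied to two neighbouring terms of the series of
  order \<open>k\<close>.\<close>

lemma bes_Suc_le:
  assumes t: "0 \<le> t"
  shows "bes (int (Suc k)) t \<le> bes (int k) t"
proof -
  define y where "y m = t ^ (2 * m + k) / (fact m * fact (m + k))" for m
  define x where "x m = t ^ (2 * m + Suc k) / (fact m * fact (m + Suc k))" for m
  have y: "y sums bes (int k) t" and x: "x sums bes (int (Suc k)) t"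
    unfolding x_def y_def using bes_sums_closed by blast+
  have "(\<lambda>m. y (Suc m)) sums (bes (int k) t - y 0)" using y by (simp add: sums_Suc_iff)
  hence yy: "(\<lambda>m. y m + y (Suc m)) sums (bes (int k) t + (bes (int k) t - y 0))"
    using y by (rule sums_add[rotated])
  have le: "2 * x m \<le> y m + y (Suc m)" for m
  proof -
    define s where "s = t / real (m + k + 1)"
    have y0: "0 \<le> y m" using t by (simp add: y_def)
    have xs: "x m = y m * s" by (simp add: x_def y_def s_def field_simps)
    have ys: "y (Suc m) = y m * (s * (t / real (m + 1)))"
      by (simp add: y_def s_def field_simps)
    have "s \<le> t / real (m + 1)" unfolding s_def using t by (intro divide_left_mono) auto
    moreover have "0 \<le> s" using t by (simp add: s_def)
    ultimately have "s * s \<le> s * (t / real (m + 1))" by (intro mult_left_mono)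
    moreover have "0 \<le> (s - 1)\<^sup>2" by simp
    ultimately have "2 * s \<le> 1 + s * (t / real (m + 1))" by (simp add: power2_eq_square algebra_simps)
    hence "y m * (2 * s) \<le> y m * (1 + s * (t / real (m + 1)))" using y0 by (rule mult_left_mono)
    thus ?thesis unfolding xs ys by (simp add: algebra_simps)
  qed
  have "2 * bes (int (Suc k)) t \<le> bes (int k) t + (bes (int k) t - y 0)"
    using le by (rule sums_le[OF _ sums_mult[OF x] yy])
  moreover have "0 \<le> y 0" using t by (simp add: y_def)
  ultimately show ?thesis by simp
qed

text \<open>Unlike single coefficients, the summed series can be compared across parities; this is
  what allows Green's functions at arbitrary displacements to be compared.\<close>

lemma bes_antimono:
  assumes t: "0 \<le> t" and "\<bar>k\<bar> \<le> \<bar>l\<bar>"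
  shows "bes l t \<le> bes k t"
proof -
  have a: "bes \<bar>k\<bar> t = bes k t" for k by (simp add: bes_def bfps_def bcoef_abs)
  have "bes (int (nat \<bar>l\<bar>)) t \<le> bes (int (nat \<bar>k\<bar>)) t"
    by (rule lift_Suc_antimono_le[of "\<lambda>n. bes (int n) t"]) (use assms bes_Suc_le in auto)
  thus ?thesis by (simp add: a)
qed

text \<open>One of the two factorials is dropped from each term. Both sides agree up to the order
  \<open>u\<^sup>2\<close> at 0, so the bound loses nothing in the 1/d term of the integral.\<close>

lemma bes_0_le_exp_square: "bes 0 u \<le> exp (u\<^sup>2)"
proof (rule sums_le)
  show "(\<lambda>m. u ^ (2 * m) / (fact m * fact m)) sums bes 0 u" using bes_sums_closed[of u 0] by simp
  show "(\<lambda>m. (u\<^sup>2) ^ m / fact m) sums exp (u\<^sup>2)"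
    using exp_converges[of "u\<^sup>2"] by (simp add: field_simps)
  fix m
  have "(fact m :: real) \<ge> 1" by (rule fact_ge_1)
  hence "(u\<^sup>2) ^ m / (fact m * fact m) \<le> (u\<^sup>2) ^ m / (fact m * 1)"
    by (intro divide_left_mono mult_left_mono) auto
  thus "u ^ (2 * m) / (fact m * fact m) \<le> (u\<^sup>2) ^ m / fact m" by (simp add: power_mult)
qed

text \<open>The fraction is the probability that the walk on the integers is back at 0 after 2 m
  steps. The induction step is (2m + 1)(2m + 3) <= (2m + 2)^2.\<close>

lemma central_binomial_bound: "(fact (2 * m) / (fact m * fact m * 4 ^ m) :: real)\<^sup>2 * (2 * real m + 1) \<le> 1"
proof (induction m)
  case (Suc m)
  define r where "r m = (fact (2 * m) / (fact m * fact m * 4 ^ m) :: real)" for m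
  have e: "r (Suc m) = r m * ((2 * real m + 1) / (2 * real m + 2))"
    by (simp add: r_def divide_simps) (simp add: algebra_simps)
  have "(r (Suc m))\<^sup>2 * (2 * real (Suc m) + 1)
     = ((r m)\<^sup>2 * (2 * real m + 1)) * (((2 * real m + 1) * (2 * real m + 3)) / (2 * real m + 2)\<^sup>2)"
    unfolding e by (simp add: power2_eq_square field_simps)
  also have "\<dots> \<le> 1 * 1"
  proof (rule mult_mono)
    show "(r m)\<^sup>2 * (2 * real m + 1) \<le> 1" using Suc.IH by (simp add: r_def)
    show "((2 * real m + 1) * (2 * real m + 3)) / (2 * real m + 2)\<^sup>2 \<le> 1"
    proof -
      have "(2 * real m + 1) * (2 * real m + 3) \<le> (2 * real m + 2)\<^sup>2"
        by (simp add: power2_eq_square algebra_simps)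
      moreover have "0 < (2 * real m + 2)\<^sup>2" by (simp add: zero_less_power)
      ultimately show ?thesis by (simp only: divide_le_eq_1 simp_thms)
    qed
  qed auto
  finally show ?case by (simp add: r_def)
qed simp

text \<open>With v = 2 u, the series is the exponential series of v weighted at even n by return
  probabilities of size at most 1 / sqrt (n + 1). AM-GM splits this root into two terms, each of
  which sums to an exponential.\<close>

lemma bes_0_le:
  assumes u: "u > 0"
  shows "bes 0 u \<le> exp (2 * u) / sqrt (2 * u)"
proof -
  define v where "v = 2 * u"
  have v: "v > 0" using u by (simp add: v_def)
  have ex: "(\<lambda>n. v ^ n / fact n) sums exp v" using exp_converges[of v] by (simp add: field_simps)
  have "(\<lambda>n. v ^ Suc n / fact (Suc n)) sums (exp v - v ^ 0 / fact 0)" using ex by (subst sums_Suc_iff) simp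
  hence "(\<lambda>n. (1 / v) * (v ^ Suc n / fact (Suc n))) sums ((1 / v) * (exp v - v ^ 0 / fact 0))" by (rule sums_mult)
  hence ex2: "(\<lambda>n. v ^ n / fact (Suc n)) sums ((exp v - 1) / v)" using v by simp
  have S: "(\<lambda>n. 1 / 2 * (sqrt v * (v ^ n / fact (Suc n)) + 1 / sqrt v * (v ^ n / fact n)))
    sums (1 / 2 * (sqrt v * ((exp v - 1) / v) + 1 / sqrt v * exp v))"
    using ex ex2 by (intro sums_mult sums_add)
  have L: "bcoef n 0 * u ^ n \<le> 1 / 2 * (sqrt v * (v ^ n / fact (Suc n)) + 1 / sqrt v * (v ^ n / fact n))" for n
  proof (cases "even n")
    case False
    hence "bcoef n 0 = 0" by (intro bcoef_zero) auto
    thus ?thesis using v by simp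
  next
    case True
    then obtain m where n: "n = 2 * m" by (auto elim: evenE)
    define r where "r = (fact (2 * m) / (fact m * fact m * 4 ^ m) :: real)"
    have r0: "r \<ge> 0" by (simp add: r_def)
    have "r\<^sup>2 * (real n + 1) \<le> 1" using central_binomial_bound[of m] n by (simp add: r_def)
    hence "sqrt (r\<^sup>2 * (real n + 1)) \<le> sqrt 1" by (rule real_sqrt_le_mono)
    hence r1: "r * sqrt (real n + 1) \<le> 1" using r0 by (simp add: real_sqrt_mult)
    have s0: "sqrt (real n + 1) > 0" by simp
    have "r \<le> 1 / sqrt (real n + 1)" using r1 s0 by (simp add: field_simps)
    \<comment> \<open>The weights balance at n + 1 = v, where the exponential series has its mass;
      this keeps the constant 1 in the final bound.\<close>
    also have "\<dots> \<le> 1 / 2 * (sqrt v / (real n + 1) + 1 / sqrt v)"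
    proof -
      define p q where "p = 1 / sqrt (real n + 1)" and "q = sqrt v"
      have q: "q > 0" using v by (simp add: q_def)
      have pp: "p * p = 1 / (real n + 1)" by (simp add: p_def)
      have "0 \<le> (q * p - 1)\<^sup>2 / q" using q by simp
      also have "\<dots> = q * (p * p) + 1 / q - 2 * p" using q by (simp add: power2_eq_square field_simps)
      finally have "p \<le> 1 / 2 * (q * (p * p) + 1 / q)" by simp
      thus ?thesis unfolding pp by (simp add: p_def q_def)
    qed
    finally have rr: "r \<le> 1 / 2 * (sqrt v / (real n + 1) + 1 / sqrt v)" .
    have "bcoef n 0 = 1 / (fact m * fact m)" using bcoef_closed[of m 0 n] n by simp
    hence "bcoef n 0 * u ^ n = r * (v ^ n / fact n)"
      unfolding r_def v_def n by (simp add: power_mult_distrib power_mult)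
    also have "\<dots> \<le> 1 / 2 * (sqrt v / (real n + 1) + 1 / sqrt v) * (v ^ n / fact n)"
      using v by (intro mult_right_mono rr) simp
    also have "\<dots> = 1 / 2 * (sqrt v * (v ^ n / fact (Suc n)) + 1 / sqrt v * (v ^ n / fact n))"
    proof -
      have alg: "1 / 2 * (q / a + 1 / q) * (p / f) = 1 / 2 * (q * (p / (a * f)) + 1 / q * (p / f))"
        for q a p f :: real by (simp add: algebra_simps)
      show ?thesis using alg[of "sqrt v" "real n + 1" "v ^ n" "fact n"] by (simp add: algebra_simps)
    qed
    finally show ?thesis .
  qed
  have "bes 0 u \<le> 1 / 2 * (sqrt v * ((exp v - 1) / v) + 1 / sqrt v * exp v)"
    by (rule sums_le[OF L bes_sums S])
  also have "\<dots> \<le> 1 / 2 * (sqrt v * (exp v / v) + 1 / sqrt v * exp v)"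
    using v by (intro mult_left_mono add_mono divide_right_mono) auto
  also have "\<dots> = exp v / sqrt v"
  proof -
    have "sqrt v * (exp v / v) = exp v / sqrt v" using v
      by (metis less_eq_real_def mult.commute real_div_sqrt divide_divide_eq_right times_divide_eq_left)
    thus ?thesis by simp
  qed
  finally show ?thesis by (simp add: v_def)
qed

subsection \<open>Products and Laplace transforms\<close>

lemma conv_radius_prod_bfps:
  "finite I \<Longrightarrow> fps_conv_radius (\<Prod>i\<in>I. bfps (z i)) = \<infinity>"
proof (induction I rule: finite_induct)
  case (insert i I)
  have "min (fps_conv_radius (bfps (z i))) (fps_conv_radius (\<Prod>i\<in>I. bfps (z i)))
    \<le> fps_conv_radius (bfps (z i) * (\<Prod>i\<in>I. bfps (z i)))" by (rule fps_conv_radius_mult)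
  thus ?case using insert by (simp add: fps_conv_radius_bfps)
qed simp

lemma eval_prod_bfps:
  "finite I \<Longrightarrow> eval_fps (\<Prod>i\<in>I. bfps (z i)) t = (\<Prod>i\<in>I. bes (z i) t)"
  by (induction I rule: finite_induct)
     (simp_all add: eval_fps_mult conv_radius_prod_bfps fps_conv_radius_bfps bes_def)

lemma prod_bfps_sums:
  "finite I \<Longrightarrow> (\<lambda>n. fps_nth (\<Prod>i\<in>I. bfps (z i)) n * t ^ n) sums (\<Prod>i\<in>I. bes (z i) t)"
  using sums_eval_fps[of t "\<Prod>i\<in>I. bfps (z i)"]
  by (simp add: eval_prod_bfps conv_radius_prod_bfps)

lemma fps_mult_nonneg:
  fixes f g :: "real fps"
  shows "(\<And>n. 0 \<le> fps_nth f n) \<Longrightarrow> (\<And>n. 0 \<le> fps_nth g n) \<Longrightarrow> 0 \<le> fps_nth (f * g) n"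
  by (auto simp: fps_mult_nth intro!: sum_nonneg)

lemma fps_mult_mono:
  fixes f g :: "real fps"
  shows "(\<And>n. 0 \<le> fps_nth f n) \<Longrightarrow> (\<And>n. 0 \<le> fps_nth g n) \<Longrightarrow>
    (\<And>n. fps_nth f n \<le> fps_nth f' n) \<Longrightarrow> (\<And>n. fps_nth g n \<le> fps_nth g' n) \<Longrightarrow> fps_nth (f * g) n \<le> fps_nth (f' * g') n"
  unfolding fps_mult_nth by (intro sum_mono mult_mono) (auto intro: order_trans)

lemma fps_prod_mono:
  fixes f g :: "'i \<Rightarrow> real fps"
  assumes "finite I" "\<And>i n. i \<in> I \<Longrightarrow> 0 \<le> fps_nth (f i) n" "\<And>i n. i \<in> I \<Longrightarrow> fps_nth (f i) n \<le> fps_nth (g i) n"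
  shows "0 \<le> fps_nth (\<Prod>i\<in>I. f i) n \<and> fps_nth (\<Prod>i\<in>I. f i) n \<le> fps_nth (\<Prod>i\<in>I. g i) n"
  using assms
proof (induction I arbitrary: n rule: finite_induct)
  case (insert i I)
  thus ?case by (auto intro!: fps_mult_nonneg fps_mult_mono)
qed auto

section \<open>The Laplace transform of a product of Bessel functions and its asymptotics\<close>

definition green_integral :: "nat \<Rightarrow> (nat \<Rightarrow> int) \<Rightarrow> ennreal" where
  "green_integral d z =
     (\<integral>\<^sup>+t. ennreal (t * exp (- t) * (\<Prod>i\<in>{1..d}. bes (z i) (t / (2 * real d)))) * indicator {0..} t \<partial>lborel)"

text \<open>Termwise integration: t^(n+1) exp(-t) integrates to (n + 1)!, of which n! turns the
  coefficient of the exponential generating function into a number of walks and n + 1 remains as a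
  weight. Working in \<open>ennreal\<close> makes the interchange unconditional.\<close>

lemma green_integral_suminf:
  "green_integral d z = (\<Sum>n. ennreal (fact (Suc n) * fps_nth (\<Prod>i\<in>{1..d}. bfps (z i)) n / (2 * real d) ^ n))"
proof -
  define c where "c n = fps_nth (\<Prod>i\<in>{1..d}. bfps (z i)) n" for n
  have c0: "0 \<le> c n" for n unfolding c_def
    using fps_prod_mono[of "{1..d}" "\<lambda>i. bfps (z i)" "\<lambda>i. bfps (z i)"] by (simp add: bcoef_nonneg)
  have "green_integral d z =
    (\<integral>\<^sup>+t. (\<Sum>n. ennreal (c n / (2 * real d) ^ n) * (ennreal (t ^ Suc n * exp (- t)) * indicator {0..} t)) \<partial>lborel)"
    unfolding green_integral_def
  proof (rule nn_integral_cong)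
    fix t :: real
    show "ennreal (t * exp (- t) * (\<Prod>i\<in>{1..d}. bes (z i) (t / (2 * real d)))) * indicator {0..} t
      = (\<Sum>n. ennreal (c n / (2 * real d) ^ n) * (ennreal (t ^ Suc n * exp (- t)) * indicator {0..} t))"
    proof (cases "t \<ge> 0")
      case True
      have "(\<lambda>n. t * exp (- t) * (c n * (t / (2 * real d)) ^ n)) sums
         (t * exp (- t) * (\<Prod>i\<in>{1..d}. bes (z i) (t / (2 * real d))))"
        unfolding c_def by (intro sums_mult prod_bfps_sums) simp
      moreover have "t * exp (- t) * (c n * (t / (2 * real d)) ^ n)
          = c n / (2 * real d) ^ n * (t ^ Suc n * exp (- t))" for n
        by (simp add: power_divide)
      ultimately have s: "(\<lambda>n. c n / (2 * real d) ^ n * (t ^ Suc n * exp (- t))) sums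
         (t * exp (- t) * (\<Prod>i\<in>{1..d}. bes (z i) (t / (2 * real d))))" by simp
      have "(\<Sum>n. ennreal (c n / (2 * real d) ^ n * (t ^ Suc n * exp (- t))))
        = ennreal (t * exp (- t) * (\<Prod>i\<in>{1..d}. bes (z i) (t / (2 * real d))))"
        using s c0 True by (subst suminf_ennreal2) (auto simp: sums_iff)
      moreover have "ennreal (c n / (2 * real d) ^ n * (t ^ Suc n * exp (- t))) =
        ennreal (c n / (2 * real d) ^ n) * (ennreal (t ^ Suc n * exp (- t)) * indicator {0..} t)" for n
        using True c0 by (subst ennreal_mult) auto
      ultimately show ?thesis using True by simp
    qed simp
  qed
  also have "\<dots> = (\<Sum>n. \<integral>\<^sup>+t. ennreal (c n / (2 * real d) ^ n) * (ennreal (t ^ Suc n * exp (- t)) * indicator {0..} t) \<partial>lborel)"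
    by (rule nn_integral_suminf) simp
  also have "\<dots> = (\<Sum>n. ennreal (c n / (2 * real d) ^ n) * ennreal (fact (Suc n)))"
    by (subst nn_integral_cmult) (simp_all only: nn_intergal_power_times_exp_Ici of_nat_fact, simp)
  also have "\<dots> = (\<Sum>n. ennreal (fact (Suc n) * c n / (2 * real d) ^ n))"
    using c0 by (intro suminf_cong) (simp add: ennreal_mult[symmetric] mult_ac del: fact_Suc)
  finally show ?thesis by (simp add: c_def)
qed

lemma green_integral_mono:
  assumes "(\<And>t. 0 \<le> t \<Longrightarrow> (\<Prod>i\<in>{1..d}. bes (z i) t) \<le> (\<Prod>i\<in>{1..d}. bes (z' i) t))"
  shows "green_integral d z \<le> green_integral d z'"
  unfolding green_integral_def
proof (rule nn_integral_mono)
  fix t :: real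
  show "ennreal (t * exp (- t) * (\<Prod>i\<in>{1..d}. bes (z i) (t / (2 * real d)))) * indicator {0..} t
    \<le> ennreal (t * exp (- t) * (\<Prod>i\<in>{1..d}. bes (z' i) (t / (2 * real d)))) * indicator {0..} t"
  proof (cases "t \<ge> 0")
    case True
    thus ?thesis by (auto intro!: ennreal_leI mult_left_mono assms simp del: One_nat_def)
  qed simp
qed

text \<open>One nonzero coordinate is compared with order 1 and all others with order 0. So a unit
  vector gives the largest value among all nonzero displacements.\<close>

lemma green_integral_le_unit:
  assumes i: "i \<in> {1..d}" "z i \<noteq> 0" and k: "k \<in> {1..d}"
  shows "green_integral d z \<le> green_integral d ((\<lambda>_. 0)(k := 1))"
proof (rule green_integral_mono)
  fix t :: real assume t: "0 \<le> t"
  have "(\<Prod>i\<in>{1..d}. bes (z i) t) = bes (z i) t * (\<Prod>j\<in>{1..d}-{i}. bes (z j) t)"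
    using i by (intro prod.remove) auto
  also have "\<dots> \<le> bes 1 t * (\<Prod>j\<in>{1..d}-{i}. bes 0 t)"
    using t i by (intro mult_mono prod_mono prod_nonneg) (auto intro!: bes_antimono bes_nonneg)
  also have "\<dots> = bes 1 t * (\<Prod>j\<in>{1..d}-{k}. bes 0 t)" using i k by simp
  also have "\<dots> = bes (((\<lambda>_. 0)(k := 1)) k) t * (\<Prod>j\<in>{1..d}-{k}. bes (((\<lambda>_. 0)(k := 1)) j) t)"
    by simp
  also have "\<dots> = (\<Prod>j\<in>{1..d}. bes (((\<lambda>_. 0)(k := 1)) j) t)"
    using k by (intro prod.remove[symmetric]) auto
  finally show "(\<Prod>i\<in>{1..d}. bes (z i) t) \<le> (\<Prod>j\<in>{1..d}. bes (((\<lambda>_. 0)(k := 1)) j) t)" .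
qed

lemma green_integral_le_0: "green_integral d z \<le> green_integral d (\<lambda>_. 0)"
  by (rule green_integral_mono, rule prod_mono) (auto intro!: bes_antimono bes_nonneg)

text \<open>Taylor's formula with the exponential kept in the remainder, so that it holds on the
  whole half-line and not only near 0.\<close>

lemma exp_taylor2_le:
  assumes "0 \<le> (x::real)"
  shows "exp x \<le> 1 + x + x\<^sup>2 / 2 * exp x"
proof -
  have d: "((\<lambda>x. 1 + x + x\<^sup>2 / 2 * exp x - exp x) has_real_derivative (1 + t * exp t + t\<^sup>2 / 2 * exp t - exp t)) (at t)" for t :: real
    by (auto intro!: derivative_eq_intros)
  have "1 + 0 + 0\<^sup>2 / 2 * exp 0 - exp 0 \<le> 1 + x + x\<^sup>2 / 2 * exp x - exp x"
  proof (rule DERIV_nonneg_imp_nondecreasing[OF assms])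
    fix t :: real assume t: "0 \<le> t"
    have "1 - t \<le> exp (- t)" using exp_ge_add_one_self[of "- t"] by simp
    hence "(1 - t) * exp t \<le> exp (- t) * exp t" by (rule mult_right_mono) simp
    hence "0 \<le> 1 + t * exp t - exp t" by (simp add: exp_minus algebra_simps)
    moreover have "0 \<le> t\<^sup>2 / 2 * exp t" by simp
    ultimately have "0 \<le> 1 + t * exp t + t\<^sup>2 / 2 * exp t - exp t" by linarith
    thus "\<exists>y. ((\<lambda>x. 1 + x + x\<^sup>2 / 2 * exp x - exp x) has_real_derivative y) (at t) \<and> 0 \<le> y"
      using d by blast
  qed
  thus ?thesis by simp
qed

text \<open>The split is at t = 2 d. Below it u = t^2 / (4d) is at most t / 2, so the remainder of
  the expansion of exp u still decays like exp (- t / 2). Above it the power decay of the Bessel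
  function, raised to the power d, is overwhelming.\<close>

lemma green_integrand_bound:
  assumes d: "d \<ge> 6" and big: "real d ^ 5 \<le> sqrt 2 ^ (d - 6)" and t: "t \<ge> 0"
  shows "t * exp (- t) * bes 0 (t / (2 * real d)) ^ d \<le>
     (t * exp (- t) + 1 / (4 * real d) * (t ^ 3 * exp (- t)) + 1 / (32 * real d ^ 2) * (t ^ 5 * exp (- (1/2) * t)))
     + (if t \<ge> 1 then 1 / real d ^ 2 * (1 / t\<^sup>2) else 0)"
proof (cases "t \<le> 2 * real d")
  case True
  define u where "u = t\<^sup>2 / (4 * real d)"
  have d0: "real d > 0" using d by simp
  have "bes 0 (t / (2 * real d)) ^ d \<le> exp ((t / (2 * real d))\<^sup>2) ^ d"
    using t by (intro power_mono bes_0_le_exp_square bes_nonneg) simp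
  also have "\<dots> = exp (real d * (t / (2 * real d))\<^sup>2)" by (rule exp_of_nat_mult[symmetric])
  also have "real d * (t / (2 * real d))\<^sup>2 = u" using d0 by (simp add: u_def power2_eq_square field_simps)
  also have "exp u \<le> 1 + u + u\<^sup>2 / 2 * exp u" using d0 by (intro exp_taylor2_le) (simp add: u_def)
  also have "\<dots> \<le> 1 + u + u\<^sup>2 / 2 * exp (t / 2)"
  proof -
    have "t * t \<le> t * (2 * real d)" using True t by (rule mult_left_mono)
    hence "u \<le> t / 2" using d0 by (simp add: u_def power2_eq_square field_simps)
    thus ?thesis by (intro add_left_mono mult_left_mono) auto
  qed
  finally have "t * exp (- t) * bes 0 (t / (2 * real d)) ^ d \<le> t * exp (- t) * (1 + u + u\<^sup>2 / 2 * exp (t / 2))"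
    using t by (intro mult_left_mono) auto
  also have "\<dots> = t * exp (- t) + t * u * exp (- t) + t * u\<^sup>2 / 2 * (exp (- t) * exp (t / 2))"
    by (simp add: algebra_simps)
  also have "exp (- t) * exp (t / 2) = exp (- (1/2) * t)" by (simp flip: exp_add)
  also have "t * u * exp (- t) = 1 / (4 * real d) * (t ^ 3 * exp (- t))"
    by (simp add: u_def power2_eq_square power3_eq_cube)
  also have "t * u\<^sup>2 / 2 * exp (- (1/2) * t) = 1 / (32 * real d ^ 2) * (t ^ 5 * exp (- (1/2) * t))"
    by (simp add: u_def power2_eq_square eval_nat_numeral)
  finally show ?thesis by (rule order_trans) simp
next
  case False
  have d0: "real d \<ge> 1" using d by simp
  have t1: "t \<ge> 1" and t0: "t > 0" using False d0 by linarith+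
  define s where "s = t / real d"
  have s2: "s \<ge> 2" using False d0 by (simp add: s_def field_simps)
  have "bes 0 (t / (2 * real d)) \<le> exp (2 * (t / (2 * real d))) / sqrt (2 * (t / (2 * real d)))"
    using t0 d0 by (intro bes_0_le) simp
  also have "2 * (t / (2 * real d)) = s" by (simp add: s_def)
  finally have "bes 0 (t / (2 * real d)) ^ d \<le> (exp s / sqrt s) ^ d"
    using t by (intro power_mono bes_nonneg) simp_all
  also have "\<dots> = exp t / sqrt s ^ d"
    using d0 by (simp add: power_divide s_def flip: exp_of_nat_mult)
  also have "\<dots> \<le> exp t / (s ^ 3 * real d ^ 5)"
  proof (rule divide_left_mono)
    \<comment> \<open>Six of the d roots supply s^3, the others supply d^5 by \<open>big\<close>.
      Since s^3 d^5 = t^3 d^2, the integrand becomes 1 / (d^2 t^2), which is integrable at infinity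
      and of the order allowed for errors.\<close>
    have "s ^ 3 * real d ^ 5 \<le> sqrt s ^ 6 * sqrt s ^ (d - 6)"
    proof (rule mult_mono)
      have "sqrt s ^ 6 = (sqrt s ^ 2) ^ 3" by (simp flip: power_mult)
      thus "s ^ 3 \<le> sqrt s ^ 6" using s2 by simp
      have "sqrt 2 ^ (d - 6) \<le> sqrt s ^ (d - 6)" using s2 by (intro power_mono) auto
      thus "real d ^ 5 \<le> sqrt s ^ (d - 6)" using big by simp
    qed (use s2 in auto)
    also have "\<dots> = sqrt s ^ d" using d by (simp flip: power_add)
    finally show "s ^ 3 * real d ^ 5 \<le> sqrt s ^ d" .
  qed (use s2 d0 in auto)
  finally have "t * exp (- t) * bes 0 (t / (2 * real d)) ^ d \<le> t * exp (- t) * (exp t / (s ^ 3 * real d ^ 5))"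
    using t by (intro mult_left_mono) auto
  also have "\<dots> = t / (s ^ 3 * real d ^ 5)" by (simp add: exp_minus)
  also have "\<dots> = 1 / real d ^ 2 * (1 / t\<^sup>2)"
    using t0 d0 by (simp add: s_def power_divide field_simps eval_nat_numeral)
  also have "\<dots> \<le> (t * exp (- t) + 1 / (4 * real d) * (t ^ 3 * exp (- t)) + 1 / (32 * real d ^ 2) * (t ^ 5 * exp (- (1/2) * t)))
     + (if t \<ge> 1 then 1 / real d ^ 2 * (1 / t\<^sup>2) else 0)"
    using t t1 by simp
  finally show ?thesis .
qed

text \<open>The second term is 6 / (4d) = 3 / (2d). In the error, 7680 / 32 = 240 comes from the
  Taylor remainder and 1 from the tail, together 241.\<close>

lemma green_integral_0_bound:
  assumes d: "d \<ge> 6" and big: "real d ^ 5 \<le> sqrt 2 ^ (d - 6)"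
  shows "green_integral d (\<lambda>_. 0) \<le> ennreal (1 + 3 / (2 * real d) + 241 / real d ^ 2)"
proof -
  let ?g = "\<lambda>k t. ennreal (t ^ k * exp (- t)) * indicator {0..} (t::real)"
  \<comment> \<open>7680 = 5! * 2^6 is the inverse of the normalising constant of the Erlang density
    with rate 1/2.\<close>
  have I3: "(\<integral>\<^sup>+t. ennreal (t ^ 5 * exp (- (1/2) * t)) * indicator {0..} t \<partial>lborel) = ennreal 7680"
  proof -
    have "(\<integral>\<^sup>+t. ennreal (t ^ 5 * exp (- (1/2) * t)) * indicator {0..} t \<partial>lborel)
      = (\<integral>\<^sup>+t. ennreal 7680 * ennreal (erlang_density 5 (1/2) t * t ^ 0) \<partial>lborel)"
    proof (rule nn_integral_cong)
      fix t :: real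
      have "t ^ 5 * exp (- (1/2) * t) = 7680 * (erlang_density 5 (1/2) t * t ^ 0)" if "t \<ge> 0"
        using that by (simp add: erlang_density_def fact_numeral power_divide)
      moreover have "0 \<le> erlang_density 5 (1/2) t * t ^ 0" by simp
      ultimately show "ennreal (t ^ 5 * exp (- (1/2) * t)) * indicator {0..} t
          = ennreal 7680 * ennreal (erlang_density 5 (1/2) t * t ^ 0)"
        by (cases "t \<ge> 0") (simp_all only: ennreal_mult[symmetric], auto simp: erlang_density_def)
    qed
    also have "\<dots> = ennreal 7680 * (\<integral>\<^sup>+t. ennreal (erlang_density 5 (1/2) t * t ^ 0) \<partial>lborel)"
      by (rule nn_integral_cmult) simp
    also have "(\<integral>\<^sup>+t. ennreal (erlang_density 5 (1/2) t * t ^ 0) \<partial>lborel) = 1"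
      by (subst nn_integral_erlang_ith_moment) auto
    finally show ?thesis by simp
  qed
  have I4: "(\<integral>\<^sup>+t. ennreal (1 / t\<^sup>2) * indicator {1..} t \<partial>lborel) = ennreal 1"
  proof -
    have "(\<integral>\<^sup>+t. ennreal (1 / t\<^sup>2) * indicator {1..} t \<partial>lborel) = ennreal (0 - (- 1 / (1::real)))"
      by (rule nn_integral_FTC_atLeast[where F = "\<lambda>t. - 1 / t"])
         (auto intro!: derivative_eq_intros simp: power2_eq_square, real_asymp)
    thus ?thesis by simp
  qed
  have "green_integral d (\<lambda>_. 0) \<le> (\<integral>\<^sup>+t. (?g 1 t + ennreal (1 / (4 * real d)) * ?g 3 t
      + ennreal (1 / (32 * real d ^ 2)) * (ennreal (t ^ 5 * exp (- (1/2) * t)) * indicator {0..} t))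
      + ennreal (1 / real d ^ 2) * (ennreal (1 / t\<^sup>2) * indicator {1..} t) \<partial>lborel)"
    unfolding green_integral_def
  proof (rule nn_integral_mono)
    fix t :: real
    show "ennreal (t * exp (- t) * (\<Prod>i\<in>{1..d}. bes 0 (t / (2 * real d)))) * indicator {0..} t
     \<le> (?g 1 t + ennreal (1 / (4 * real d)) * ?g 3 t
      + ennreal (1 / (32 * real d ^ 2)) * (ennreal (t ^ 5 * exp (- (1/2) * t)) * indicator {0..} t))
      + ennreal (1 / real d ^ 2) * (ennreal (1 / t\<^sup>2) * indicator {1..} t)"
    proof (cases "t \<ge> 0")
      case True
      have "ennreal (t * exp (- t) * bes 0 (t / (2 * real d)) ^ d) \<le>
        ennreal ((t * exp (- t) + 1 / (4 * real d) * (t ^ 3 * exp (- t)) + 1 / (32 * real d ^ 2) * (t ^ 5 * exp (- (1/2) * t)))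
     + (if t \<ge> 1 then 1 / real d ^ 2 * (1 / t\<^sup>2) else 0))"
        by (rule ennreal_leI[OF green_integrand_bound[OF d big True]])
      also have "\<dots> = (?g 1 t + ennreal (1 / (4 * real d)) * ?g 3 t
      + ennreal (1 / (32 * real d ^ 2)) * (ennreal (t ^ 5 * exp (- (1/2) * t)) * indicator {0..} t))
      + ennreal (1 / real d ^ 2) * (ennreal (1 / t\<^sup>2) * indicator {1..} t)"
        using True by (auto simp: ennreal_plus[symmetric] ennreal_mult[symmetric] split: split_indicator simp del: ennreal_plus)
      finally show ?thesis using True by simp
    qed simp
  qed
  also have "\<dots> = ennreal 1 + ennreal (1 / (4 * real d)) * ennreal 6 + ennreal (1 / (32 * real d ^ 2)) * ennreal 7680
     + ennreal (1 / real d ^ 2) * ennreal 1"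
  proof -
    have f: "(\<integral>\<^sup>+t. ?g 1 t \<partial>lborel) = ennreal 1" "(\<integral>\<^sup>+t. ?g 3 t \<partial>lborel) = ennreal 6"
      by (simp_all only: nn_intergal_power_times_exp_Ici) (simp_all add: fact_numeral)
    have add: "(\<integral>\<^sup>+t. (A t + a * B t + b * C t) + c * D t \<partial>lborel)
      = (\<integral>\<^sup>+t. A t \<partial>lborel) + a * (\<integral>\<^sup>+t. B t \<partial>lborel) + b * (\<integral>\<^sup>+t. C t \<partial>lborel) + c * (\<integral>\<^sup>+t. D t \<partial>lborel)"
      if [measurable]: "A \<in> borel_measurable borel" "B \<in> borel_measurable borel"
        "C \<in> borel_measurable borel" "D \<in> borel_measurable borel"
      for A B C D :: "real \<Rightarrow> ennreal" and a b c
      by (simp add: nn_integral_add nn_integral_cmult)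
    show ?thesis
      by (subst add) (measurable, simp only: f I3 I4)
  qed
  also have "\<dots> = ennreal (1 + 3 / (2 * real d) + 241 / real d ^ 2)"
  proof -
    have e: "ennreal 1 + ennreal a * ennreal 6 + ennreal b * ennreal 7680 + ennreal c * ennreal 1
        = ennreal (1 + a * 6 + b * 7680 + c * 1)" if "a \<ge> 0" "b \<ge> 0" "c \<ge> 0" for a b c
      using that by (simp add: ennreal_mult)
    show ?thesis by (subst e) (auto simp: field_simps)
  qed
  finally show ?thesis .
qed

lemma eventually_green_integral_0_bound:
  "\<forall>\<^sub>F d in sequentially. green_integral d (\<lambda>_. 0) \<le> ennreal (1 + 3 / (2 * real d) + 241 / real d ^ 2)"
proof -
  have "\<forall>\<^sub>F d in sequentially. real d ^ 5 \<le> sqrt 2 powr (real d - 6)" by real_asymp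
  with eventually_ge_at_top[of 6] show ?thesis
  proof eventually_elim
    case (elim d)
    have "sqrt 2 powr (real d - 6) = sqrt 2 ^ (d - 6)"
      using elim(1) by (simp add: of_nat_diff flip: powr_realpow)
    with elim show ?case by (intro green_integral_0_bound) auto
  qed
qed

subsection \<open>Walks and Green's functions\<close>

text \<open>Method of images in one coordinate: for \<open>i\<close> in \<open>S\<close> a negative
  image of the pole sits at \<open>- y i\<close>.\<close>

definition cfac :: "nat set \<Rightarrow> (nat \<Rightarrow> int) \<Rightarrow> nat \<Rightarrow> int \<Rightarrow> real fps" where
  "cfac S y i k = (if i \<in> S then bfps (k - y i) - bfps (k + y i) else bfps (k - y i))"

text \<open>For \<open>S = {}\<close> this is the number of walks with \<open>n\<close> steps from \<open>y\<close> to \<open>x\<close>; in general it is the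
  signed number obtained by the reflection principle.\<close>

definition walks :: "nat \<Rightarrow> nat set \<Rightarrow> (nat \<Rightarrow> int) \<Rightarrow> nat \<Rightarrow> (nat \<Rightarrow> int) \<Rightarrow> real" where
  "walks d S y n x = fact n * fps_nth (\<Prod>i\<in>{1..d}. cfac S y i (x i)) n"

lemma fps_deriv_cfac: "fps_deriv (cfac S y i k) = cfac S y i (k - 1) + cfac S y i (k + 1)"
  by (simp add: cfac_def fps_deriv_bfps algebra_simps)

text \<open>Differentiating an exponential generating function shifts the step count, and by the
  product rule it acts on one coordinate at a time. The shift by one step is therefore the sum over
  the nearest neighbours.\<close>

lemma fps_deriv_prod_shift:
  assumes c: "\<And>i k. fps_deriv (c i k) = c i (k - 1) + c i (k + (1::int))" and "finite I"
  shows "fps_deriv (\<Prod>i\<in>I. c i (x i) :: real fps) =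
    (\<Sum>i\<in>I. (\<Prod>j\<in>I. c j ((x(i := x i + 1)) j)) + (\<Prod>j\<in>I. c j ((x(i := x i - 1)) j)))"
  using assms(2)
proof (induction I)
  case (insert a I)
  have ne: "(\<Prod>j\<in>I. c j ((x(a := v)) j)) = (\<Prod>j\<in>I. c j (x j))" for v
    using insert.hyps by (intro prod.cong) auto
  have "(\<Sum>i\<in>I. (\<Prod>j\<in>insert a I. c j ((x(i := x i + 1)) j)) + (\<Prod>j\<in>insert a I. c j ((x(i := x i - 1)) j)))
    = (\<Sum>i\<in>I. c a (x a) * ((\<Prod>j\<in>I. c j ((x(i := x i + 1)) j)) + (\<Prod>j\<in>I. c j ((x(i := x i - 1)) j))))"
  proof (rule sum.cong[OF refl])
    fix i assume "i \<in> I"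
    hence "(x(i := v)) a = x a" for v using insert.hyps by auto
    thus "(\<Prod>j\<in>insert a I. c j ((x(i := x i + 1)) j)) + (\<Prod>j\<in>insert a I. c j ((x(i := x i - 1)) j))
       = c a (x a) * ((\<Prod>j\<in>I. c j ((x(i := x i + 1)) j)) + (\<Prod>j\<in>I. c j ((x(i := x i - 1)) j)))"
      unfolding prod.insert[OF insert.hyps] by (simp only: distrib_left)
  qed
  also have "\<dots> = c a (x a) * fps_deriv (\<Prod>i\<in>I. c i (x i))"
    unfolding insert.IH by (rule sum_distrib_left[symmetric])
  finally show ?case
    unfolding sum.insert[OF insert.hyps] prod.insert[OF insert.hyps] fps_deriv_mult c ne fun_upd_same
    by (simp add: algebra_simps)
qed simp

lemma walks_Suc: "walks d S y (Suc n) x = nbsum d (walks d S y n) x"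
proof -
  let ?F = "\<Prod>i\<in>{1..d}. cfac S y i (x i)"
  have "walks d S y (Suc n) x = fact n * fps_nth (fps_deriv ?F) n"
    by (simp add: walks_def)
  also have "fps_deriv ?F = (\<Sum>i\<in>{1..d}. (\<Prod>j\<in>{1..d}. cfac S y j ((x(i := x i + 1)) j))
      + (\<Prod>j\<in>{1..d}. cfac S y j ((x(i := x i - 1)) j)))"
    by (rule fps_deriv_prod_shift) (auto simp: fps_deriv_cfac)
  finally show ?thesis
    by (simp add: nbsum_def walks_def fps_sum_nth sum_distrib_left distrib_left del: fun_upd_apply)
qed

lemma fps_prod_nth_0: "finite I \<Longrightarrow> fps_nth (\<Prod>i\<in>I. f i) 0 = (\<Prod>i\<in>I. fps_nth (f i :: real fps) 0)"
  by (induction I rule: finite_induct) auto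

text \<open>The possible poles: on the walls every antisymmetric function vanishes, and so does its
  Laplacian.\<close>

definition open_orthant :: "nat \<Rightarrow> nat set \<Rightarrow> (nat \<Rightarrow> int) set" where
  "open_orthant d S = {x \<in> grid d. \<forall>i\<in>S. 0 < x i}"

lemma open_orthant_subset: "open_orthant d S \<subseteq> orthant d S" by (auto simp: open_orthant_def orthant_def)

lemma open_orthant_empty: "open_orthant d {} = grid d" and orthant_empty: "orthant d {} = grid d"
  by (auto simp: open_orthant_def orthant_def)

lemma grid_eqI: "x \<in> grid d \<Longrightarrow> y \<in> grid d \<Longrightarrow> (\<And>i. i \<in> {1..d} \<Longrightarrow> x i = y i) \<Longrightarrow> x = y"
  by (auto simp: grid_def intro: PiE_ext)

text \<open>The mirror images of a pole in the open orthant lie outside the closed orthant, so at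
  time 0 only the pole itself is seen.\<close>

lemma walks_0:
  assumes x: "x \<in> orthant d S" and y: "y \<in> open_orthant d S"
  shows "walks d S y 0 x = (if x = y then 1 else 0)"
proof -
  have "walks d S y 0 x = (\<Prod>i\<in>{1..d}. fps_nth (cfac S y i (x i)) 0)"
    by (simp add: walks_def fps_prod_nth_0)
  also have "\<dots> = (\<Prod>i\<in>{1..d}. if x i = y i then 1 else 0)"
    using x y by (intro prod.cong) (auto simp: cfac_def orthant_def open_orthant_def, fastforce)
  also have "\<dots> = (if x = y then 1 else 0)"
  proof (cases "x = y")
    case False
    with x y obtain i where "i \<in> {1..d}" "x i \<noteq> y i"
      using grid_eqI[of x d y] by (auto simp: orthant_def open_orthant_def)
    hence "(\<Prod>i\<in>{1..d}. if x i = y i then 1 else (0::real)) = 0" by (intro prod_zero) auto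
    with False show ?thesis by simp
  qed simp
  finally show ?thesis .
qed

text \<open>Both bounds hold for each coordinate factor, coefficient by coefficient: subtracting the
  image makes the factor smaller, and \<open>bcoef_reflect_le\<close> keeps it nonnegative. This
  transfers upper estimates for free walks to every \<open>S\<close>.\<close>

lemma walks_bounds:
  assumes x: "x \<in> orthant d S" and y: "y \<in> open_orthant d S"
  shows "0 \<le> walks d S y n x" and "walks d S y n x \<le> walks d {} y n x"
proof -
  have "0 \<le> fps_nth (\<Prod>i\<in>{1..d}. cfac S y i (x i)) n \<and>
     fps_nth (\<Prod>i\<in>{1..d}. cfac S y i (x i)) n \<le> fps_nth (\<Prod>i\<in>{1..d}. cfac {} y i (x i)) n"
  proof (rule fps_prod_mono)
    fix i m assume "i \<in> {1..d}"
    show "0 \<le> fps_nth (cfac S y i (x i)) m"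
      using x y bcoef_reflect_le[of "x i" "y i" m] bcoef_nonneg[of m]
      by (auto simp: cfac_def orthant_def open_orthant_def less_imp_le)
    show "fps_nth (cfac S y i (x i)) m \<le> fps_nth (cfac {} y i (x i)) m"
      using bcoef_nonneg[of m] by (auto simp: cfac_def)
  qed simp
  thus "0 \<le> walks d S y n x" "walks d S y n x \<le> walks d {} y n x"
    by (auto simp: walks_def intro!: mult_left_mono)
qed

lemma walks_antisymmetric:
  assumes S: "S \<subseteq> {1..d}"
  shows "antisymmetric d S (walks d S y n)"
  unfolding antisymmetric_def
proof (intro ballI)
  fix i x assume i: "i \<in> S"
  hence i': "i \<in> {1..d}" using S by auto
  have f: "cfac S y i (- k) = - cfac S y i k" for k
  proof -
    have "bfps (- k - y i) = bfps (k + y i)" "bfps (- k + y i) = bfps (k - y i)"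
      using bfps_minus[of "k + y i"] bfps_minus[of "k - y i"] by (simp_all add: algebra_simps)
    thus ?thesis using i by (simp add: cfac_def)
  qed
  have "(\<Prod>j\<in>{1..d}. cfac S y j ((x(i := - x i)) j)) = cfac S y i (- x i) * (\<Prod>j\<in>{1..d}-{i}. cfac S y j ((x(i := - x i)) j))"
    using i' by (subst prod.remove[of _ i]) auto
  also have "(\<Prod>j\<in>{1..d}-{i}. cfac S y j ((x(i := - x i)) j)) = (\<Prod>j\<in>{1..d}-{i}. cfac S y j (x j))"
    by (intro prod.cong) auto
  also have "cfac S y i (- x i) * \<dots> = - (cfac S y i (x i) * \<dots>)" by (simp add: f)
  also have "cfac S y i (x i) * (\<Prod>j\<in>{1..d}-{i}. cfac S y j (x j)) = (\<Prod>j\<in>{1..d}. cfac S y j (x j))"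
    using i' by (subst prod.remove[of _ i]) auto
  finally have "(\<Prod>j\<in>{1..d}. cfac S y j ((x(i := - x i)) j)) = - (\<Prod>j\<in>{1..d}. cfac S y j (x j))" .
  thus "walks d S y n (x(i := - x i)) = - walks d S y n x"
    unfolding walks_def by simp
qed

lemma walks_prod: "walks d {} x n y = fact n * fps_nth (\<Prod>i\<in>{1..d}. bfps (y i - x i)) n"
  by (simp add: walks_def cfac_def)

lemma finite_walks_support:
  assumes x: "x \<in> grid d"
  shows "finite {u \<in> grid d. walks d {} x m u \<noteq> 0}"
proof (induction m)
  case 0
  have "{u \<in> grid d. walks d {} x 0 u \<noteq> 0} \<subseteq> {x}"
    using walks_0[of _ d "{}" x] x by (auto simp: orthant_empty open_orthant_empty split: if_splits)
  thus ?case by (rule finite_subset) simp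
next
  case (Suc m)
  let ?A = "{u \<in> grid d. walks d {} x m u \<noteq> 0}"
  have "{u \<in> grid d. walks d {} x (Suc m) u \<noteq> 0} \<subseteq>
     (\<Union>i\<in>{1..d}. (\<lambda>u. u(i := u i - 1)) ` ?A \<union> (\<lambda>u. u(i := u i + 1)) ` ?A)"
  proof
    fix u assume u: "u \<in> {u \<in> grid d. walks d {} x (Suc m) u \<noteq> 0}"
    hence "walks d {} x (Suc m) u \<noteq> 0" by blast
    hence "nbsum d (walks d {} x m) u \<noteq> 0" unfolding walks_Suc .
    then obtain i where i: "i \<in> {1..d}" "walks d {} x m (u(i := u i + 1)) + walks d {} x m (u(i := u i - 1)) \<noteq> 0"
      unfolding nbsum_def by (meson sum.not_neutral_contains_not_neutral)
    hence "u(i := u i + 1) \<in> ?A \<or> u(i := u i - 1) \<in> ?A" using u by auto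
    moreover have "u = (u(i := u i + 1))(i := (u(i := u i + 1)) i - 1)"
      "u = (u(i := u i - 1))(i := (u(i := u i - 1)) i + 1)" by simp_all
    ultimately show "u \<in> (\<Union>i\<in>{1..d}. (\<lambda>u. u(i := u i - 1)) ` ?A \<union> (\<lambda>u. u(i := u i + 1)) ` ?A)"
      using i(1) by blast
  qed
  thus ?case by (rule finite_subset) (use Suc in auto)
qed

text \<open>The Chapman-Kolmogorov identity. Self-adjointness of the neighbour sum moves one step at
  a time from the walk starting at \<open>y\<close> to the one starting at \<open>x\<close>.\<close>

lemma walks_semigroup:
  assumes x: "x \<in> grid d" and y: "y \<in> grid d"
  shows "((\<lambda>u. walks d {} x m u * walks d {} y n u) has_sum walks d {} x (m + n) y) (grid d)"
proof (induction n arbitrary: m)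
  case 0
  have w0: "walks d {} y 0 u = (if u = y then 1 else 0)" if "u \<in> grid d" for u
    using walks_0[of u d "{}" y] that y by (simp add: orthant_empty open_orthant_empty)
  show ?case
    by (rule has_sum_finite_neutralI[where B = "{y}"]) (use y in \<open>auto simp: w0\<close>)
next
  case (Suc n)
  let ?f = "walks d {} x m" and ?g = "walks d {} y n"
  note fin = finite_walks_support[OF x, of m]
  have "((\<lambda>u. nbsum d ?f u * ?g u) has_sum (\<Sum>\<^sub>\<infinity>u\<in>grid d. ?f u * nbsum d ?g u)) (grid d)"
    by (rule nbsum_symmetric(2)[OF fin])
  moreover have "((\<lambda>u. nbsum d ?f u * ?g u) has_sum walks d {} x (Suc m + n) y) (grid d)"
    using Suc.IH[of "Suc m"] by (simp add: walks_Suc)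
  ultimately have "(\<Sum>\<^sub>\<infinity>u\<in>grid d. ?f u * nbsum d ?g u) = walks d {} x (Suc m + n) y"
    by (rule has_sum_unique)
  moreover have "((\<lambda>u. ?f u * nbsum d ?g u) has_sum (\<Sum>\<^sub>\<infinity>u\<in>grid d. ?f u * nbsum d ?g u)) (grid d)"
    by (rule has_sum_infsum[OF nbsum_symmetric(1)[OF fin]])
  ultimately show ?case by (simp add: walks_Suc)
qed

section \<open>Green's functions and their convolution squares\<close>

definition valency :: "nat \<Rightarrow> real" where "valency d = 2 * real d"

lemma valency_nonneg [simp]: "0 \<le> valency d" by (simp add: valency_def)

text \<open>The exponent is \<open>Suc n\<close> and not \<open>n\<close> because the Laplacian is
  unnormalised: it is 2d times the identity minus the transition operator.\<close>

definition green :: "nat \<Rightarrow> nat set \<Rightarrow> (nat \<Rightarrow> int) \<Rightarrow> (nat \<Rightarrow> int) \<Rightarrow> real" where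
  "green d S y x = (\<Sum>n. walks d S y n x / (valency d) ^ Suc n)"

text \<open>The inner product of two free Green's functions, that is, the kernel of the inverse
  square of the Laplacian. The weight \<open>Suc n\<close> counts the ways to split a walk of
  \<open>n\<close> steps into two.\<close>

definition green_pair :: "nat \<Rightarrow> (nat \<Rightarrow> int) \<Rightarrow> (nat \<Rightarrow> int) \<Rightarrow> real" where
  "green_pair d x y = (\<Sum>n. real (Suc n) * walks d {} x n y / (valency d) ^ (n + 2))"

lemma has_sum_mult_nonneg:
  fixes f :: "'a \<Rightarrow> real" and g :: "'b \<Rightarrow> real"
  assumes f: "(f has_sum a) A" "\<And>x. x \<in> A \<Longrightarrow> 0 \<le> f x" and g: "(g has_sum b) B" "\<And>x. x \<in> B \<Longrightarrow> 0 \<le> g x"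
  shows "((\<lambda>(x, y). f x * g y) has_sum (a * b)) (A \<times> B)"
proof (rule has_sum_SigmaI[where g = "\<lambda>x. f x * b"])
  show i: "((\<lambda>y. case (x, y) of (x, y) \<Rightarrow> f x * g y) has_sum f x * b) B" if "x \<in> A" for x
    using g(1) by (auto intro: has_sum_cmult_right)
  show o: "((\<lambda>x. f x * b) has_sum a * b) A" using f(1) by (rule has_sum_cmult_left)
  show "(\<lambda>(x, y). f x * g y) summable_on A \<times> B"
    by (rule summable_on_SigmaI[where g = "\<lambda>x. f x * b"])
       (use i has_sum_imp_summable[OF o] f g in auto)
qed

lemma mult_divide_power_Suc: "D \<noteq> 0 \<Longrightarrow> D * (a / D ^ Suc n) = a / D ^ n" for D :: real
  by simp

text \<open>Finiteness of the weighted sum over all return times is more than transience of the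
  walk: it makes the Green's function square summable. All other displacements are dominated by
  displacement 0.\<close>

locale transient =
  fixes d :: nat
  assumes d_pos: "d \<ge> 1" and green_integral_finite: "green_integral d (\<lambda>_. 0) < \<infinity>"
begin

lemma valency_pos: "valency d > 0" using d_pos by (simp add: valency_def)
lemma valency_ne: "valency d \<noteq> 0" using valency_pos by simp

lemma walks_nonneg: "x \<in> grid d \<Longrightarrow> y \<in> grid d \<Longrightarrow> 0 \<le> walks d {} x n y"
  using walks_bounds[of y d "{}" x] by (simp add: orthant_empty open_orthant_empty)

lemma green_pair_summable:
  assumes x: "x \<in> grid d" and y: "y \<in> grid d"
  shows "summable (\<lambda>n. real (Suc n) * walks d {} x n y / (valency d) ^ (n + 2))"
    and "ennreal ((valency d)\<^sup>2 * green_pair d x y) = green_integral d (\<lambda>i. y i - x i)"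
proof -
  let ?f = "\<lambda>n. real (Suc n) * walks d {} x n y / (valency d) ^ n"
  have nn: "0 \<le> ?f n" for n using walks_nonneg[OF x y] by simp
  have "ennreal (?f n) = ennreal (fact (Suc n) * fps_nth (\<Prod>i\<in>{1..d}. bfps (y i - x i)) n / (valency d) ^ n)" for n
    unfolding walks_prod fact_Suc by (simp only: mult.assoc)
  hence e: "green_integral d (\<lambda>i. y i - x i) = (\<Sum>n. ennreal (?f n))"
    unfolding green_integral_suminf valency_def[symmetric] by simp
  have "green_integral d (\<lambda>i. y i - x i) < \<infinity>"
    using green_integral_le_0 green_integral_finite by (rule le_less_trans)
  hence s: "summable ?f" unfolding e by (intro summable_suminf_not_top nn) auto
  have q: "real (Suc n) * walks d {} x n y / (valency d) ^ (n + 2) = ?f n / (valency d)\<^sup>2" for n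
    by (simp only: power_add divide_divide_eq_left)
  show "summable (\<lambda>n. real (Suc n) * walks d {} x n y / (valency d) ^ (n + 2))"
    unfolding q by (rule summable_divide[OF s])
  have "green_pair d x y = suminf ?f / (valency d)\<^sup>2"
    unfolding green_pair_def q by (rule suminf_divide[OF s])
  hence "(valency d)\<^sup>2 * green_pair d x y = suminf ?f" using valency_pos by simp
  thus "ennreal ((valency d)\<^sup>2 * green_pair d x y) = green_integral d (\<lambda>i. y i - x i)"
    unfolding e using suminf_ennreal_eq[OF nn summable_sums[OF s]] by simp
qed

lemma walks_summable_free:
  assumes x: "x \<in> grid d" and y: "y \<in> grid d"
  shows "summable (\<lambda>n. walks d {} x n y / (valency d) ^ Suc n)"
proof (rule summable_comparison_test[OF _ summable_mult[OF green_pair_summable(1)[OF x y], of "valency d"]])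
  show "\<exists>N. \<forall>n\<ge>N. norm (walks d {} x n y / (valency d) ^ Suc n)
    \<le> valency d * (real (Suc n) * walks d {} x n y / (valency d) ^ (n + 2))"
  proof (intro exI allI impI)
    fix n
    have w: "0 \<le> walks d {} x n y / (valency d) ^ Suc n" using walks_nonneg[OF x y] by simp
    hence "1 * (walks d {} x n y / (valency d) ^ Suc n) \<le> real (Suc n) * (walks d {} x n y / (valency d) ^ Suc n)"
      by (intro mult_right_mono) auto
    also have "\<dots> = valency d * (real (Suc n) * walks d {} x n y / (valency d) ^ (n + 2))"
      using valency_pos by simp
    finally show "norm (walks d {} x n y / (valency d) ^ Suc n)
      \<le> valency d * (real (Suc n) * walks d {} x n y / (valency d) ^ (n + 2))" using w by simp
  qed
qed

text \<open>Domination by free walks is available on the orthant only, so the point is folded there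
  first; antisymmetry preserves absolute values.\<close>

lemma walks_summable:
  assumes S: "S \<subseteq> {1..d}" and y: "y \<in> open_orthant d S" and x: "x \<in> grid d"
  shows "summable (\<lambda>n. walks d S y n x / (valency d) ^ Suc n)"
proof -
  let ?x = "fold_abs S x"
  have o: "?x \<in> orthant d S" using fold_abs_orthant[OF S x] .
  have g: "?x \<in> grid d" "y \<in> grid d" using o y by (auto simp: orthant_def open_orthant_def)
  have "\<bar>walks d S y n ?x\<bar> = \<bar>walks d S y n x\<bar>" for n
    by (rule reflection_invariant_fold_abs[OF S x, of "\<lambda>x. \<bar>walks d S y n x\<bar>"])
       (use walks_antisymmetric[OF S, of y n] in \<open>simp add: reflection_eq antisymmetric_def del: fun_upd_apply\<close>)
  hence "\<bar>walks d S y n x\<bar> \<le> walks d {} y n ?x" for n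
    using walks_bounds[OF o y, of n] by (metis abs_of_nonneg)
  hence "norm (walks d S y n x / (valency d) ^ Suc n) \<le> walks d {} y n ?x / (valency d) ^ Suc n" for n
    by (simp add: power_abs divide_right_mono del: power_Suc)
  hence "\<exists>N. \<forall>n\<ge>N. norm (walks d S y n x / (valency d) ^ Suc n) \<le> walks d {} y n ?x / (valency d) ^ Suc n"
    by blast
  thus ?thesis using walks_summable_free[OF g(2,1)] by (rule summable_comparison_test)
qed

lemma green_sums:
  assumes S: "S \<subseteq> {1..d}" and y: "y \<in> open_orthant d S" and x: "x \<in> grid d"
  shows "(\<lambda>n. walks d S y n x / (valency d) ^ Suc n) sums green d S y x"
  unfolding green_def by (rule summable_sums[OF walks_summable[OF assms]])

lemma green_antisymmetric:
  assumes S: "S \<subseteq> {1..d}" and y: "y \<in> open_orthant d S"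
  shows "antisymmetric d S (green d S y)"
  unfolding antisymmetric_def
proof (intro ballI)
  fix i x assume i: "i \<in> S" and x: "x \<in> grid d"
  have "walks d S y n (x(i := - x i)) = - walks d S y n x" for n
    using walks_antisymmetric[OF S] i x unfolding antisymmetric_def by blast
  thus "green d S y (x(i := - x i)) = - green d S y x"
    unfolding green_def by (simp only: minus_divide_left[symmetric] suminf_minus[OF walks_summable[OF S y x]])
qed

lemma green_bounds:
  assumes S: "S \<subseteq> {1..d}" and y: "y \<in> open_orthant d S" and x: "x \<in> orthant d S"
  shows "0 \<le> green d S y x" and "green d S y x \<le> green d {} y x"
proof -
  have g: "x \<in> grid d" "y \<in> grid d" using x y by (simp_all add: orthant_def open_orthant_def)
  show "0 \<le> green d S y x"
    using walks_bounds(1)[OF x y] by (intro sums_le[OF _ sums_zero green_sums[OF S y g(1)]]) simp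
  show "green d S y x \<le> green d {} y x"
    using walks_bounds(2)[OF x y] g
    by (intro sums_le[OF _ green_sums[OF S y g(1)] green_sums[of "{}"]])
       (auto simp: open_orthant_empty intro!: divide_right_mono)
qed

lemma green_ge_sum:
  assumes S: "S \<subseteq> {1..d}" and y: "y \<in> open_orthant d S" and x: "x \<in> orthant d S"
  shows "(\<Sum>n<N. walks d S y n x / (valency d) ^ Suc n) \<le> green d S y x"
proof -
  have g: "x \<in> grid d" using x by (auto simp: orthant_def)
  show ?thesis unfolding green_def
    using walks_bounds(1)[OF x y] by (intro sum_le_suminf walks_summable[OF S y g]) auto
qed

text \<open>The neighbour sum advances the step count by one, so the series telescopes down to its
  term of length 0. Outside the orthant this term also records the signed images of the
  pole.\<close>

lemma laplacian_green:
  assumes S: "S \<subseteq> {1..d}" and y: "y \<in> open_orthant d S" and x: "x \<in> grid d"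
  shows "laplacian d (green d S y) x = walks d S y 0 x"
proof -
  let ?D = "valency d"
  have "(\<lambda>n. \<Sum>i\<in>{1..d}. walks d S y n (x(i := x i + 1)) / ?D ^ Suc n + walks d S y n (x(i := x i - 1)) / ?D ^ Suc n)
     sums nbsum d (green d S y) x"
    unfolding nbsum_def by (intro sums_sum sums_add green_sums[OF S y]) (use x in auto)
  also have "(\<lambda>n. \<Sum>i\<in>{1..d}. walks d S y n (x(i := x i + 1)) / ?D ^ Suc n + walks d S y n (x(i := x i - 1)) / ?D ^ Suc n)
     = (\<lambda>n. walks d S y (Suc n) x / ?D ^ Suc n)"
    unfolding walks_Suc nbsum_def sum_divide_distrib add_divide_distrib ..
  finally have A: "(\<lambda>n. walks d S y (Suc n) x / ?D ^ Suc n) sums nbsum d (green d S y) x" .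
  have "(\<lambda>n. ?D * (walks d S y n x / ?D ^ Suc n)) sums (?D * green d S y x)"
    by (rule sums_mult[OF green_sums[OF assms]])
  also have "(\<lambda>n. ?D * (walks d S y n x / ?D ^ Suc n)) = (\<lambda>n. walks d S y n x / ?D ^ n)"
    by (simp only: mult_divide_power_Suc[OF valency_ne])
  finally have "(\<lambda>n. walks d S y (Suc n) x / ?D ^ Suc n) sums (?D * green d S y x - walks d S y 0 x)"
    by (subst sums_Suc_iff) simp
  with A have "nbsum d (green d S y) x = ?D * green d S y x - walks d S y 0 x" by (rule sums_unique2)
  thus ?thesis unfolding laplacian_nbsum[OF x] by (simp add: valency_def)
qed

text \<open>All terms are nonnegative, so the three summations may be interchanged. Summing over the
  grid first merges two walks by the semigroup identity; summing over the two lengths first gives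
  the product of the Green's functions.\<close>

lemma green_pair_has_sum:
  assumes x: "x \<in> grid d" and y: "y \<in> grid d"
  shows "((\<lambda>u. green d {} x u * green d {} y u) has_sum green_pair d x y) (grid d)"
proof -
  let ?D = "valency d"
  let ?a = "\<lambda>z n u. walks d {} z n u / ?D ^ Suc n"
  let ?F = "\<lambda>((m, n), u). ?a x m u * ?a y n u"
  let ?g = "\<lambda>(m, n). walks d {} x (m + n) y / ?D ^ (m + n + 2)"
  have inner: "((\<lambda>u. ?F (p, u)) has_sum ?g p) (grid d)" for p
  proof -
    obtain m n where p: "p = (m, n)" by (cases p)
    have "((\<lambda>u. 1 / ?D ^ (m + n + 2) * (walks d {} x m u * walks d {} y n u)) has_sum
       (1 / ?D ^ (m + n + 2) * walks d {} x (m + n) y)) (grid d)"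
      by (intro has_sum_cmult_right walks_semigroup x y)
    moreover have "1 / ?D ^ (m + n + 2) * (walks d {} x m u * walks d {} y n u) = ?a x m u * ?a y n u" for u
      by (simp add: power_add)
    ultimately have "((\<lambda>u. ?a x m u * ?a y n u) has_sum (1 / ?D ^ (m + n + 2) * walks d {} x (m + n) y)) (grid d)"
      by (simp only:)
    thus ?thesis unfolding p prod.case by (simp only: times_divide_eq_left mult_1_left)
  qed
  have gs: "(?g has_sum green_pair d x y) UNIV"
  proof -
    \<comment> \<open>Pairs of lengths are grouped by their sum \<open>N\<close>. The term does not
      depend on \<open>m\<close>, so each group contributes \<open>Suc N\<close> equal
      terms.\<close>
    let ?h = "\<lambda>(N, m). walks d {} x N y / ?D ^ (N + 2)"
    have "(?h has_sum green_pair d x y) (Sigma (UNIV :: nat set) (\<lambda>N. {..N}))"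
    proof (rule has_sum_SigmaI[where g = "\<lambda>N. real (Suc N) * walks d {} x N y / ?D ^ (N + 2)"])
      show i: "((\<lambda>m. ?h (N, m)) has_sum real (Suc N) * walks d {} x N y / ?D ^ (N + 2)) {..N}" for N
        by (rule has_sum_finiteI) auto
      show o: "((\<lambda>N. real (Suc N) * walks d {} x N y / ?D ^ (N + 2)) has_sum green_pair d x y) UNIV"
        unfolding green_pair_def
        by (rule sums_nonneg_imp_has_sum[OF summable_sums[OF green_pair_summable(1)[OF x y]]])
           (use walks_nonneg[OF x y] in auto)
      show "?h summable_on Sigma (UNIV :: nat set) (\<lambda>N. {..N})"
        by (rule summable_on_SigmaI[OF i has_sum_imp_summable[OF o]]) (use walks_nonneg[OF x y] in auto)
    qed
    also have "?this \<longleftrightarrow> ?thesis"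
      by (rule has_sum_reindex_bij_witness[where j = "\<lambda>(N, m). (m, N - m)" and i = "\<lambda>(m, n). (m + n, m)"]) auto
    finally show ?thesis .
  qed
  have nn: "0 \<le> ?a z n u" if "z \<in> grid d" "u \<in> grid d" for z n u using walks_nonneg[OF that] by simp
  have "?F summable_on UNIV \<times> grid d"
    by (rule summable_on_SigmaI[OF inner has_sum_imp_summable[OF gs]])
       (auto simp del: power_Suc intro!: divide_nonneg_nonneg mult_nonneg_nonneg walks_nonneg x y)
  hence "(?F has_sum green_pair d x y) (UNIV \<times> grid d)"
    by (rule has_sum_SigmaI[OF inner gs])
  hence sw: "((\<lambda>(u, p). ?F (p, u)) has_sum green_pair d x y) (grid d \<times> UNIV)"
    by (subst (asm) has_sum_swap) 
  show ?thesis
  proof (rule has_sum_SigmaD[OF sw])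
    fix u assume u: "u \<in> grid d"
    have gh: "((\<lambda>n. ?a z n u) has_sum green d {} z u) UNIV" if "z \<in> grid d" for z
      using green_sums[of "{}" z u] that u
      by (intro sums_nonneg_imp_has_sum nn) (auto simp: open_orthant_empty)
    have "((\<lambda>(m, n). ?a x m u * ?a y n u) has_sum (green d {} x u * green d {} y u)) (UNIV \<times> UNIV)"
      by (rule has_sum_mult_nonneg[OF gh[OF x] _ gh[OF y]]) (auto intro: nn x y u simp del: power_Suc)
    thus "((\<lambda>p. case (u, p) of (u, p) \<Rightarrow> ?F (p, u)) has_sum green d {} x u * green d {} y u) UNIV"
      by (simp add: case_prod_unfold)
  qed
qed

lemma green_pair_self: "green_pair d x x = green_pair d y y"
  by (simp add: green_pair_def walks_prod)

text \<open>The interaction of two distinct poles is strongest for neighbours; hence the difference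
  of two Green's functions has the least square sum when the poles are adjacent.\<close>

lemma green_pair_le_neighbour:
  assumes x: "x \<in> grid d" and y: "y \<in> grid d" and ne: "x \<noteq> y" and k: "k \<in> {1..d}"
  shows "green_pair d x y \<le> green_pair d x (x(k := x k + 1))"
proof -
  obtain i where i: "i \<in> {1..d}" "x i \<noteq> y i" using grid_eqI[OF x y] ne by blast
  let ?z = "x(k := x k + 1)"
  have zg: "?z \<in> grid d" using x k by simp
  have e: "(\<lambda>i. ?z i - x i) = ((\<lambda>_. 0)(k := 1))" by auto
  have "ennreal ((valency d)\<^sup>2 * green_pair d x y) \<le> ennreal ((valency d)\<^sup>2 * green_pair d x ?z)"
    unfolding green_pair_summable(2)[OF x y] green_pair_summable(2)[OF x zg] e
    using i by (intro green_integral_le_unit[OF i(1) _ k]) simp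
  moreover have "0 \<le> green_pair d x ?z"
    unfolding green_pair_def
    by (intro suminf_nonneg green_pair_summable(1)[OF x zg] divide_nonneg_nonneg mult_nonneg_nonneg walks_nonneg x zg) auto
  ultimately have "(valency d)\<^sup>2 * green_pair d x y \<le> (valency d)\<^sup>2 * green_pair d x ?z"
    by (subst (asm) ennreal_le_iff) auto
  thus ?thesis using valency_pos by simp
qed

lemma walks_neighbour:
  assumes "k \<in> {1..d}"
  shows "walks d {} x n (x(k := x k - 1)) = walks d {} x n (x(k := x k + 1))"
    and "k' \<in> {1..d} \<Longrightarrow> walks d {} x n (x(k := x k + 1)) = walks d {} x n (x(k' := x k' + 1))"
proof -
  have e: "(\<Prod>i\<in>{1..d}. bfps ((x(k := x k + c)) i - x i)) = bfps c * bfps 0 ^ (d - 1)" if "k \<in> {1..d}" for k c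
  proof -
    have "(\<Prod>i\<in>{1..d}. bfps ((x(k := x k + c)) i - x i)) = bfps c * (\<Prod>i\<in>{1..d}-{k}. bfps ((x(k := x k + c)) i - x i))"
      using that by (subst prod.remove[of _ k]) auto
    also have "(\<Prod>i\<in>{1..d}-{k}. bfps ((x(k := x k + c)) i - x i)) = (\<Prod>i\<in>{1..d}-{k}. bfps 0)"
      by (intro prod.cong) auto
    finally show ?thesis using that by simp
  qed
  have "bfps (-1) = bfps 1" by (rule bfps_minus)
  thus "walks d {} x n (x(k := x k - 1)) = walks d {} x n (x(k := x k + 1))"
    using e[OF assms, of 1] e[OF assms, of "-1"] by (simp add: walks_prod del: fun_upd_apply)
  show "walks d {} x n (x(k := x k + 1)) = walks d {} x n (x(k' := x k' + 1))" if "k' \<in> {1..d}"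
    using e[OF assms, of 1] e[OF that, of 1] by (simp add: walks_prod del: fun_upd_apply)
qed

text \<open>The Laplacian of the convolution square is the Green's function, and by symmetry all 2d
  neighbours contribute equally. In the series, closed walks carry the weights n + 1 and n, whose
  difference is 1.\<close>

lemma green_pair_neighbour_diff:
  assumes x: "x \<in> grid d" and k: "k \<in> {1..d}"
  shows "green_pair d x x - green_pair d x (x(k := x k + 1)) = green d {} x x / (valency d)"
proof -
  let ?D = "valency d" and ?e = "x(k := x k + 1)"
  have eg: "?e \<in> grid d" using x k by simp
  have w: "walks d {} x (Suc n) x = ?D * walks d {} x n ?e" for n
  proof -
    have "walks d {} x (Suc n) x = (\<Sum>i\<in>{1..d}. walks d {} x n ?e + walks d {} x n ?e)"
      unfolding walks_Suc nbsum_def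
      by (intro sum.cong refl) (metis walks_neighbour k)
    also have "\<dots> = ?D * walks d {} x n ?e" by (simp add: valency_def)
    finally show ?thesis .
  qed
  have "(\<lambda>n. real (Suc n) * walks d {} x n ?e / ?D ^ (n + 2)) sums green_pair d x ?e"
    unfolding green_pair_def by (rule summable_sums[OF green_pair_summable(1)[OF x eg]])
  moreover have "real (Suc n) * walks d {} x n ?e / ?D ^ (n + 2) = real (Suc n) * walks d {} x (Suc n) x / ?D ^ (Suc n + 2)" for n
    using valency_pos by (simp add: w)
  ultimately have A: "(\<lambda>n. real n * walks d {} x n x / ?D ^ (n + 2)) sums green_pair d x ?e"
    using sums_Suc_iff[of "\<lambda>n. real n * walks d {} x n x / ?D ^ (n + 2)"] by simp
  have "(\<lambda>n. real (Suc n) * walks d {} x n x / ?D ^ (n + 2)) sums green_pair d x x"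
    unfolding green_pair_def by (rule summable_sums[OF green_pair_summable(1)[OF x x]])
  from sums_diff[OF this A] have "(\<lambda>n. walks d {} x n x / ?D ^ (n + 2)) sums (green_pair d x x - green_pair d x ?e)"
    by (simp add: algebra_simps add_divide_distrib diff_divide_distrib)
  moreover have "(\<lambda>n. walks d {} x n x / ?D ^ Suc n / ?D) sums (green d {} x x / ?D)"
    by (intro sums_divide green_sums) (use x in \<open>auto simp: open_orthant_empty\<close>)
  ultimately show ?thesis
    using sums_unique2 by (fastforce simp: mult_ac)
qed

lemma green_diff_has_sum:
  assumes x: "x \<in> grid d" and y: "y \<in> grid d"
  shows "((\<lambda>u. (green d {} x u - green d {} y u)\<^sup>2) has_sum 2 * (green_pair d x x - green_pair d x y)) (grid d)"
proof -
  have "((\<lambda>u. (green d {} x u * green d {} x u + green d {} y u * green d {} y u) - 2 * (green d {} x u * green d {} y u))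
    has_sum ((green_pair d x x + green_pair d y y) - 2 * green_pair d x y)) (grid d)"
    by (intro has_sum_minus has_sum_add has_sum_cmult_right green_pair_has_sum x y)
  thus ?thesis using green_pair_self[of x y] by (simp add: power2_eq_square algebra_simps)
qed

text \<open>On the orthant the antisymmetrised Green's function lies between 0 and the free one. The
  resulting bound does not depend on \<open>S\<close>.\<close>

lemma green_ell2:
  assumes S: "S \<subseteq> {1..d}" and y: "y \<in> open_orthant d S"
  shows "(\<lambda>x. (green d S y x)\<^sup>2) summable_on orthant d S"
    and "(\<Sum>\<^sub>\<infinity>x\<in>orthant d S. (green d S y x)\<^sup>2) \<le> green_pair d y y"
    and "green d S y \<in> ell2 d"
proof -
  have yg: "y \<in> grid d" using y by (auto simp: open_orthant_def)
  have og: "orthant d S \<subseteq> grid d" by (auto simp: orthant_def)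
  have h: "((\<lambda>x. (green d {} y x)\<^sup>2) has_sum green_pair d y y) (grid d)"
    using green_pair_has_sum[OF yg yg] by (simp add: power2_eq_square)
  have le: "(green d S y x)\<^sup>2 \<le> (green d {} y x)\<^sup>2" if "x \<in> orthant d S" for x
    using green_bounds[OF S y that] by (intro power_mono)
  show s: "(\<lambda>x. (green d S y x)\<^sup>2) summable_on orthant d S"
    by (rule summable_on_comparison_test[OF summable_on_subset[OF has_sum_imp_summable[OF h] og]])
       (use le in auto)
  have "(\<Sum>\<^sub>\<infinity>x\<in>orthant d S. (green d S y x)\<^sup>2) \<le> (\<Sum>\<^sub>\<infinity>x\<in>grid d. (green d {} y x)\<^sup>2)"
    by (rule infsum_mono_neutral[OF s has_sum_imp_summable[OF h]]) (use le og in auto)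
  thus "(\<Sum>\<^sub>\<infinity>x\<in>orthant d S. (green d S y x)\<^sup>2) \<le> green_pair d y y" using infsumI[OF h] by simp
  show "green d S y \<in> ell2 d"
    unfolding ell2_def mem_Collect_eq
    by (rule summable_on_grid_from_orthant[OF S s])
       (use green_antisymmetric[OF S y] in \<open>simp add: antisymmetric_def del: fun_upd_apply\<close>)
qed

end

subsection \<open>Comparing cosines with squares\<close>

text \<open>Rounding half-integers away from zero keeps the map odd.\<close>

definition odd_frac :: "real \<Rightarrow> real" where
  "odd_frac t = t - sgn t * of_int (round \<bar>t\<bar>)"

lemma odd_frac_minus: "odd_frac (- t) = - odd_frac t"
  by (simp add: odd_frac_def sgn_minus)

lemma odd_frac_le_half: "\<bar>odd_frac t\<bar> \<le> 1 / 2"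
proof -
  have "odd_frac t = sgn t * (\<bar>t\<bar> - of_int (round \<bar>t\<bar>))"
    by (cases "t > 0"; cases "t < 0") (auto simp: odd_frac_def sgn_if algebra_simps)
  also have "\<bar>\<dots>\<bar> \<le> \<bar>\<bar>t\<bar> - of_int (round \<bar>t\<bar>)\<bar>"
    by (simp add: abs_mult sgn_if)
  also have "\<dots> \<le> 1 / 2" using of_int_round_abs_le[of "\<bar>t\<bar>"] by (simp only: abs_minus_commute)
  finally show ?thesis .
qed

lemma odd_frac_diff_Ints: "t - odd_frac t \<in> \<int>"
  by (simp add: odd_frac_def sgn_if)

lemma odd_frac_eq_self: "\<bar>t\<bar> < 1 / 2 \<Longrightarrow> odd_frac t = t"
  using round_unique'[of "\<bar>t\<bar>" 0] by (simp add: odd_frac_def)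

lemma odd_frac_abs_le: "\<bar>odd_frac t\<bar> \<le> \<bar>t\<bar>"
  using odd_frac_eq_self[of t] odd_frac_le_half[of t] by (cases "\<bar>t\<bar> < 1 / 2") auto

lemma cos_odd_frac: "cos (2 * pi * odd_frac t) = cos (2 * pi * t)"
proof -
  obtain n where n: "t - odd_frac t = of_int n" using odd_frac_diff_Ints[of t] by (auto elim: Ints_cases)
  hence "2 * pi * t = 2 * pi * odd_frac t + 2 * pi * of_int n" by (simp add: algebra_simps flip: n)
  thus ?thesis by (simp add: cos_add)
qed

lemma sin_ge_cubic:
  assumes "0 \<le> (x::real)"
  shows "x - x ^ 3 / 6 \<le> sin x"
proof -
  have "sin 0 - (0 - 0 ^ 3 / 6) \<le> sin x - (x - x ^ 3 / 6)"
  proof (rule DERIV_nonneg_imp_nondecreasing[OF assms])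
    fix t :: real
    have "((\<lambda>x. sin x - (x - x ^ 3 / 6)) has_real_derivative (cos t - (1 - t\<^sup>2 / 2))) (at t)"
      by (auto intro!: derivative_eq_intros)
    moreover have "0 \<le> cos t - (1 - t\<^sup>2 / 2)"
    proof -
      have "\<bar>sin (t / 2)\<bar> \<le> \<bar>t / 2\<bar>" by (rule abs_sin_x_le_abs_x)
      hence "(sin (t / 2))\<^sup>2 \<le> (t / 2)\<^sup>2" by (simp only: abs_le_square_iff)
      moreover have "cos t = 1 - 2 * (sin (t / 2))\<^sup>2" using cos_double_sin[of "t / 2"] by simp
      ultimately show ?thesis by (simp add: power_divide)
    qed
    ultimately show "\<exists>y. ((\<lambda>x. sin x - (x - x ^ 3 / 6)) has_real_derivative y) (at t) \<and> 0 \<le> y" by blast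
  qed
  thus ?thesis by simp
qed

text \<open>The loss is measured by a bound \<open>L\<close> on the summand itself, not by the size
  of \<open>t\<close>, because a small total controls every summand.\<close>

lemma one_minus_cos_lower:
  assumes t: "\<bar>t\<bar> \<le> 1 / 2" and L: "1 - cos (2 * pi * t) \<le> L"
  shows "2 * pi\<^sup>2 * (1 - 2 * L) * t\<^sup>2 \<le> 1 - cos (2 * pi * t)"
proof -
  define x where "x = pi * \<bar>t\<bar>"
  have x0: "0 \<le> x" by (simp add: x_def)
  have "x \<le> pi * (1 / 2)" unfolding x_def using t by (intro mult_left_mono) auto
  hence x2: "x < 2" using pi_half_less_two by simp
  have c: "1 - cos (2 * pi * t) = 2 * (sin x)\<^sup>2"
  proof -
    have "2 * pi * t = 2 * x \<or> 2 * pi * t = - (2 * x)" by (cases "t \<ge> 0") (auto simp: x_def)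
    hence "cos (2 * pi * t) = cos (2 * x)" by (metis cos_minus)
    thus ?thesis using cos_double_sin[of x] by simp
  qed
  have xx: "x\<^sup>2 \<le> 4" using power_mono[of x 2 2] x0 x2 by simp
  have s: "x * (1 - x\<^sup>2 / 6) \<le> sin x" using sin_ge_cubic[OF x0] by (simp add: power2_eq_square power3_eq_cube algebra_simps)
  have s2: "x\<^sup>2 * (1 - x\<^sup>2 / 6)\<^sup>2 \<le> (sin x)\<^sup>2"
    using power_mono[OF s, of 2] x0 xx by (simp add: power_mult_distrib)
  \<comment> \<open>Bootstrap: x < 2 gives the crude sin x >= x / 3, hence 2 x^2 / 9 <= L. This
    makes the loss x^2 / 3 in the cubic bound at most 2 L.\<close>
  have "(1/3)\<^sup>2 \<le> (1 - x\<^sup>2 / 6)\<^sup>2" using xx by (intro power_mono) auto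
  hence "x\<^sup>2 * (1/3)\<^sup>2 \<le> x\<^sup>2 * (1 - x\<^sup>2 / 6)\<^sup>2" by (rule mult_left_mono) simp
  with s2 L c have "2 * x\<^sup>2 / 9 \<le> L" by (simp add: power2_eq_square)
  hence "1 - 2 * L \<le> 1 - x\<^sup>2 / 3" using zero_le_power2[of x] by linarith
  also have "\<dots> \<le> (1 - x\<^sup>2 / 6)\<^sup>2"
  proof -
    have "0 \<le> (x\<^sup>2 / 6)\<^sup>2" by simp
    thus ?thesis by (simp add: power2_eq_square algebra_simps)
  qed
  finally have "x\<^sup>2 * (1 - 2 * L) \<le> x\<^sup>2 * (1 - x\<^sup>2 / 6)\<^sup>2" by (rule mult_left_mono) simp
  with s2 have "2 * (x\<^sup>2 * (1 - 2 * L)) \<le> 1 - cos (2 * pi * t)" unfolding c by linarith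
  thus ?thesis by (simp add: x_def power_mult_distrib algebra_simps)
qed

lemma one_minus_cos_upper: "1 - cos (2 * pi * t) \<le> 2 * pi\<^sup>2 * t\<^sup>2"
proof -
  have "\<bar>sin (pi * t)\<bar> \<le> \<bar>pi * t\<bar>" by (rule abs_sin_x_le_abs_x)
  hence "(sin (pi * t))\<^sup>2 \<le> (pi * t)\<^sup>2" by (simp only: abs_le_square_iff)
  moreover have "cos (2 * pi * t) = 1 - 2 * (sin (pi * t))\<^sup>2"
    using cos_double_sin[of "pi * t"] by (simp add: mult.assoc)
  ultimately show ?thesis by (simp add: power_mult_distrib)
qed

lemma one_minus_cos_summable:
  assumes "(\<lambda>x. (\<xi> x)\<^sup>2) summable_on R"
  shows "(\<lambda>x. 1 - cos (2 * pi * \<xi> x)) summable_on R"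
  by (rule summable_on_comparison_test[OF summable_on_cmult_right[OF assms, of "2 * pi\<^sup>2"]])
     (use one_minus_cos_upper in auto)

lemma one_minus_cos_infsum_upper:
  assumes "(\<lambda>x. (\<xi> x)\<^sup>2) summable_on R"
  shows "(\<Sum>\<^sub>\<infinity>x\<in>R. 1 - cos (2 * pi * \<xi> x)) \<le> 2 * pi\<^sup>2 * (\<Sum>\<^sub>\<infinity>x\<in>R. (\<xi> x)\<^sup>2)"
proof -
  have "(\<Sum>\<^sub>\<infinity>x\<in>R. 1 - cos (2 * pi * \<xi> x)) \<le> (\<Sum>\<^sub>\<infinity>x\<in>R. 2 * pi\<^sup>2 * (\<xi> x)\<^sup>2)"
    using assms one_minus_cos_upper
    by (intro infsum_mono one_minus_cos_summable summable_on_cmult_right) auto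
  also have "\<dots> = 2 * pi\<^sup>2 * (\<Sum>\<^sub>\<infinity>x\<in>R. (\<xi> x)\<^sup>2)" by (rule infsum_cmult_right')
  finally show ?thesis .
qed

text \<open>Either all summands are at most \<open>L\<close>, and the quadratic comparison applies
  everywhere, or a single summand exceeds \<open>L\<close> and alone already beats the claimed
  bound.\<close>

lemma one_minus_cos_infsum_lower:
  assumes s: "(\<lambda>x. (\<xi> x)\<^sup>2) summable_on R" and h: "\<And>x. x \<in> R \<Longrightarrow> \<bar>\<xi> x\<bar> \<le> 1 / 2"
    and q: "q \<le> (\<Sum>\<^sub>\<infinity>x\<in>R. (\<xi> x)\<^sup>2)" "0 \<le> q" and L: "L \<le> 1 / 2" "2 * pi\<^sup>2 * q \<le> L"
  shows "2 * pi\<^sup>2 * (1 - 2 * L) * q \<le> (\<Sum>\<^sub>\<infinity>x\<in>R. 1 - cos (2 * pi * \<xi> x))"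
proof (cases "\<forall>x\<in>R. 1 - cos (2 * pi * \<xi> x) \<le> L")
  case True
  have "2 * pi\<^sup>2 * (1 - 2 * L) * q \<le> 2 * pi\<^sup>2 * (1 - 2 * L) * (\<Sum>\<^sub>\<infinity>x\<in>R. (\<xi> x)\<^sup>2)"
    using L q by (intro mult_left_mono) auto
  also have "\<dots> = (\<Sum>\<^sub>\<infinity>x\<in>R. 2 * pi\<^sup>2 * (1 - 2 * L) * (\<xi> x)\<^sup>2)" by (rule infsum_cmult_right'[symmetric])
  also have "\<dots> \<le> (\<Sum>\<^sub>\<infinity>x\<in>R. 1 - cos (2 * pi * \<xi> x))"
    using True h by (intro infsum_mono one_minus_cos_summable summable_on_cmult_right s one_minus_cos_lower) auto
  finally show ?thesis .
next
  case False
  then obtain x where x: "x \<in> R" "1 - cos (2 * pi * \<xi> x) > L" by auto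
  have L0: "0 \<le> L" using L(2) q(2) by (meson mult_nonneg_nonneg order_trans zero_le_numeral zero_le_power2)
  have "(\<Sum>\<^sub>\<infinity>x\<in>{x}. 1 - cos (2 * pi * \<xi> x)) \<le> (\<Sum>\<^sub>\<infinity>x\<in>R. 1 - cos (2 * pi * \<xi> x))"
    by (rule infsum_mono_neutral) (use x one_minus_cos_summable[OF s] in auto)
  hence "L \<le> (\<Sum>\<^sub>\<infinity>x\<in>R. 1 - cos (2 * pi * \<xi> x))" using x by simp
  moreover have "2 * pi\<^sup>2 * (1 - 2 * L) * q \<le> 2 * pi\<^sup>2 * q"
  proof -
    have "(1 - 2 * L) * (2 * pi\<^sup>2 * q) \<le> 1 * (2 * pi\<^sup>2 * q)"
      using q L0 by (intro mult_right_mono) auto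
    thus ?thesis by (simp add: mult_ac)
  qed
  ultimately show ?thesis using L(2) by linarith
qed

subsection \<open>Reduction modulo one\<close>

lemma ell2_diff:
  assumes "f \<in> ell2 d" "g \<in> ell2 d"
  shows "(\<lambda>x. f x - g x) \<in> ell2 d"
proof -
  have "(\<lambda>x. 2 * (f x)\<^sup>2 + 2 * (g x)\<^sup>2) summable_on grid d"
    using assms by (intro summable_on_add summable_on_cmult_right) (auto simp: ell2_def)
  moreover have "(a - b)\<^sup>2 \<le> 2 * a\<^sup>2 + 2 * b\<^sup>2" for a b :: real
    using zero_le_power2[of "a + b"] by (simp add: power2_eq_square algebra_simps)
  ultimately show ?thesis unfolding ell2_def mem_Collect_eq
    by (rule summable_on_comparison_test) auto
qed

lemma ell2_mult: "f \<in> ell2 d \<Longrightarrow> (\<lambda>x. c * f x) \<in> ell2 d"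
  by (auto simp: ell2_def power_mult_distrib intro!: summable_on_cmult_right)

lemma odd_frac_ell2: "\<xi> \<in> ell2 d \<Longrightarrow> (\<lambda>x. odd_frac (\<xi> x)) \<in> ell2 d"
  unfolding ell2_def mem_Collect_eq
  by (erule summable_on_comparison_test) (use odd_frac_abs_le in \<open>auto simp flip: abs_le_square_iff\<close>)

lemma laplacian_odd_frac:
  assumes "x \<in> grid d"
  shows "laplacian d (\<lambda>x. odd_frac (\<xi> x)) x = laplacian d \<xi> x - laplacian d (\<lambda>x. \<xi> x - odd_frac (\<xi> x)) x"
  using laplacian_diff[OF assms, of \<xi> "\<lambda>x. \<xi> x - odd_frac (\<xi> x)"] by simp

lemma odd_frac_harmonic: "harmonic_mod_1 d \<xi> \<Longrightarrow> harmonic_mod_1 d (\<lambda>x. odd_frac (\<xi> x))"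
  unfolding harmonic_mod_1_def
  by (auto simp: laplacian_odd_frac intro!: Ints_diff laplacian_Ints odd_frac_diff_Ints)

lemma odd_frac_antisymmetric: "antisymmetric d S \<xi> \<Longrightarrow> antisymmetric d S (\<lambda>x. odd_frac (\<xi> x))"
  by (simp add: antisymmetric_def odd_frac_minus)

lemma odd_frac_zero_mod_1: "(\<And>x. x \<in> grid d \<Longrightarrow> odd_frac (\<xi> x) = 0) \<Longrightarrow> zero_mod_1 d \<xi>"
  unfolding zero_mod_1_def using odd_frac_diff_Ints by (metis diff_zero)

lemma C1_has_sum: "f \<in> C1 d \<Longrightarrow> (f has_sum 0) (grid d)"
  by (rule has_sum_finite_neutralI[where B = "{x \<in> grid d. f x \<noteq> 0}"]) (auto simp: C1_def)

text \<open>A square summable function is at least 1/2 in absolute value at finitely many points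
  only, so the reduction changes finitely many values and keeps the total of the Laplacian at
  0.\<close>

lemma odd_frac_laplacian_has_sum:
  assumes "\<xi> \<in> ell2 d" "laplacian d \<xi> \<in> C1 d"
  shows "(laplacian d (\<lambda>x. odd_frac (\<xi> x)) has_sum 0) (grid d)"
proof -
  have "{x \<in> grid d. \<xi> x - odd_frac (\<xi> x) \<noteq> 0} \<subseteq> {x \<in> grid d. \<bar>\<xi> x\<bar> \<ge> 1 / 2}"
  proof
    fix x assume "x \<in> {x \<in> grid d. \<xi> x - odd_frac (\<xi> x) \<noteq> 0}"
    thus "x \<in> {x \<in> grid d. \<bar>\<xi> x\<bar> \<ge> 1 / 2}" using odd_frac_eq_self[of "\<xi> x"] by force
  qed
  moreover have "finite {x \<in> grid d. \<bar>\<xi> x\<bar> \<ge> 1 / 2}" by (rule ell2_finite_ge[OF assms(1)]) simp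
  ultimately have fin: "finite {x \<in> grid d. \<xi> x - odd_frac (\<xi> x) \<noteq> 0}" by (rule finite_subset)
  have "((\<lambda>x. laplacian d \<xi> x - laplacian d (\<lambda>x. \<xi> x - odd_frac (\<xi> x)) x) has_sum (0 - 0)) (grid d)"
    by (intro has_sum_minus C1_has_sum[OF assms(2)] has_sum_laplacian_zero[OF fin])
  moreover have "(laplacian d (\<lambda>x. odd_frac (\<xi> x)) has_sum 0) (grid d) \<longleftrightarrow>
    ((\<lambda>x. laplacian d \<xi> x - laplacian d (\<lambda>x. \<xi> x - odd_frac (\<xi> x)) x) has_sum 0) (grid d)"
    by (rule has_sum_cong) (rule laplacian_odd_frac)
  ultimately show ?thesis by simp
qed

subsection \<open>Lower bounds for the square sum\<close>

text \<open>At a point of the open orthant the Laplacian sees values on the closed orthant only, so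
  the orthant sum controls it.\<close>

lemma neighbours_in_orthant:
  assumes S: "S \<subseteq> {1..d}" and x: "x \<in> open_orthant d S" and a: "adjacent d x w"
  shows "w \<in> orthant d S"
proof -
  have xg: "x \<in> grid d" using x by (simp add: open_orthant_def)
  then obtain i where i: "i \<in> {1..d}" "w = x(i := x i + 1) \<or> w = x(i := x i - 1)"
    using a adjacent_iff by blast
  have "0 \<le> w k" if "k \<in> S" for k
  proof -
    have "0 < x k" using x that by (simp add: open_orthant_def)
    thus ?thesis using i(2) by auto
  qed
  moreover have "w \<in> grid d" using a by (simp add: adjacent_def)
  ultimately show ?thesis by (simp add: orthant_def)
qed

lemma finite_adjacent: "x \<in> grid d \<Longrightarrow> finite {w. adjacent d x w}"
proof -
  assume x: "x \<in> grid d"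
  have "{w. adjacent d x w} \<subseteq> (\<lambda>i. x(i := x i + 1)) ` {1..d} \<union> (\<lambda>i. x(i := x i - 1)) ` {1..d}"
    using adjacent_iff[OF x] by auto
  thus ?thesis by (rule finite_subset) simp
qed

lemma card_adjacent: "x \<in> grid d \<Longrightarrow> real (card {w. adjacent d x w}) = 2 * real d"
  using sum_adjacent[of x d "\<lambda>_. 1 :: real"] by (simp add: nbsum_def)

text \<open>At each of the n points 1 <= 2d |xi(x)| + sum of |xi| over the neighbours.
  Cauchy-Schwarz over the n points, and over each set of 2d neighbours, shows that the square sum is
  at least n / (4 d^2) to leading order.\<close>

lemma infsum_square_ge_support:
  assumes S: "S \<subseteq> {1..d}" and d: "d \<ge> 1" and s: "(\<lambda>x. (\<xi> x)\<^sup>2) summable_on orthant d S"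
    and X: "X \<subseteq> open_orthant d S" "finite X" "card X = n"
    and one: "\<And>x. x \<in> X \<Longrightarrow> 1 \<le> \<bar>laplacian d \<xi> x\<bar>"
  shows "real n / (2 * real d + sqrt (2 * real d * real n))\<^sup>2 \<le> (\<Sum>\<^sub>\<infinity>x\<in>orthant d S. (\<xi> x)\<^sup>2)"
proof -
  define q where "q = (\<Sum>\<^sub>\<infinity>x\<in>orthant d S. (\<xi> x)\<^sup>2)"
  have q0: "0 \<le> q" unfolding q_def by (intro infsum_nonneg) simp
  have cs: "(\<Sum>w\<in>F. \<bar>\<xi> w\<bar>) \<le> sqrt q * sqrt (real (card F))" if F: "finite F" "F \<subseteq> orthant d S" for F
  proof -
    have "(\<Sum>w\<in>F. \<bar>\<xi> w\<bar>)\<^sup>2 \<le> (\<Sum>w\<in>F. \<bar>\<xi> w\<bar>\<^sup>2) * card F" by (rule sum_squared_le_sum_of_squares)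
    also have "(\<Sum>w\<in>F. \<bar>\<xi> w\<bar>\<^sup>2) \<le> q" unfolding q_def
      using F finite_sum_le_infsum[OF s F] by simp
    finally have "(\<Sum>w\<in>F. \<bar>\<xi> w\<bar>)\<^sup>2 \<le> q * card F" by (simp add: mult_right_mono)
    hence "\<bar>\<Sum>w\<in>F. \<bar>\<xi> w\<bar>\<bar> \<le> sqrt (q * card F)" by (metis real_sqrt_le_iff real_sqrt_abs)
    thus ?thesis by (simp add: real_sqrt_mult)
  qed
  have Xg: "x \<in> grid d" if "x \<in> X" for x using that X by (auto simp: open_orthant_def)
  have "real n = (\<Sum>x\<in>X. 1)" using X by simp
  also have "\<dots> \<le> (\<Sum>x\<in>X. 2 * real d * \<bar>\<xi> x\<bar> + (\<Sum>w | adjacent d x w. \<bar>\<xi> w\<bar>))"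
  proof (rule sum_mono)
    fix x assume x: "x \<in> X"
    have "\<bar>laplacian d \<xi> x\<bar> \<le> \<bar>2 * real d * \<xi> x\<bar> + \<bar>\<Sum>w | adjacent d x w. \<xi> w\<bar>"
      unfolding laplacian_def by (rule abs_triangle_ineq4)
    also have "\<dots> \<le> 2 * real d * \<bar>\<xi> x\<bar> + (\<Sum>w | adjacent d x w. \<bar>\<xi> w\<bar>)"
      by (intro add_mono sum_abs) (simp add: abs_mult)
    finally show "1 \<le> 2 * real d * \<bar>\<xi> x\<bar> + (\<Sum>w | adjacent d x w. \<bar>\<xi> w\<bar>)" using one[OF x] by simp
  qed
  also have "\<dots> = 2 * real d * (\<Sum>x\<in>X. \<bar>\<xi> x\<bar>) + (\<Sum>x\<in>X. \<Sum>w | adjacent d x w. \<bar>\<xi> w\<bar>)"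
    by (simp add: sum.distrib sum_distrib_left)
  also have "\<dots> \<le> 2 * real d * (sqrt q * sqrt (real n)) + (\<Sum>x\<in>X. sqrt q * sqrt (2 * real d))"
  proof (intro add_mono mult_left_mono sum_mono)
    show "(\<Sum>x\<in>X. \<bar>\<xi> x\<bar>) \<le> sqrt q * sqrt (real n)"
      using cs[of X] X open_orthant_subset[of d S] by auto
    fix x assume x: "x \<in> X"
    have "(\<Sum>w | adjacent d x w. \<bar>\<xi> w\<bar>) \<le> sqrt q * sqrt (real (card {w. adjacent d x w}))"
      using x X neighbours_in_orthant[OF S] by (intro cs finite_adjacent Xg) auto
    thus "(\<Sum>w | adjacent d x w. \<bar>\<xi> w\<bar>) \<le> sqrt q * sqrt (2 * real d)"
      unfolding card_adjacent[OF Xg[OF x]] .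
  qed simp
  also have "\<dots> = sqrt q * (sqrt (real n) * (2 * real d + sqrt (2 * real d * real n)))"
    using X by (simp add: real_sqrt_mult algebra_simps)
  finally have le: "real n \<le> sqrt q * (sqrt (real n) * (2 * real d + sqrt (2 * real d * real n)))" .
  define M where "M = 2 * real d + sqrt (2 * real d * real n)"
  have M: "M > 0" unfolding M_def using d by (intro add_pos_nonneg) auto
  have "(real n)\<^sup>2 \<le> (sqrt q * (sqrt (real n) * M))\<^sup>2"
    using le unfolding M_def by (intro power_mono) auto
  also have "\<dots> = q * M\<^sup>2 * real n" using q0 by (simp add: power_mult_distrib)
  finally have "real n * real n \<le> (q * M\<^sup>2) * real n" by (simp add: power2_eq_square)
  hence "real n \<le> q * M\<^sup>2" using q0 by (cases "n = 0") auto
  thus ?thesis using M unfolding q_def[symmetric] M_def[symmetric] by (simp add: divide_le_eq)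
qed

lemma Ints_ge_1: "(a::real) \<in> \<int> \<Longrightarrow> a \<noteq> 0 \<Longrightarrow> 1 \<le> \<bar>a\<bar>"
  by (rule Ints_nonzero_abs_ge1)

section \<open>A Laplacian with few support points forces a multiple of a Green's function\<close>

context transient begin

text \<open>The Laplacian is prescribed on the open orthant only. On the walls the Laplacian of the
  difference vanishes by antisymmetry, and reflections carry this to the whole grid, where
  uniqueness applies.\<close>

lemma eq_green:
  assumes S: "S \<subseteq> {1..d}" and y: "y \<in> open_orthant d S" and l2: "\<xi> \<in> ell2 d" and as: "antisymmetric d S \<xi>"
    and lap: "\<And>x. x \<in> open_orthant d S \<Longrightarrow> laplacian d \<xi> x = (if x = y then a else 0)"
    and x: "x \<in> grid d"
  shows "\<xi> x = a * green d S y x"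
proof -
  let ?\<eta> = "\<lambda>x. \<xi> x - a * green d S y x"
  have l2': "?\<eta> \<in> ell2 d" by (intro ell2_diff l2 ell2_mult green_ell2[OF S y])
  have as': "antisymmetric d S ?\<eta>" using as green_antisymmetric[OF S y]
    by (simp add: antisymmetric_def del: fun_upd_apply)
  have lap': "laplacian d ?\<eta> z = laplacian d \<xi> z - a * walks d S y 0 z" if "z \<in> grid d" for z
    using that laplacian_green[OF S y that] by (simp add: laplacian_diff laplacian_mult)
  have z: "laplacian d ?\<eta> z = 0" if z: "z \<in> orthant d S" for z
  proof (cases "z \<in> open_orthant d S")
    case True
    thus ?thesis using lap'[of z] z lap[of z] walks_0[OF z y] by (auto simp: orthant_def)
  next
    case False
    then obtain i where "i \<in> S" "z i = 0" "z \<in> grid d" using z by (force simp: open_orthant_def orthant_def)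
    thus ?thesis using antisymmetric_zero_on_wall[OF antisymmetric_laplacian[OF S as']] by blast
  qed
  have "laplacian d ?\<eta> z = 0" if "z \<in> grid d" for z
    by (rule antisymmetric_zeroI[OF S antisymmetric_laplacian[OF S as'] z that])
  from ell2_harmonic_zero[OF l2' this d_pos x] show ?thesis by simp
qed

text \<open>\<open>N\<close> consists of all upward neighbours, and the downward ones in directions
  outside \<open>S\<close>: these stay in the open orthant wherever the pole is. A downward
  neighbour in a direction of \<open>S\<close> may lie on a wall, where the Green's function is
  0.\<close>

lemma green_neighbourhood_lower:
  assumes S: "S \<subseteq> {1..d}" and y: "y \<in> open_orthant d S"
  obtains N where "finite N" "N \<subseteq> orthant d S" "y \<notin> N" "real (card N) = 2 * real d - real (card S)"
    "1 / (2 * real d) + (2 * real d - real (card S)) / (2 * real d) ^ 3 \<le> green d S y y"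
    "\<And>w. w \<in> N \<Longrightarrow> 1 / (2 * real d) ^ 2 \<le> green d S y w"
proof -
  have yg: "y \<in> grid d" using y by (simp add: open_orthant_def)
  have yo: "y \<in> orthant d S" using y open_orthant_subset by blast
  let ?m = "2 * real d - real (card S)"
  have fS: "finite S" using S finite_subset by blast
  have cS: "card S \<le> d" using card_mono[OF _ S] by simp
  let ?up = "\<lambda>i. y(i := y i + 1)" and ?dn = "\<lambda>i. y(i := y i - 1)"
  define U where "U = ?up ` {1..d}"
  define D where "D = ?dn ` ({1..d} - S)"
  have iu: "inj_on ?up {1..d}"
  proof (rule inj_onI)
    fix i j assume "?up i = ?up j"
    from fun_cong[OF this, of i] show "i = j" by (auto split: if_splits)
  qed
  have id: "inj_on ?dn ({1..d} - S)"
  proof (rule inj_onI)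
    fix i j assume "?dn i = ?dn j"
    from fun_cong[OF this, of i] show "i = j" by (auto split: if_splits)
  qed
  have UD: "U \<inter> D = {}"
  proof -
    have "?up i \<noteq> ?dn j" for i j
    proof
      assume "?up i = ?dn j"
      from fun_cong[OF this, of i] show False by (auto split: if_splits)
    qed
    thus ?thesis by (auto simp: U_def D_def)
  qed
  have yN: "y \<notin> U \<union> D"
  proof
    assume "y \<in> U \<union> D"
    then obtain i c where "y = y(i := y i + c)" "c \<noteq> 0"
      unfolding U_def D_def by (auto simp: fun_upd_def) (metis add.commute add_diff_cancel_left' diff_add_cancel zero_neq_one)+
    from fun_cong[OF this(1), of i] this(2) show False by simp
  qed
  have fin: "finite (U \<union> D)" by (simp add: U_def D_def)
  have cUD: "real (card (U \<union> D)) = ?m"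
  proof -
    have "card (U \<union> D) = d + (d - card S)"
    proof -
      have "card U = d" unfolding U_def card_image[OF iu] by simp
      moreover have "card D = d - card S" unfolding D_def card_image[OF id] using fS S by (simp add: card_Diff_subset)
      moreover have "card (U \<union> D) = card U + card D" using UD by (intro card_Un_disjoint) (auto simp: U_def D_def)
      ultimately show ?thesis by simp
    qed
    thus ?thesis using cS by simp
  qed
  have sub: "U \<union> D \<subseteq> open_orthant d S"
  proof
    fix w assume "w \<in> U \<union> D"
    then consider i where "i \<in> {1..d}" "w = ?up i" | i where "i \<in> {1..d}" "i \<notin> S" "w = ?dn i"
      by (auto simp: U_def D_def)
    thus "w \<in> open_orthant d S"
    proof cases
      case 1
      thus ?thesis using y yg by (auto simp: open_orthant_def intro: add_pos_pos)
    next
      case 2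
      thus ?thesis using y yg by (auto simp: open_orthant_def)
    qed
  qed
  have nb: "nbsum d f v = (\<Sum>w | adjacent d v w. f w)" if "v \<in> open_orthant d S" for f :: "_ \<Rightarrow> real" and v
    using sum_adjacent[of v d f] that by (simp add: open_orthant_def)
  have adj: "adjacent d y w" "adjacent d w y" if "w \<in> U \<union> D" for w
  proof -
    show "adjacent d y w" using that adjacent_iff[OF yg] by (auto simp: U_def D_def)
    thus "adjacent d w y" by (simp add: adjacent_def abs_minus_commute)
  qed
  have w1: "1 \<le> walks d S y 1 w" if w: "w \<in> U \<union> D" for w
  proof -
    have wi: "w \<in> open_orthant d S" using w sub by blast
    have wg: "w \<in> grid d" using wi by (simp add: open_orthant_def)
    have "walks d S y 0 y \<le> (\<Sum>v | adjacent d w v. walks d S y 0 v)"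
      using adj[OF w] finite_adjacent[OF wg] neighbours_in_orthant[OF S wi] walks_bounds(1)[OF _ y]
      by (intro member_le_sum) auto
    thus ?thesis using walks_Suc[of d S y 0 w] nb[OF wi] walks_0[OF yo y] by simp
  qed
  \<comment> \<open>Each point of \<open>N\<close> is reached in one step and returns to the pole in
    one more; all other contributions are nonnegative.\<close>
  have w2: "?m \<le> walks d S y 2 y"
  proof -
    have "(\<Sum>w\<in>U \<union> D. 1) \<le> (\<Sum>w\<in>U \<union> D. walks d S y 1 w)" using w1 by (rule sum_mono)
    also have "\<dots> \<le> (\<Sum>w | adjacent d y w. walks d S y 1 w)"
      using adj finite_adjacent[OF yg] neighbours_in_orthant[OF S y] walks_bounds(1)[OF _ y]
      by (intro sum_mono2) auto
    finally show ?thesis using walks_Suc[of d S y 1 y] nb[OF y] cUD by (simp add: eval_nat_numeral)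
  qed
  let ?D = "2 * real d"
  have gy: "1 / ?D + ?m / ?D ^ 3 \<le> green d S y y"
  proof -
    have "?m / valency d ^ 3 \<le> walks d S y 2 y / valency d ^ 3"
      using w2 by (intro divide_right_mono) simp_all
    moreover have "0 \<le> walks d S y 1 y / valency d ^ 2" using walks_bounds(1)[OF yo y] by simp
    ultimately have "1 / valency d + ?m / valency d ^ 3 \<le> 1 / valency d + walks d S y 1 y / valency d ^ 2 + walks d S y 2 y / valency d ^ 3"
      by linarith
    also have "\<dots> = (\<Sum>n<3. walks d S y n y / valency d ^ Suc n)"
      using walks_0[OF yo y] by (simp add: eval_nat_numeral)
    also have "\<dots> \<le> green d S y y" by (rule green_ge_sum[OF S y yo])
    finally show ?thesis by (simp add: valency_def)
  qed
  have gw: "1 / ?D ^ 2 \<le> green d S y w" if w: "w \<in> U \<union> D" for w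
  proof -
    have wo: "w \<in> orthant d S" using w sub open_orthant_subset by blast
    have "1 / valency d ^ 2 \<le> walks d S y 1 w / valency d ^ 2"
      using w1[OF w] by (intro divide_right_mono) simp_all
    also have "\<dots> \<le> walks d S y 0 w / valency d + walks d S y 1 w / valency d ^ 2"
      using walks_bounds(1)[OF wo y, of 0] by simp
    also have "\<dots> = (\<Sum>n<2. walks d S y n w / valency d ^ Suc n)" by (simp add: eval_nat_numeral)
    also have "\<dots> \<le> green d S y w" by (rule green_ge_sum[OF S y wo])
    finally show ?thesis by (simp add: valency_def)
  qed
  show thesis
    by (rule that[OF fin _ yN cUD gy gw]) (use sub open_orthant_subset[of d S] in blast)+
qed

lemma green_self_lower:
  assumes x: "x \<in> grid d"
  shows "1 / (2 * real d) + 1 / (2 * real d)\<^sup>2 \<le> green d {} x x"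
proof -
  have "x \<in> open_orthant d {}" using x by (simp add: open_orthant_empty)
  then obtain N where "1 / (2 * real d) + (2 * real d - real (card ({} :: nat set))) / (2 * real d) ^ 3 \<le> green d {} x x"
    using green_neighbourhood_lower[of "{}" x] by blast
  thus ?thesis using d_pos by (simp add: power2_eq_square power3_eq_cube)
qed

text \<open>The factor 3 is 2 + 1: twice from the cross term in the square at the pole and once from
  the squares at the neighbours.\<close>

lemma green_square_sum_lower:
  assumes S: "S \<subseteq> {1..d}" and y: "y \<in> open_orthant d S"
  shows "1 / (4 * real d ^ 2) * (1 + 3 * (2 * real d - real (card S)) / (4 * real d ^ 2))
     \<le> (\<Sum>\<^sub>\<infinity>x\<in>orthant d S. (green d S y x)\<^sup>2)"
proof -
  let ?m = "2 * real d - real (card S)" and ?D = "2 * real d"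
  from green_neighbourhood_lower[OF S y] obtain N where N: "finite N" "N \<subseteq> orthant d S" "y \<notin> N" "real (card N) = ?m"
    and gy: "1 / ?D + ?m / ?D ^ 3 \<le> green d S y y" and gw: "\<And>w. w \<in> N \<Longrightarrow> 1 / ?D ^ 2 \<le> green d S y w"
    by blast
  have m0: "0 \<le> ?m" unfolding N(4)[symmetric] by simp
  have yo: "y \<in> orthant d S" using y open_orthant_subset by blast
  have "1 / (4 * real d ^ 2) * (1 + 3 * ?m / (4 * real d ^ 2)) = (1 / ?D)\<^sup>2 + 2 * (1 / ?D) * (?m / ?D ^ 3) + ?m * (1 / ?D ^ 2)\<^sup>2"
  proof -
    have alg: "1 / (4 * a ^ 2) * (1 + 3 * m / (4 * a ^ 2)) = (1 / (2 * a))\<^sup>2 + 2 * (1 / (2 * a)) * (m / (2 * a) ^ 3) + m * (1 / (2 * a) ^ 2)\<^sup>2"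
      if "a > 0" for a m :: real
      using that by (simp add: field_simps eval_nat_numeral)
    show ?thesis using d_pos by (intro alg) simp
  qed
  also have "\<dots> \<le> (1 / ?D + ?m / ?D ^ 3)\<^sup>2 + ?m * (1 / ?D ^ 2)\<^sup>2"
    by (simp add: power2_sum)
  also have "\<dots> \<le> (green d S y y)\<^sup>2 + (\<Sum>w\<in>N. (green d S y w)\<^sup>2)"
  proof (rule add_mono)
    show "(1 / ?D + ?m / ?D ^ 3)\<^sup>2 \<le> (green d S y y)\<^sup>2"
      using gy m0 by (intro power_mono) (auto intro!: add_nonneg_nonneg divide_nonneg_nonneg)
    have "?m * (1 / ?D ^ 2)\<^sup>2 = (\<Sum>w\<in>N. (1 / ?D ^ 2)\<^sup>2)" by (simp only: sum_constant N(4))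
    also have "\<dots> \<le> (\<Sum>w\<in>N. (green d S y w)\<^sup>2)"
      using gw by (intro sum_mono power_mono) auto
    finally show "?m * (1 / ?D ^ 2)\<^sup>2 \<le> (\<Sum>w\<in>N. (green d S y w)\<^sup>2)" .
  qed
  also have "\<dots> = (\<Sum>w\<in>insert y N. (green d S y w)\<^sup>2)" using N by simp
  also have "\<dots> \<le> (\<Sum>\<^sub>\<infinity>x\<in>orthant d S. (green d S y x)\<^sup>2)"
    by (rule finite_sum_le_infsum[OF green_ell2(1)[OF S y]]) (use N yo in auto)
  finally show ?thesis .
qed

text \<open>By the number of points in the open orthant where the Laplacian is nonzero: two or more
  give \<open>q2\<close> by Cauchy-Schwarz, none forces the reduced function to vanish, and exactly
  one makes it a nonzero integer multiple of a Green's function, which gives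
  \<open>q1\<close>.\<close>

lemma open_square_sum_lower:
  assumes S: "S \<subseteq> {1..d}" and \<xi>: "\<xi> \<in> H2 d S" "\<not> zero_mod_1 d \<xi>"
    and q1: "q \<le> 1 / (4 * real d ^ 2) * (1 + 3 * (2 * real d - real (card S)) / (4 * real d ^ 2))"
    and q2: "q \<le> 2 / (2 * real d + sqrt (4 * real d))\<^sup>2"
  shows "q \<le> (\<Sum>\<^sub>\<infinity>x\<in>orthant d S. (odd_frac (\<xi> x))\<^sup>2)"
proof -
  let ?\<xi> = "\<lambda>x. odd_frac (\<xi> x)"
  have l2: "?\<xi> \<in> ell2 d" and hm: "harmonic_mod_1 d ?\<xi>" and as: "antisymmetric d S ?\<xi>"
    using \<xi> by (auto simp: H2_iff intro: odd_frac_ell2 odd_frac_harmonic odd_frac_antisymmetric)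
  have og: "orthant d S \<subseteq> grid d" by (auto simp: orthant_def)
  have so: "(\<lambda>x. (?\<xi> x)\<^sup>2) summable_on orthant d S"
    using summable_on_subset[OF _ og] l2 by (simp add: ell2_def)
  define T where "T = {x \<in> open_orthant d S. laplacian d ?\<xi> x \<noteq> 0}"
  have ints: "1 \<le> \<bar>laplacian d ?\<xi> x\<bar>" if "x \<in> T" for x
    using that hm by (intro Ints_ge_1) (auto simp: T_def harmonic_mod_1_def open_orthant_def)
  show ?thesis
  proof (cases "\<exists>x y. x \<in> T \<and> y \<in> T \<and> x \<noteq> y")
    case True
    then obtain x y where xy: "x \<in> T" "y \<in> T" "x \<noteq> y" by blast
    have "real 2 / (2 * real d + sqrt (2 * real d * real 2))\<^sup>2 \<le> (\<Sum>\<^sub>\<infinity>x\<in>orthant d S. (?\<xi> x)\<^sup>2)"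
      by (rule infsum_square_ge_support[OF S d_pos so, of "{x, y}"])
         (use xy ints in \<open>auto simp: T_def\<close>)
    thus ?thesis using q2 by simp
  next
    case F: False
    show ?thesis
    proof (cases "T = {}")
      case True
      \<comment> \<open>An arbitrary pole, so that \<open>eq_green\<close> can be applied with the
        factor 0.\<close>
      have y: "(\<lambda>i\<in>{1..d}. 1) \<in> open_orthant d S"
        using S by (auto simp: open_orthant_def grid_def)
      have "?\<xi> x = 0" if "x \<in> grid d" for x
        using eq_green[OF S y l2 as, of 0 x] True that by (auto simp: T_def)
      hence False using odd_frac_zero_mod_1 \<xi> by blast
      thus ?thesis ..
    next
      case False
      then obtain y where y: "y \<in> T" by blast
      have yi: "y \<in> open_orthant d S" using y by (simp add: T_def)
      let ?a = "laplacian d ?\<xi> y"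
      have eq: "?\<xi> x = ?a * green d S y x" if "x \<in> grid d" for x
        using F y that by (intro eq_green[OF S yi l2 as]) (auto simp: T_def)
      have "q \<le> (\<Sum>\<^sub>\<infinity>x\<in>orthant d S. (green d S y x)\<^sup>2)" (is "_ \<le> ?K")
        using green_square_sum_lower[OF S yi] q1 by linarith
      also have "1\<^sup>2 \<le> \<bar>?a\<bar>\<^sup>2" using ints[OF y] by (intro power_mono) auto
      hence "1 * ?K \<le> ?a\<^sup>2 * ?K" by (intro mult_right_mono infsum_nonneg) auto
      hence "?K \<le> ?a\<^sup>2 * ?K" by simp
      also have "\<dots> = (\<Sum>\<^sub>\<infinity>x\<in>orthant d S. ?a\<^sup>2 * (green d S y x)\<^sup>2)" by (rule infsum_cmult_right'[symmetric])
      also have "\<dots> = (\<Sum>\<^sub>\<infinity>x\<in>orthant d S. (?\<xi> x)\<^sup>2)"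
        by (rule infsum_cong) (use eq og in \<open>auto simp: power_mult_distrib\<close>)
      finally show ?thesis .
    qed
  qed
qed

text \<open>Total 0 rules out a single support point of the Laplacian. Three or more give
  \<open>q2\<close>; exactly two carry opposite values, so the reduced function is a multiple of a
  difference of Green's functions, and adjacent poles are the cheapest.\<close>

lemma periodic_square_sum_lower:
  assumes \<xi>: "\<xi> \<in> ell2 d" "laplacian d \<xi> \<in> C1 d" "\<not> zero_mod_1 d \<xi>"
    and q1: "q \<le> 1 / (2 * real d ^ 2) * (1 + 1 / (2 * real d))"
    and q2: "q \<le> 3 / (2 * real d + sqrt (6 * real d))\<^sup>2"
  shows "q \<le> (\<Sum>\<^sub>\<infinity>x\<in>grid d. (odd_frac (\<xi> x))\<^sup>2)"
proof -
  let ?\<xi> = "\<lambda>x. odd_frac (\<xi> x)"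
  have hm0: "harmonic_mod_1 d \<xi>" using \<xi>(2) by (simp add: C1_def harmonic_mod_1_def)
  have l2: "?\<xi> \<in> ell2 d" and hm: "harmonic_mod_1 d ?\<xi>"
    using \<xi> hm0 by (auto intro: odd_frac_ell2 odd_frac_harmonic)
  have sg: "(\<lambda>x. (?\<xi> x)\<^sup>2) summable_on grid d" using l2 by (simp add: ell2_def)
  have hs: "(laplacian d ?\<xi> has_sum 0) (grid d)" by (rule odd_frac_laplacian_has_sum[OF \<xi>(1,2)])
  define T where "T = {x \<in> grid d. laplacian d ?\<xi> x \<noteq> 0}"
  have ints: "1 \<le> \<bar>laplacian d ?\<xi> x\<bar>" if "x \<in> T" for x
    using that hm by (intro Ints_ge_1) (auto simp: T_def harmonic_mod_1_def)
  have "T \<noteq> {}"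
  proof
    assume T: "T = {}"
    have "?\<xi> x = 0" if "x \<in> grid d" for x
      by (rule ell2_harmonic_zero[OF l2 _ d_pos that]) (use T in \<open>auto simp: T_def\<close>)
    thus False using odd_frac_zero_mod_1 \<xi> by blast
  qed
  then obtain x where x: "x \<in> T" by blast
  have "\<exists>y\<in>T. y \<noteq> x"
  proof (rule ccontr)
    assume n: "\<not> ?thesis"
    have "(laplacian d ?\<xi> has_sum laplacian d ?\<xi> x) (grid d)"
      by (rule has_sum_finite_neutralI[of "{x}"]) (use n x in \<open>auto simp: T_def\<close>)
    hence "laplacian d ?\<xi> x = 0" using hs has_sum_unique by blast
    thus False using x by (simp add: T_def)
  qed
  then obtain y where y: "y \<in> T" "y \<noteq> x" by blast
  have xg: "x \<in> grid d" and yg: "y \<in> grid d" using x y by (auto simp: T_def)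
  show ?thesis
  proof (cases "\<exists>z\<in>T. z \<noteq> x \<and> z \<noteq> y")
    case True
    then obtain z where z: "z \<in> T" "z \<noteq> x" "z \<noteq> y" by blast
    have "real 3 / (2 * real d + sqrt (2 * real d * real 3))\<^sup>2 \<le> (\<Sum>\<^sub>\<infinity>x\<in>orthant d {}. (?\<xi> x)\<^sup>2)"
      by (rule infsum_square_ge_support[of "{}" d ?\<xi> "{x, y, z}"])
         (use x y z ints sg d_pos in \<open>auto simp: T_def open_orthant_empty orthant_empty\<close>)
    thus ?thesis using q2 by (simp add: orthant_empty)
  next
    case False
    let ?a = "laplacian d ?\<xi> x"
    have "(laplacian d ?\<xi> has_sum (?a + laplacian d ?\<xi> y)) (grid d)"
      by (rule has_sum_finite_neutralI[of "{x, y}"]) (use False x y in \<open>auto simp: T_def\<close>)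
    hence "?a + laplacian d ?\<xi> y = 0" using hs has_sum_unique by blast
    hence ly: "laplacian d ?\<xi> y = - ?a" by simp
    let ?g = "\<lambda>u. green d {} x u - green d {} y u"
    let ?\<eta> = "\<lambda>u. ?\<xi> u - ?a * ?g u"
    have xi: "x \<in> open_orthant d {}" "y \<in> open_orthant d {}" using xg yg by (auto simp: open_orthant_empty)
    have ge: "green d {} z \<in> ell2 d" if "z \<in> grid d" for z
      using green_ell2(3)[of "{}" z] that by (simp add: open_orthant_empty)
    have l2e: "?\<eta> \<in> ell2 d" by (intro ell2_diff l2 ell2_mult ge xg yg)
    have w0: "walks d {} z 0 u = (if u = z then 1 else 0)" if "u \<in> grid d" "z \<in> grid d" for u z
      using walks_0[of u d "{}" z] that by (simp add: orthant_empty open_orthant_empty)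
    have "laplacian d ?\<eta> u = 0" if u: "u \<in> grid d" for u
    proof -
      have "laplacian d ?\<eta> u = laplacian d ?\<xi> u - ?a * (laplacian d (green d {} x) u - laplacian d (green d {} y) u)"
        using u by (simp only: laplacian_diff laplacian_mult)
      also have "\<dots> = laplacian d ?\<xi> u - ?a * ((if u = x then 1 else 0) - (if u = y then 1 else 0))"
        using u xg yg by (simp only: laplacian_green[OF _ xi(1)] laplacian_green[OF _ xi(2)] empty_subsetI w0)
      also have "\<dots> = 0" using ly y(2) False u by (auto simp: T_def)
      finally show ?thesis .
    qed
    from ell2_harmonic_zero[OF l2e this d_pos] have eq: "?\<xi> u = ?a * ?g u" if "u \<in> grid d" for u
      using that by simp
    have gs: "((\<lambda>u. (?g u)\<^sup>2) has_sum 2 * (green_pair d x x - green_pair d x y)) (grid d)"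
      by (rule green_diff_has_sum[OF xg yg])
    let ?K = "2 * (green_pair d x x - green_pair d x y)"
    have "q \<le> 1 / (2 * real d ^ 2) * (1 + 1 / (2 * real d))" by (rule q1)
    also have "\<dots> = 2 * ((1 / (2 * real d) + 1 / (2 * real d)\<^sup>2) / (2 * real d))"
      using d_pos by (simp add: divide_simps) (simp add: power2_eq_square algebra_simps)
    also have "\<dots> \<le> 2 * (green d {} x x / (2 * real d))"
      by (intro mult_left_mono divide_right_mono green_self_lower xg) auto
    also have "\<dots> = 2 * (green_pair d x x - green_pair d x (x(1 := x 1 + 1)))"
      using green_pair_neighbour_diff[OF xg, of 1] d_pos by (simp add: valency_def)
    also have "\<dots> \<le> ?K"
      using green_pair_le_neighbour[OF xg yg _ , of 1] y d_pos by simp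
    finally have qK: "q \<le> ?K" .
    have "0 \<le> ?K" by (rule has_sum_nonneg[OF gs]) simp
    moreover have "1\<^sup>2 \<le> \<bar>?a\<bar>\<^sup>2" using ints[OF x] by (intro power_mono) auto
    ultimately have "1 * ?K \<le> ?a\<^sup>2 * ?K" by (intro mult_right_mono) auto
    also have "\<dots> = (\<Sum>\<^sub>\<infinity>u\<in>grid d. ?a\<^sup>2 * (?g u)\<^sup>2)"
      using infsumI[OF has_sum_cmult_right[OF gs, of "?a\<^sup>2"]] by simp
    also have "\<dots> = (\<Sum>\<^sub>\<infinity>u\<in>grid d. (?\<xi> u)\<^sup>2)"
      by (rule infsum_cong) (use eq in \<open>auto simp: power_mult_distrib\<close>)
    finally show ?thesis using qK by simp
  qed
qed

end

subsection \<open>Asymptotics\<close>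

lemma pi_square_less: "pi\<^sup>2 < 16"
  using power_strict_mono[of pi 4 2] pi_less_4 by simp

context transient begin

text \<open>Here L = 32 / d^2, from pi^2 < 16 and q <= 1 / d^2; the loss 2 L is 64 / d^2, and d >= 8
  ensures L <= 1/2.\<close>

lemma one_minus_cos_odd_frac_lower:
  assumes R: "R \<subseteq> grid d" and l2: "\<xi> \<in> ell2 d" and d8: "d \<ge> 8"
    and q: "q \<le> (\<Sum>\<^sub>\<infinity>x\<in>R. (odd_frac (\<xi> x))\<^sup>2)" "0 \<le> q" "q \<le> 1 / real d ^ 2"
  shows "2 * pi\<^sup>2 * (1 - 64 / real d ^ 2) * q \<le> (\<Sum>\<^sub>\<infinity>x\<in>R. 1 - cos (2 * pi * \<xi> x))"
proof -
  have s: "(\<lambda>x. (odd_frac (\<xi> x))\<^sup>2) summable_on R"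
    using summable_on_subset[OF _ R] odd_frac_ell2[OF l2] by (simp add: ell2_def)
  have "8\<^sup>2 \<le> real d ^ 2" using d8 by (intro power_mono) auto
  hence "32 / real d ^ 2 \<le> 32 / 8\<^sup>2" using d8 by (intro divide_left_mono) auto
  hence L: "32 / real d ^ 2 \<le> 1 / 2" by simp
  have "2 * pi\<^sup>2 * q \<le> 2 * 16 * (1 / real d ^ 2)"
    using pi_square_less q by (intro mult_mono) auto
  hence "2 * pi\<^sup>2 * q \<le> 32 / real d ^ 2" by simp
  from one_minus_cos_infsum_lower[OF s odd_frac_le_half q(1,2) L this]
  show ?thesis by (simp add: cos_odd_frac)
qed

lemma open_lower:
  assumes S: "S \<subseteq> {1..d}" "card S = j" and \<xi>: "\<xi> \<in> H2 d S" "\<not> zero_mod_1 d \<xi>" and d8: "d \<ge> 8"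
    and q: "q = 1 / (4 * real d ^ 2) * (1 + 3 * (2 * real d - real j) / (4 * real d ^ 2))"
    "q \<le> 2 / (2 * real d + sqrt (4 * real d))\<^sup>2" "0 \<le> q" "q \<le> 1 / real d ^ 2"
  shows "2 * pi\<^sup>2 * (1 - 64 / real d ^ 2) * q \<le> orbit_sum d S \<xi>"
  unfolding orbit_sum_orthant[OF S(1) \<xi>(1)]
proof (rule one_minus_cos_odd_frac_lower[OF _ _ d8 _ q(3,4)])
  show "orthant d S \<subseteq> grid d" by (auto simp: orthant_def)
  show "\<xi> \<in> ell2 d" using \<xi> by (simp add: H2_def)
  show "q \<le> (\<Sum>\<^sub>\<infinity>x\<in>orthant d S. (odd_frac (\<xi> x))\<^sup>2)"
    using open_square_sum_lower[OF S(1) \<xi>] q S by simp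
qed

lemma periodic_lower:
  assumes \<xi>: "\<xi> \<in> ell2 d" "laplacian d \<xi> \<in> C1 d" "\<not> zero_mod_1 d \<xi>" and d8: "d \<ge> 8"
    and q: "q = 1 / (2 * real d ^ 2) * (1 + 1 / (2 * real d))"
    "q \<le> 3 / (2 * real d + sqrt (6 * real d))\<^sup>2" "0 \<le> q" "q \<le> 1 / real d ^ 2"
  shows "2 * pi\<^sup>2 * (1 - 64 / real d ^ 2) * q \<le> (\<Sum>\<^sub>\<infinity>x\<in>grid d. 1 - cos (2 * pi * \<xi> x))"
  using periodic_square_sum_lower[OF \<xi>] q
  by (intro one_minus_cos_odd_frac_lower[OF _ \<xi>(1) d8 _ q(3,4)]) auto

section \<open>Competitors for the upper bounds, and the passage to the infima\<close>

lemma not_zero_mod_1I: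
  assumes R: "R \<subseteq> grid d" and s: "((\<lambda>x. (\<xi> x)\<^sup>2) has_sum a) R" and a: "0 < a" "a < 1"
  shows "\<not> zero_mod_1 d \<xi>"
proof
  assume z: "zero_mod_1 d \<xi>"
  have "\<xi> x = 0" if x: "x \<in> R" for x
  proof (rule ccontr)
    assume "\<xi> x \<noteq> 0"
    hence "1\<^sup>2 \<le> \<bar>\<xi> x\<bar>\<^sup>2" using Ints_ge_1[of "\<xi> x"] z x R
      by (intro power_mono) (auto simp: zero_mod_1_def)
    also have "\<bar>\<xi> x\<bar>\<^sup>2 \<le> a"
      using has_sum_mono_neutral[OF has_sum_finite[of "{x}" "\<lambda>x. (\<xi> x)\<^sup>2"] s] x by simp
    finally show False using a by simp
  qed
  hence "((\<lambda>x. (\<xi> x)\<^sup>2) has_sum 0) R" by (subst has_sum_cong[where g = "\<lambda>_. 0"]) auto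
  hence "a = 0" using s has_sum_unique by blast
  thus False using a by simp
qed

lemma open_upper:
  assumes S: "S \<subseteq> {1..d}" and K: "\<And>y. y \<in> grid d \<Longrightarrow> green_pair d y y \<le> K" "K < 1"
  shows "\<exists>\<xi>\<in>H2 d S. \<not> zero_mod_1 d \<xi> \<and> orbit_sum d S \<xi> \<le> 2 * pi\<^sup>2 * K"
proof -
  \<comment> \<open>The all-ones point lies in the open orthant of every \<open>S\<close>.\<close>
  define y :: "nat \<Rightarrow> int" where "y = (\<lambda>i\<in>{1..d}. 1)"
  have y: "y \<in> open_orthant d S" using S by (auto simp: open_orthant_def grid_def y_def)
  have yg: "y \<in> grid d" using y by (simp add: open_orthant_def)
  have og: "orthant d S \<subseteq> grid d" by (auto simp: orthant_def)
  have hm: "harmonic_mod_1 d (green d S y)"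
    unfolding harmonic_mod_1_def
  proof
    fix x assume x: "x \<in> grid d"
    \<comment> \<open>The Laplacian is known to be 0 or 1 on the orthant; elsewhere it agrees with
      such a value up to sign.\<close>
    have "\<bar>walks d S y 0 (fold_abs S x)\<bar> = \<bar>walks d S y 0 x\<bar>"
      by (rule reflection_invariant_fold_abs[OF S x, of "\<lambda>x. \<bar>walks d S y 0 x\<bar>"])
         (use walks_antisymmetric[OF S, of y 0] in \<open>simp add: reflection_eq antisymmetric_def del: fun_upd_apply\<close>)
    moreover have "walks d S y 0 (fold_abs S x) \<in> \<int>"
      using walks_0[OF fold_abs_orthant[OF S x] y] by simp
    ultimately have "walks d S y 0 x \<in> \<int>"
      by (metis Ints_abs abs_if minus_in_Ints_iff)
    thus "laplacian d (green d S y) x \<in> \<int>" using laplacian_green[OF S y x] by simp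
  qed
  have H: "green d S y \<in> H2 d S"
    unfolding H2_iff using hm green_ell2(3)[OF S y] green_antisymmetric[OF S y] by simp
  let ?s = "\<Sum>\<^sub>\<infinity>x\<in>orthant d S. (green d S y x)\<^sup>2"
  have sK: "?s \<le> K" using green_ell2(2)[OF S y] K(1)[OF yg] by linarith
  have hs: "((\<lambda>x. (green d S y x)\<^sup>2) has_sum ?s) (orthant d S)"
    by (rule has_sum_infsum[OF green_ell2(1)[OF S y]])
  have "0 < 1 / (4 * real d ^ 2) * (1 + 3 * (2 * real d - real (card S)) / (4 * real d ^ 2))"
    using d_pos card_mono[OF _ S] by (intro mult_pos_pos add_pos_nonneg divide_nonneg_nonneg) auto
  hence "0 < ?s" using green_square_sum_lower[OF S y] by linarith
  hence nz: "\<not> zero_mod_1 d (green d S y)"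
    using sK K(2) by (intro not_zero_mod_1I[OF og hs]) auto
  have "orbit_sum d S (green d S y) \<le> 2 * pi\<^sup>2 * ?s"
    unfolding orbit_sum_orthant[OF S H] by (rule one_minus_cos_infsum_upper[OF green_ell2(1)[OF S y]])
  also have "\<dots> \<le> 2 * pi\<^sup>2 * K" using sK by (intro mult_left_mono) auto
  finally show ?thesis using H nz by blast
qed

text \<open>The walk of one step enters with weight 2. This interaction is what lowers 3/(2d) to
  1/(2d) in the periodic upper bound.\<close>

lemma green_pair_neighbour_lower:
  assumes x: "x \<in> grid d" and k: "k \<in> {1..d}"
  shows "2 / (2 * real d) ^ 3 \<le> green_pair d x (x(k := x k + 1))"
proof -
  let ?e = "x(k := x k + 1)"
  have eg: "?e \<in> grid d" using x k by simp
  have a: "adjacent d ?e x" using adjacent_iff[OF x, of ?e] k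
    by (auto simp: adjacent_def abs_minus_commute)
  have w0: "walks d {} x 0 u = (if u = x then 1 else 0)" if "u \<in> grid d" for u
    using walks_0[of u d "{}" x] that x by (simp add: orthant_empty open_orthant_empty)
  have "walks d {} x 0 x \<le> (\<Sum>w | adjacent d ?e w. walks d {} x 0 w)"
    using a finite_adjacent[OF eg] walks_nonneg[OF x] by (intro member_le_sum) (auto simp: adjacent_def)
  hence w1: "1 \<le> walks d {} x 1 ?e"
    using walks_Suc[of d "{}" x 0 ?e] sum_adjacent[OF eg, of "walks d {} x 0"] w0[OF x] by simp
  have "2 / valency d ^ 3 \<le> 2 * walks d {} x 1 ?e / valency d ^ 3" using w1 by (intro divide_right_mono) simp_all
  also have "\<dots> \<le> walks d {} x 0 ?e / valency d ^ 2 + 2 * walks d {} x 1 ?e / valency d ^ 3"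
    using walks_nonneg[OF x eg, of 0] by simp
  also have "\<dots> = (\<Sum>n<2. real (Suc n) * walks d {} x n ?e / valency d ^ (n + 2))"
    by (simp add: eval_nat_numeral)
  also have "\<dots> \<le> green_pair d x ?e"
    unfolding green_pair_def
    by (intro sum_le_suminf green_pair_summable(1)[OF x eg])
       (auto intro!: divide_nonneg_nonneg mult_nonneg_nonneg walks_nonneg x eg simp del: power_Suc)
  finally show ?thesis by (simp add: valency_def)
qed

text \<open>The poles are the origin and a neighbour. K < 1/2 keeps the square sum below 1, and a
  nonzero integer value would already contribute 1.\<close>

lemma periodic_upper:
  assumes K: "\<And>y. y \<in> grid d \<Longrightarrow> green_pair d y y \<le> K" "K < 1 / 2"
  shows "\<exists>\<xi>\<in>ell2 d. laplacian d \<xi> \<in> C1 d \<and> \<not> zero_mod_1 d \<xi> \<and>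
    (\<Sum>\<^sub>\<infinity>x\<in>grid d. 1 - cos (2 * pi * \<xi> x)) \<le> 2 * pi\<^sup>2 * (2 * (K - 2 / (2 * real d) ^ 3))"
proof -
  define x :: "nat \<Rightarrow> int" where "x = (\<lambda>i\<in>{1..d}. 0)"
  define e where "e = x(1 := x 1 + 1)"
  have k: "(1::nat) \<in> {1..d}" using d_pos by simp
  have xg: "x \<in> grid d" by (simp add: x_def grid_def)
  have eg: "e \<in> grid d" unfolding e_def using xg k by (rule grid_upd)
  have ne: "x \<noteq> e" by (metis e_def fun_upd_same add_cancel_right_right zero_neq_one)
  let ?g = "\<lambda>u. green d {} x u - green d {} e u"
  have xi: "x \<in> open_orthant d {}" "e \<in> open_orthant d {}" using xg eg by (auto simp: open_orthant_empty)
  have l2: "?g \<in> ell2 d" by (intro ell2_diff green_ell2(3) xi) auto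
  have w0: "walks d {} z 0 u = (if u = z then 1 else 0)" if "u \<in> grid d" "z \<in> grid d" for u z
    using walks_0[of u d "{}" z] that by (simp add: orthant_empty open_orthant_empty)
  have lap: "laplacian d ?g u = (if u = x then 1 else 0) - (if u = e then 1 else 0)" if u: "u \<in> grid d" for u
    using u xg eg by (simp only: laplacian_diff laplacian_green[OF _ xi(1)] laplacian_green[OF _ xi(2)] empty_subsetI w0)
  have supp: "{u \<in> grid d. laplacian d ?g u \<noteq> 0} = {x, e}" using lap xg eg ne by auto
  have C1: "laplacian d ?g \<in> C1 d"
    unfolding C1_def mem_Collect_eq supp using lap xg eg ne by auto
  let ?s = "2 * (green_pair d x x - green_pair d x e)"
  have hs: "((\<lambda>u. (?g u)\<^sup>2) has_sum ?s) (grid d)" by (rule green_diff_has_sum[OF xg eg])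
  have K1: "2 / (2 * real d) ^ 3 \<le> green_pair d x e"
    unfolding e_def by (rule green_pair_neighbour_lower[OF xg k])
  have sK: "?s \<le> 2 * (K - 2 / (2 * real d) ^ 3)"
    by (intro mult_left_mono diff_mono K(1)[OF xg] K1) simp
  have "0 \<le> 2 / (2 * real d) ^ 3" by simp
  hence "0 \<le> green_pair d x e" using K1 by (rule order_trans)
  hence s1: "?s < 1"
  proof -
    have "2 * (a - b) < 1" if "0 \<le> b" "a \<le> K" for a b :: real using that K(2) by simp
    thus ?thesis using \<open>0 \<le> green_pair d x e\<close> K(1)[OF xg] by blast
  qed
  have "0 < 1 / (2 * real d) + 1 / (2 * real d)\<^sup>2" using d_pos by (intro add_pos_pos) auto
  hence "0 < green d {} x x" using green_self_lower[OF xg] by linarith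
  hence "0 < green d {} x x / valency d" using valency_pos by simp
  hence s0: "0 < ?s" using green_pair_neighbour_diff[OF xg k] by (simp add: e_def del: fun_upd_apply)
  have nz: "\<not> zero_mod_1 d ?g" by (rule not_zero_mod_1I[OF subset_refl hs s0 s1])
  have "(\<Sum>\<^sub>\<infinity>x\<in>grid d. 1 - cos (2 * pi * ?g x)) \<le> 2 * pi\<^sup>2 * ?s"
    using one_minus_cos_infsum_upper[OF has_sum_imp_summable[OF hs]] infsumI[OF hs] by simp
  also have "\<dots> \<le> 2 * pi\<^sup>2 * (2 * (K - 2 / (2 * real d) ^ 3))" using sK by (intro mult_left_mono) auto
  finally show ?thesis using l2 C1 nz by blast
qed

text \<open>A real infimum is meaningful only over a nonempty set bounded below; the competitor and
  \<open>c\<close> provide both, for the inner and for the outer infimum.\<close>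

lemma gamma_open_bounds:
  assumes j: "j \<le> d" and K: "\<And>y. y \<in> grid d \<Longrightarrow> green_pair d y y \<le> K" "K < 1"
    and lo: "\<And>S \<xi>. S \<subseteq> {1..d} \<Longrightarrow> card S = j \<Longrightarrow> \<xi> \<in> H2 d S \<Longrightarrow> \<not> zero_mod_1 d \<xi> \<Longrightarrow> c \<le> orbit_sum d S \<xi>"
  shows "c \<le> gamma_open d j" and "gamma_open d j \<le> 2 * pi\<^sup>2 * K"
proof -
  let ?A = "{S. S \<subseteq> {1..d} \<and> card S = j}"
  let ?B = "\<lambda>S. {\<xi> \<in> H2 d S. \<not> zero_mod_1 d \<xi>}"
  let ?I = "\<lambda>S. INF \<xi>\<in>?B S. orbit_sum d S \<xi>"
  have A: "{1..j} \<in> ?A" using j by auto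
  have B: "c \<le> ?I S" "?I S \<le> 2 * pi\<^sup>2 * K" if S: "S \<in> ?A" for S
  proof -
    obtain \<xi> where \<xi>: "\<xi> \<in> ?B S" "orbit_sum d S \<xi> \<le> 2 * pi\<^sup>2 * K"
      using open_upper[OF _ K, of S] S by blast
    have l: "c \<le> orbit_sum d S \<zeta>" if "\<zeta> \<in> ?B S" for \<zeta> using lo[of S \<zeta>] S that by blast
    show "c \<le> ?I S" by (rule cINF_greatest) (use \<xi> l in blast)+
    show "?I S \<le> 2 * pi\<^sup>2 * K"
      by (rule cINF_lower2[where f = "orbit_sum d S", OF _ \<xi>]) (use l in \<open>auto intro!: bdd_belowI[where m = c]\<close>)
  qed
  show "c \<le> gamma_open d j" unfolding gamma_open_def
    by (rule cINF_greatest) (use A B(1) in blast)+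
  show "gamma_open d j \<le> 2 * pi\<^sup>2 * K" unfolding gamma_open_def
    by (rule cINF_lower2[where f = ?I, OF _ A B(2)[OF A]]) (use B(1) in \<open>auto intro!: bdd_belowI[where m = c]\<close>)
qed

lemma gamma_periodic_bounds:
  assumes K: "\<And>y. y \<in> grid d \<Longrightarrow> green_pair d y y \<le> K" "K < 1 / 2"
    and lo: "\<And>\<xi>. \<xi> \<in> ell2 d \<Longrightarrow> laplacian d \<xi> \<in> C1 d \<Longrightarrow> \<not> zero_mod_1 d \<xi> \<Longrightarrow>
      c \<le> (\<Sum>\<^sub>\<infinity>x\<in>grid d. 1 - cos (2 * pi * \<xi> x))"
  shows "c \<le> gamma_periodic d" and "gamma_periodic d \<le> 2 * pi\<^sup>2 * (2 * (K - 2 / (2 * real d) ^ 3))"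
proof -
  let ?B = "{\<xi> \<in> ell2 d. laplacian d \<xi> \<in> C1 d \<and> \<not> zero_mod_1 d \<xi>}"
  let ?f = "\<lambda>\<xi>. \<Sum>\<^sub>\<infinity>x\<in>grid d. 1 - cos (2 * pi * \<xi> x)"
  obtain \<xi> where \<xi>: "\<xi> \<in> ?B" "?f \<xi> \<le> 2 * pi\<^sup>2 * (2 * (K - 2 / (2 * real d) ^ 3))"
    using periodic_upper[OF K] by blast
  have l: "c \<le> ?f \<zeta>" if "\<zeta> \<in> ?B" for \<zeta> using lo[of \<zeta>] that by blast
  show "c \<le> gamma_periodic d" unfolding gamma_periodic_def
    by (rule cINF_greatest) (use \<xi> l in blast)+
  show "gamma_periodic d \<le> 2 * pi\<^sup>2 * (2 * (K - 2 / (2 * real d) ^ 3))" unfolding gamma_periodic_def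
    by (rule cINF_lower2[where f = ?f, OF _ \<xi>]) (use l in \<open>auto intro!: bdd_belowI[where m = c]\<close>)
qed

end

section \<open>Explicit bounds for all large dimensions\<close>

lemma eventually_transient:
  "\<forall>\<^sub>F d in sequentially. transient d \<and>
     (\<forall>y\<in>grid d. green_pair d y y \<le> 1 / (4 * real d ^ 2) * (1 + 3 / (2 * real d) + 241 / real d ^ 2))"
  using eventually_green_integral_0_bound eventually_ge_at_top[of 1]
proof eventually_elim
  case (elim d)
  let ?M = "1 + 3 / (2 * real d) + 241 / real d ^ 2"
  have "ennreal ?M < \<infinity>" by simp
  with elim(1) have "green_integral d (\<lambda>_. 0) < \<infinity>" by (rule le_less_trans)
  then interpret transient d using elim(2) by unfold_locales
  have "green_pair d y y \<le> 1 / (4 * real d ^ 2) * ?M" if y: "y \<in> grid d" for y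
  proof -
    have "ennreal ((valency d)\<^sup>2 * green_pair d y y) \<le> ennreal ?M"
      using green_pair_summable(2)[OF y y] elim(1) by simp
    moreover have "0 \<le> ?M" by simp
    ultimately have "(valency d)\<^sup>2 * green_pair d y y \<le> ?M" using ennreal_le_iff by blast
    thus ?thesis using elim(2) by (simp add: valency_def power_mult_distrib field_simps)
  qed
  thus ?case using transient_axioms by blast
qed

text \<open>The side conditions are checked at j = 0, where the one-point bound is largest, which
  makes the threshold for d independent of j. They hold because two support points cost about 1 / (2
  d^2), twice the price of one.\<close>

lemma eventually_gamma_open_bounds:
  "\<forall>\<^sub>F d in sequentially. \<forall>j<d.
     pi\<^sup>2 / (2 * real d ^ 2) * ((1 - 64 / real d ^ 2) * (1 + 3 * (2 * real d - real j) / (4 * real d ^ 2))) \<le> gamma_open d j \<and>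
     gamma_open d j \<le> pi\<^sup>2 / (2 * real d ^ 2) * (1 + 3 / (2 * real d) + 241 / real d ^ 2)"
proof -
  have e1: "\<forall>\<^sub>F d in sequentially. 1 / (4 * real d ^ 2) * (1 + 3 / (2 * real d) + 241 / real d ^ 2) < 1" by real_asymp
  have e2: "\<forall>\<^sub>F d in sequentially. 1 / (4 * real d ^ 2) * (1 + 3 * (2 * real d) / (4 * real d ^ 2)) \<le> 2 / (2 * real d + sqrt (4 * real d))\<^sup>2"
    by real_asymp
  have e3: "\<forall>\<^sub>F d in sequentially. 1 / (4 * real d ^ 2) * (1 + 3 * (2 * real d) / (4 * real d ^ 2)) \<le> 1 / real d ^ 2"
    by real_asymp
  from eventually_transient e1 e2 e3 eventually_ge_at_top[of 8] show ?thesis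
  proof eventually_elim
    case (elim d)
    interpret transient d using elim(1) by blast
    show ?case
    proof (intro allI impI)
      fix j assume j: "j < d"
      define q where "q = 1 / (4 * real d ^ 2) * (1 + 3 * (2 * real d - real j) / (4 * real d ^ 2))"
      have q0: "0 \<le> q" unfolding q_def using j by (intro mult_nonneg_nonneg add_nonneg_nonneg divide_nonneg_nonneg) auto
      have "q \<le> 1 / (4 * real d ^ 2) * (1 + 3 * (2 * real d) / (4 * real d ^ 2))"
        unfolding q_def by (intro mult_left_mono add_left_mono divide_right_mono) auto
      hence q: "q \<le> 2 / (2 * real d + sqrt (4 * real d))\<^sup>2" "q \<le> 1 / real d ^ 2"
        using elim(3,4) by linarith+
      have K: "green_pair d y y \<le> 1 / (4 * real d ^ 2) * (1 + 3 / (2 * real d) + 241 / real d ^ 2)"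
        if "y \<in> grid d" for y using elim(1) that by blast
      have lo: "2 * pi\<^sup>2 * (1 - 64 / real d ^ 2) * q \<le> orbit_sum d S \<xi>"
        if "S \<subseteq> {1..d}" "card S = j" "\<xi> \<in> H2 d S" "\<not> zero_mod_1 d \<xi>" for S \<xi>
        by (rule open_lower[OF that elim(5) q_def q(1) q0 q(2)])
      note b = gamma_open_bounds[OF less_imp_le[OF j] K elim(2) lo]
      have lower: "2 * pi\<^sup>2 * (1 - 64 / real d ^ 2) * q
        = pi\<^sup>2 / (2 * real d ^ 2) * ((1 - 64 / real d ^ 2) * (1 + 3 * (2 * real d - real j) / (4 * real d ^ 2)))"
        by (simp add: q_def)
      have upper: "2 * p * (1 / (4 * a) * M) = p / (2 * a) * M" for a p M :: real by simp
      from b show "pi\<^sup>2 / (2 * real d ^ 2) * ((1 - 64 / real d ^ 2) * (1 + 3 * (2 * real d - real j) / (4 * real d ^ 2))) \<le> gamma_open d j \<and>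
     gamma_open d j \<le> pi\<^sup>2 / (2 * real d ^ 2) * (1 + 3 / (2 * real d) + 241 / real d ^ 2)"
        unfolding lower upper by blast
    qed
  qed
qed

text \<open>The minimal configuration has two support points and costs about 1 / (2 d^2), while
  three cost at least about 3 / (4 d^2).\<close>

lemma eventually_gamma_periodic_bounds:
  "\<forall>\<^sub>F d in sequentially.
     pi\<^sup>2 / real d ^ 2 * ((1 - 64 / real d ^ 2) * (1 + 1 / (2 * real d))) \<le> gamma_periodic d \<and>
     gamma_periodic d \<le> pi\<^sup>2 / real d ^ 2 * (1 + 1 / (2 * real d) + 241 / real d ^ 2)"
proof -
  have e1: "\<forall>\<^sub>F d in sequentially. 1 / (4 * real d ^ 2) * (1 + 3 / (2 * real d) + 241 / real d ^ 2) < 1 / 2" by real_asymp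
  have e2: "\<forall>\<^sub>F d in sequentially. 1 / (2 * real d ^ 2) * (1 + 1 / (2 * real d)) \<le> 3 / (2 * real d + sqrt (6 * real d))\<^sup>2"
    by real_asymp
  have e3: "\<forall>\<^sub>F d in sequentially. 1 / (2 * real d ^ 2) * (1 + 1 / (2 * real d)) \<le> 1 / real d ^ 2"
    by real_asymp
  from eventually_transient e1 e2 e3 eventually_ge_at_top[of 8] show ?thesis
  proof eventually_elim
    case (elim d)
    interpret transient d using elim(1) by blast
    define q where "q = 1 / (2 * real d ^ 2) * (1 + 1 / (2 * real d))"
    have q0: "0 \<le> q" unfolding q_def by simp
    note q = elim(3,4)[folded q_def]
    have K: "green_pair d y y \<le> 1 / (4 * real d ^ 2) * (1 + 3 / (2 * real d) + 241 / real d ^ 2)"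
      if "y \<in> grid d" for y using elim(1) that by blast
    have lo: "2 * pi\<^sup>2 * (1 - 64 / real d ^ 2) * q \<le> (\<Sum>\<^sub>\<infinity>x\<in>grid d. 1 - cos (2 * pi * \<xi> x))"
      if "\<xi> \<in> ell2 d" "laplacian d \<xi> \<in> C1 d" "\<not> zero_mod_1 d \<xi>" for \<xi>
      by (rule periodic_lower[OF that elim(5) q_def q(1) q0 q(2)])
    note b = gamma_periodic_bounds[OF K elim(2) lo]
    have A: "2 * pi\<^sup>2 * (1 - 64 / real d ^ 2) * q = pi\<^sup>2 / real d ^ 2 * ((1 - 64 / real d ^ 2) * (1 + 1 / (2 * real d)))"
      by (simp add: q_def)
    \<comment> \<open>The subtracted interaction is 1 / (4 a^2) times 1 / a, and 3 / (2a) - 1 / a =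
      1 / (2a).\<close>
    have alg: "2 * p * (2 * (1 / (4 * a ^ 2) * (1 + 3 / (2 * a) + 241 / a ^ 2) - 2 / (2 * a) ^ 3))
      = p / a ^ 2 * (1 + 1 / (2 * a) + 241 / a ^ 2)" if "a > 0" for a p :: real
      using that by (simp add: field_simps eval_nat_numeral)
    have d: "0 < real d" using elim(5) by simp
    from b show ?case unfolding A alg[OF d] by blast
  qed
qed

theorem theorem3:
  shows
  "(\<exists>E \<in> O[sequentially](\<lambda>d. 1 / real d ^ 2). \<forall>\<^sub>F d in sequentially.
      gamma_periodic d = pi\<^sup>2 / real d ^ 2 * (1 + 1 / (2 * real d) + E d)) \<and>
   (\<forall>j. \<exists>E \<in> O[sequentially](\<lambda>d. 1 / real d ^ 2). \<forall>\<^sub>F d in sequentially.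
      gamma_open d j = pi\<^sup>2 / (2 * real d ^ 2) * (1 + 3 / (2 * real d) + E d)) \<and>
   (\<forall>\<^sub>F d in sequentially. \<forall>j<d.
      gamma_open d j \<ge> pi\<^sup>2 / (2 * real d ^ 2 + real d)) \<and>
   (\<forall>j. \<exists>E \<in> O[sequentially](\<lambda>d. real d). \<forall>\<^sub>F d in sequentially.
      spectral_factor d j =
        (2 * real d ^ 3 - (2 * real j + 3) * real d ^ 2 + E d) / pi\<^sup>2) \<and>
   (\<forall>\<^sub>F d in sequentially. bulk_controls_mixing d) \<and>
   (\<exists>E \<in> O[sequentially](\<lambda>d. 1 / real d ^ 2). \<forall>\<^sub>F d in sequentially.
      max_spectral_factor d =
        2 * real d ^ 3 / pi\<^sup>2 * (1 - 3 / (2 * real d) + E d))"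
proof -
  have periodic: "\<exists>E \<in> O[sequentially](\<lambda>d. 1 / real d ^ 2). \<forall>\<^sub>F d in sequentially.
      gamma_periodic d = pi\<^sup>2 / real d ^ 2 * (1 + 1 / (2 * real d) + E d)"
  proof (intro bexI)
    let ?E = "\<lambda>d. gamma_periodic d * real d ^ 2 / pi\<^sup>2 - 1 - 1 / (2 * real d)"
    show "\<forall>\<^sub>F d in sequentially. gamma_periodic d = pi\<^sup>2 / real d ^ 2 * (1 + 1 / (2 * real d) + ?E d)"
      using eventually_gt_at_top[of 0] by eventually_elim simp
    show "?E \<in> O(\<lambda>d. 1 / real d ^ 2)"
    proof (rule bigoI[of _ 241])
      have lo: "\<forall>\<^sub>F d in sequentially. - (241 / real d ^ 2) \<le> (1 - 64 / real d ^ 2) * (1 + 1 / (2 * real d)) - 1 - 1 / (2 * real d)"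
        by real_asymp
      from eventually_gamma_periodic_bounds lo eventually_gt_at_top[of 0]
      show "\<forall>\<^sub>F d in sequentially. norm (?E d) \<le> 241 * norm (1 / real d ^ 2)"
      proof eventually_elim
        case (elim d)
        let ?g = "gamma_periodic d * real d ^ 2 / pi\<^sup>2"
        have c: "0 < real d ^ 2 / pi\<^sup>2" using elim(3) by simp
        have "(1 - 64 / real d ^ 2) * (1 + 1 / (2 * real d)) \<le> ?g"
          using mult_right_mono[OF elim(1)[THEN conjunct1] less_imp_le[OF c]] elim(3) by simp
        moreover have "?g \<le> 1 + 1 / (2 * real d) + 241 / real d ^ 2"
          using mult_right_mono[OF elim(1)[THEN conjunct2] less_imp_le[OF c]] elim(3) by simp
        ultimately have "- (241 / real d ^ 2) \<le> ?E d" "?E d \<le> 241 / real d ^ 2" using elim(2) by linarith+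
        thus ?case by (simp add: abs_le_iff)
      qed
    qed
  qed
  \<comment> \<open>For fixed j the deficit 3 j / (4 d^2) of the lower bound is itself of order
    d^-2; the constant 241 + j absorbs it together with 64.\<close>
  have bounds: "\<forall>\<^sub>F d in sequentially. \<bar>gamma_open d j * (2 * real d ^ 2) / pi\<^sup>2 - 1 - 3 / (2 * real d)\<bar> \<le> (241 + real j) / real d ^ 2 \<and>
      1 \<le> gamma_open d j * (2 * real d ^ 2) / pi\<^sup>2" for j
  proof -
    have lo: "\<forall>\<^sub>F d in sequentially. - ((241 + real j) / real d ^ 2) \<le>
        (1 - 64 / real d ^ 2) * (1 + 3 * (2 * real d - real j) / (4 * real d ^ 2)) - 1 - 3 / (2 * real d)"
      by real_asymp
    have one: "\<forall>\<^sub>F d in sequentially. 1 \<le> (1 - 64 / real d ^ 2) * (1 + 3 * (2 * real d - real j) / (4 * real d ^ 2))"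
      by real_asymp
    from eventually_gamma_open_bounds lo one eventually_gt_at_top[of j] show ?thesis
    proof eventually_elim
      case (elim d)
      let ?g = "gamma_open d j * (2 * real d ^ 2) / pi\<^sup>2"
      have d: "real d > 0" using elim(4) by simp
      have c: "0 < 2 * real d ^ 2 / pi\<^sup>2" using d by simp
      note b = elim(1)[rule_format, OF elim(4)]
      have l: "(1 - 64 / real d ^ 2) * (1 + 3 * (2 * real d - real j) / (4 * real d ^ 2)) \<le> ?g"
        using mult_right_mono[OF b[THEN conjunct1] less_imp_le[OF c]] d by simp
      moreover have "?g \<le> 1 + 3 / (2 * real d) + 241 / real d ^ 2"
        using mult_right_mono[OF b[THEN conjunct2] less_imp_le[OF c]] d by simp
      moreover have "241 / real d ^ 2 \<le> (241 + real j) / real d ^ 2" by (intro divide_right_mono) auto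
      ultimately have "- ((241 + real j) / real d ^ 2) \<le> ?g - 1 - 3 / (2 * real d)"
        "?g - 1 - 3 / (2 * real d) \<le> (241 + real j) / real d ^ 2" "1 \<le> ?g" using elim(2,3) by linarith+
      thus ?case by (simp add: abs_le_iff)
    qed
  qed
  have "open": "\<exists>E \<in> O[sequentially](\<lambda>d. 1 / real d ^ 2). \<forall>\<^sub>F d in sequentially.
      gamma_open d j = pi\<^sup>2 / (2 * real d ^ 2) * (1 + 3 / (2 * real d) + E d)" for j
  proof (intro bexI)
    let ?E = "\<lambda>d. gamma_open d j * (2 * real d ^ 2) / pi\<^sup>2 - 1 - 3 / (2 * real d)"
    show "\<forall>\<^sub>F d in sequentially. gamma_open d j = pi\<^sup>2 / (2 * real d ^ 2) * (1 + 3 / (2 * real d) + ?E d)"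
      using eventually_gt_at_top[of 0] by eventually_elim simp
    show "?E \<in> O(\<lambda>d. 1 / real d ^ 2)"
      by (rule bigoI[of _ "241 + real j"], rule eventually_mono[OF bounds[of j]]) simp
  qed
  \<comment> \<open>For j < d the number 2d - j exceeds d, so the gain is at least 3 / (4d), which
    outweighs the loss 64 / d^2.\<close>
  have uniform: "\<forall>\<^sub>F d in sequentially. \<forall>j<d. pi\<^sup>2 / (2 * real d ^ 2) \<le> gamma_open d j"
  proof -
    have one: "\<forall>\<^sub>F d in sequentially. 1 \<le> (1 - 64 / real d ^ 2) * (1 + 3 * real d / (4 * real d ^ 2))"
      by real_asymp
    have pos: "\<forall>\<^sub>F d in sequentially. 0 \<le> 1 - 64 / real d ^ 2" by real_asymp
    from eventually_gamma_open_bounds one pos show ?thesis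
    proof eventually_elim
      case (elim d)
      show ?case
      proof (intro allI impI)
        fix j assume j: "j < d"
        have "pi\<^sup>2 / (2 * real d ^ 2) * 1 \<le> pi\<^sup>2 / (2 * real d ^ 2) * ((1 - 64 / real d ^ 2) * (1 + 3 * real d / (4 * real d ^ 2)))"
          using elim(2) by (intro mult_left_mono) auto
        also have "\<dots> \<le> pi\<^sup>2 / (2 * real d ^ 2) * ((1 - 64 / real d ^ 2) * (1 + 3 * (2 * real d - real j) / (4 * real d ^ 2)))"
          using elim(3) j by (intro mult_left_mono add_left_mono divide_right_mono) auto
        also have "\<dots> \<le> gamma_open d j" using elim(1) j by blast
        finally show "pi\<^sup>2 / (2 * real d ^ 2) \<le> gamma_open d j" by simp
      qed
    qed
  qed
  have third: "\<forall>\<^sub>F d in sequentially. \<forall>j<d. gamma_open d j \<ge> pi\<^sup>2 / (2 * real d ^ 2 + real d)"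
    using uniform
  proof eventually_elim
    case (elim d)
    show ?case
    proof (intro allI impI)
      fix j assume j: "j < d"
      have "pi\<^sup>2 / (2 * real d ^ 2 + real d) \<le> pi\<^sup>2 / (2 * real d ^ 2)"
        using j by (intro divide_left_mono) (auto intro!: mult_pos_pos add_pos_pos)
      thus "gamma_open d j \<ge> pi\<^sup>2 / (2 * real d ^ 2 + real d)" using elim j by (meson order_trans)
    qed
  qed
  define F where "F j d = spectral_factor d j * pi\<^sup>2 - (2 * real d ^ 3 - (2 * real j + 3) * real d ^ 2)" for j d
  have F_eq: "spectral_factor d j = (2 * real d ^ 3 - (2 * real j + 3) * real d ^ 2 + F j d) / pi\<^sup>2" for j d
    by (simp add: F_def)
  \<comment> \<open>The constant collects 9/2 + 3 j from the product of the two first-order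
    corrections and 482 + 2 j from the error in \<open>gamma_open\<close>. Dimensions above j + 3
    ensure 2 j + 3 <= 2 d, hence the bound on \<open>T\<close>.\<close>
  have F_bound: "\<forall>\<^sub>F d in sequentially. \<bar>F j d\<bar> \<le> (490 + 5 * real j) * real d" for j
    using bounds[of j] eventually_gt_at_top[of "j + 3"]
  proof eventually_elim
    case (elim d)
    define x where "x = gamma_open d j * (2 * real d ^ 2) / pi\<^sup>2"
    define e where "e = x - 1 - 3 / (2 * real d)"
    define T where "T = 2 * real d ^ 3 - (2 * real j + 3) * real d ^ 2"
    have d: "real d > 0" using elim(2) by simp
    have x1: "1 \<le> x" and e: "\<bar>e\<bar> \<le> (241 + real j) / real d ^ 2" using elim(1) by (auto simp: x_def e_def)
    have g: "gamma_open d j = pi\<^sup>2 * x / (2 * real d ^ 2)" using d by (simp add: x_def)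
    have sf: "spectral_factor d j * pi\<^sup>2 = (2 * real d ^ 3 - 2 * real j * real d ^ 2) / x"
      unfolding spectral_factor_def g using d x1
      by (simp add: field_simps power2_eq_square power3_eq_cube)
    have xe: "x = 1 + 3 / (2 * real d) + e" by (simp add: e_def)
    have "F j d = ((2 * real d ^ 3 - 2 * real j * real d ^ 2) - T * x) / x"
      unfolding F_def sf T_def using x1 by (simp add: field_simps)
    \<comment> \<open>\<open>T\<close> is the expansion of the quotient up to order d^2, so the
      cubic and the quadratic terms cancel.\<close>
    also have "(2 * real d ^ 3 - 2 * real j * real d ^ 2) - T * x = (2 * real j + 3) * (3 / 2) * real d - e * T"
      unfolding xe T_def using d by (simp add: field_simps power2_eq_square power3_eq_cube)
    finally have Fx: "F j d = ((2 * real j + 3) * (3 / 2) * real d - e * T) / x" .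
    have T: "\<bar>T\<bar> \<le> 2 * real d ^ 3"
    proof -
      have "(2 * real j + 3) * real d ^ 2 \<le> 2 * real d * real d ^ 2"
        using elim(2) by (intro mult_right_mono) auto
      moreover have "0 \<le> (2 * real j + 3) * real d ^ 2" by simp
      moreover have "2 * real d * real d ^ 2 = 2 * real d ^ 3" by (simp add: eval_nat_numeral)
      ultimately show ?thesis unfolding T_def abs_le_iff by linarith
    qed
    have "\<bar>e * T\<bar> \<le> (241 + real j) / real d ^ 2 * (2 * real d ^ 3)"
      unfolding abs_mult using e T by (intro mult_mono) auto
    also have "\<dots> = (482 + 2 * real j) * real d"
      using d by (simp add: field_simps eval_nat_numeral)
    finally have eT: "\<bar>e * T\<bar> \<le> (482 + 2 * real j) * real d" .
    have "\<bar>F j d\<bar> = \<bar>(2 * real j + 3) * (3 / 2) * real d - e * T\<bar> / x"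
      unfolding Fx using x1 by (simp add: abs_divide)
    also have "\<dots> \<le> \<bar>(2 * real j + 3) * (3 / 2) * real d - e * T\<bar> / 1"
      using x1 by (intro divide_left_mono) auto
    also have "\<dots> \<le> \<bar>(2 * real j + 3) * (3 / 2) * real d\<bar> + \<bar>e * T\<bar>"
      unfolding div_by_1 by (rule abs_triangle_ineq4)
    also have "\<bar>(2 * real j + 3) * (3 / 2) * real d\<bar> = (2 * real j + 3) * (3 / 2) * real d" by simp
    also have "(2 * real j + 3) * (3 / 2) * real d + \<bar>e * T\<bar> \<le> (490 + 5 * real j) * real d"
      using eT d by (simp add: algebra_simps)
    finally show ?case .
  qed
  have F_bigo: "F j \<in> O(\<lambda>d. real d)" for j
    by (rule bigoI[of _ "490 + 5 * real j"], rule eventually_mono[OF F_bound[of j]]) simp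
  have fourth: "\<exists>E \<in> O[sequentially](\<lambda>d. real d). \<forall>\<^sub>F d in sequentially.
      spectral_factor d j = (2 * real d ^ 3 - (2 * real j + 3) * real d ^ 2 + E d) / pi\<^sup>2" for j
    by (rule bexI[of _ "F j"]) (use F_eq F_bigo in auto)
  \<comment> \<open>For j >= 2 the uniform bound gives at most (2 d^3 - 4 d^2) / pi^2, below the
    bulk value 2 d^3 - 3 d^2 over pi^2. At j = 1 it would only give 2 d^3 - 2 d^2, so this case
    takes its own expansion, 2 d^3 - 5 d^2.\<close>
  have bulk: "\<forall>\<^sub>F d in sequentially. max_spectral_factor d = spectral_factor d 0"
    using uniform F_bound[of 0] F_bound[of 1] eventually_gt_at_top[of 1000]
  proof eventually_elim
    case (elim d)
    have d: "real d > 1000" using elim(4) by simp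
    have dd: "1000 * real d \<le> real d * real d" using d by (intro mult_right_mono) auto
    have F: "- (490 * real d) \<le> F 0 d" "F 1 d \<le> 495 * real d"
      using elim(2,3) by (simp_all add: abs_le_iff)
    have le: "spectral_factor d j \<le> spectral_factor d 0" if j: "j < d" for j
    proof -
      consider "j = 0" | "j = 1" | "j \<ge> 2" by linarith
      thus ?thesis
      proof cases
        case 1 thus ?thesis by simp
      next
        case 2
        have "F 1 d - 5 * real d ^ 2 \<le> F 0 d - 3 * real d ^ 2"
          using F dd d unfolding power2_eq_square by linarith
        thus ?thesis unfolding 2 F_eq by (intro divide_right_mono) auto
      next
        case 3
        have g: "pi\<^sup>2 / (2 * real d ^ 2) \<le> gamma_open d j" using elim(1) j by blast
        have p: "0 < pi\<^sup>2 / (2 * real d ^ 2)" using d by simp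
        have "spectral_factor d j \<le> (real d - real j) / (pi\<^sup>2 / (2 * real d ^ 2))"
          unfolding spectral_factor_def using j by (intro divide_left_mono mult_pos_pos g p less_le_trans[OF p g]) auto
        also have "\<dots> \<le> (real d - 2) / (pi\<^sup>2 / (2 * real d ^ 2))"
          using p 3 by (intro divide_right_mono) auto
        also have "\<dots> = (2 * real d ^ 3 - 4 * real d ^ 2) / pi\<^sup>2"
          by (simp add: algebra_simps eval_nat_numeral)
        also have "\<dots> \<le> spectral_factor d 0"
        proof -
          have "- (4 * real d ^ 2) \<le> F 0 d - 3 * real d ^ 2"
            using F dd d unfolding power2_eq_square by linarith
          thus ?thesis unfolding F_eq by (intro divide_right_mono) auto
        qed
        finally show ?thesis .
      qed
    qed
    show ?case unfolding max_spectral_factor_def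
      by (rule Max_eqI) (use le elim(4) in auto)
  qed
  have sixth: "\<exists>E \<in> O[sequentially](\<lambda>d. 1 / real d ^ 2). \<forall>\<^sub>F d in sequentially.
      max_spectral_factor d = 2 * real d ^ 3 / pi\<^sup>2 * (1 - 3 / (2 * real d) + E d)"
  proof (intro bexI)
    let ?E = "\<lambda>d. F 0 d / (2 * real d ^ 3)"
    show "\<forall>\<^sub>F d in sequentially. max_spectral_factor d = 2 * real d ^ 3 / pi\<^sup>2 * (1 - 3 / (2 * real d) + ?E d)"
      using bulk eventually_gt_at_top[of 0]
    proof eventually_elim
      case (elim d)
      have d: "real d > 0" using elim(2) by simp
      have "max_spectral_factor d = (2 * real d ^ 3 - 3 * real d ^ 2 + F 0 d) / pi\<^sup>2"
        unfolding elim(1) F_eq by simp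
      also have "2 * real d ^ 3 - 3 * real d ^ 2 + F 0 d = 2 * real d ^ 3 * (1 - 3 / (2 * real d) + ?E d)"
        using d by (simp add: field_simps eval_nat_numeral)
      finally show ?case by simp
    qed
    show "?E \<in> O(\<lambda>d. 1 / real d ^ 2)"
    proof (rule bigoI[of _ 245])
      show "\<forall>\<^sub>F d in sequentially. norm (?E d) \<le> 245 * norm (1 / real d ^ 2)"
        using F_bound[of 0] eventually_gt_at_top[of 0]
      proof eventually_elim
        case (elim d)
        have d: "real d > 0" using elim(2) by simp
        have "norm (?E d) = \<bar>F 0 d\<bar> / (2 * real d ^ 3)" by (simp add: abs_mult power_abs)
        also have "\<dots> \<le> (490 * real d) / (2 * real d ^ 3)" using elim(1) by (intro divide_right_mono) auto
        also have "\<dots> = 245 * norm (1 / real d ^ 2)" using d by (simp add: field_simps eval_nat_numeral)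
        finally show ?case .
      qed
    qed
  qed
  from periodic "open" third fourth bulk sixth show ?thesis
    unfolding bulk_controls_mixing_def by blast
qed

end
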